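(* Every theta graph is determined by its $L$-spectrum. That is, for all integers $r\ge s\ge t\ge 0$ with $(s,t)\ne(0,0)$, every finite simple undirected graph that has the same $L$-spectrum as $\Theta_{r,s,t}$ is isomorphic to $\Theta_{r,s,t}$.
   Context: All graphs are finite, simple and undirected. For a graph $G$ with vertices $v_1,\dots,v_n$, the Laplacian matrix is $L(G)=D(G)-A(G)$, where $A(G)$ is the adjacency matrix and $D(G)$ is the diagonal matrix of vertex degrees. The $L$-spectrum of $G$ is the multiset of eigenvalues of $L(G)$. Two graphs are $L$-cospectral if they have the same $L$-spectrum. A graph is determined by its $L$-spectrum if every graph $L$-cospectral with it is isomorphic to it. $P_n$ denotes the path on $n$ vertices. The theta graph $\Theta_{r,s,t}$ (with $r\ge s\ge t\ge 0$ and $(s,t)\ne(0,0)$) is the graph formed by joining two given distinct vertices $u,v$ via three disjoint paths $P_r$, $P_s$, $P_t$. That is, $u$ and $v$ are connected by three internally disjoint $u$–$v$ paths having exactly $r$, $s$ and $t$ internal vertices respectively (0 internal vertices means the edge $uv$). It has $r+s+t+2$ vertices. *)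

theory Defs
  imports
    "HOL-Library.Multiset"
    "HOL-Computational_Algebra.Polynomial"
    "Graph_Theory.Graph_Theory"
    "Jordan_Normal_Form.Char_Poly"
begin

section \<open>Laplacian spectrum\<close>

text \<open>
  A finite simple undirected graph is a pair digraph satisfying the locale predicate
  \<open>pair_graph\<close> (finite, loop-free, symmetric arc relation): the undirected edge
  joining \<open>u\<close> and \<open>v\<close> is the pair of arcs \<open>(u, v)\<close>, \<open>(v, u)\<close>, so that the degree
  of a vertex is its out-degree.

  The matrices are taken with respect to an enumeration \<open>vs\<close> of the vertices, i.e. a
  distinct list whose set of elements is the vertex set.  Their entries are complex
  so that the roots of the characteristic polynomial, counted with multiplicity, are
  all the eigenvalues.
\<close>

definition adjacency_mat :: "'a pair_pre_digraph \<Rightarrow> 'a list \<Rightarrow> complex mat" where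
  "adjacency_mat G vs = mat (length vs) (length vs)
     (\<lambda>(i, j). if (vs ! i, vs ! j) \<in> parcs G then 1 else 0)"

definition degree_mat :: "'a pair_pre_digraph \<Rightarrow> 'a list \<Rightarrow> complex mat" where
  "degree_mat G vs = mat (length vs) (length vs)
     (\<lambda>(i, j). if i = j then of_nat (out_degree (with_proj G) (vs ! i)) else 0)"

definition laplacian_mat :: "'a pair_pre_digraph \<Rightarrow> 'a list \<Rightarrow> complex mat" where
  "laplacian_mat G vs = degree_mat G vs - adjacency_mat G vs"

text \<open>The choice of the enumeration is irrelevant; see \<open>L_spectrum_eq\<close> below.\<close>

definition L_spectrum :: "'a pair_pre_digraph \<Rightarrow> complex multiset" where
  "L_spectrum G =
     proots (char_poly (laplacian_mat G (SOME vs. distinct vs \<and> set vs = pverts G)))"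

definition L_cospectral :: "'a pair_pre_digraph \<Rightarrow> 'b pair_pre_digraph \<Rightarrow> bool" where
  "L_cospectral G H \<longleftrightarrow> L_spectrum G = L_spectrum H"

lemma laplacian_mat_index:
  assumes "i < length vs" "j < length vs"
  shows "laplacian_mat G vs $$ (i, j) =
    (if i = j then of_nat (out_degree (with_proj G) (vs ! i)) else 0)
      - (if (vs ! i, vs ! j) \<in> parcs G then 1 else 0)"
  using assms by (simp add: laplacian_mat_def degree_mat_def adjacency_mat_def)

lemma laplacian_mat_carrier:
  "laplacian_mat G vs \<in> carrier_mat (length vs) (length vs)"
  by (auto simp: laplacian_mat_def degree_mat_def adjacency_mat_def intro!: minus_carrier_mat)

lemma similar_laplacian_mat:
  assumes vs: "distinct vs" and ws: "distinct ws" and eq: "set vs = set ws"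
  shows "similar_mat (laplacian_mat G vs) (laplacian_mat G ws)"
proof -
  define n where "n = length vs"
  have n': "length ws = n"
    using vs ws eq unfolding n_def by (metis distinct_card)
  have "\<forall>i<n. \<exists>k<n. ws ! k = vs ! i"
    using eq n' unfolding n_def by (metis in_set_conv_nth nth_mem)
  then obtain f where f: "\<And>i. i < n \<Longrightarrow> f i < n" "\<And>i. i < n \<Longrightarrow> ws ! f i = vs ! i"
    by metis
  have inj: "inj_on f {..<n}"
    using f(2) vs by (intro inj_onI) (metis lessThan_iff n_def nth_eq_iff_index_eq)
  have img: "f ` {..<n} = {..<n}"
    using inj f(1) by (intro endo_inj_surj) auto
  have inj': "f i = f j \<longleftrightarrow> i = j" if "i < n" "j < n" for i j
    using inj that by (auto dest: inj_onD)
  define P :: "complex mat" where "P = mat n n (\<lambda>(i, k). if k = f i then 1 else 0)"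
  define Q :: "complex mat" where "Q = mat n n (\<lambda>(k, i). if k = f i then 1 else 0)"
  let ?A = "laplacian_mat G vs" and ?B = "laplacian_mat G ws"
  have A: "?A \<in> carrier_mat n n" and B: "?B \<in> carrier_mat n n"
    using laplacian_mat_carrier[of G vs] laplacian_mat_carrier[of G ws]
    by (simp_all add: n_def[symmetric] n')
  have P: "P \<in> carrier_mat n n" and Q: "Q \<in> carrier_mat n n"
    by (simp_all add: P_def Q_def)
  have PQ: "P * Q = 1\<^sub>m n"
  proof (rule eq_matI)
    fix i j assume ij: "i < dim_row (1\<^sub>m n)" "j < dim_col (1\<^sub>m n)"
    have "(P * Q) $$ (i, j) =
        (\<Sum>k\<in>{0..<n}. (if k = f i then 1 else 0) * (if k = f j then 1 else 0))"
      using ij by (simp add: P_def Q_def scalar_prod_def)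
    also have "\<dots> = (\<Sum>k\<in>{0..<n}. if k = f i then (if k = f j then 1 else 0) else 0)"
      by (intro sum.cong) auto
    also have "\<dots> = 1\<^sub>m n $$ (i, j)"
      using ij f(1) inj'[of i j] by (simp add: sum.delta)
    finally show "(P * Q) $$ (i, j) = 1\<^sub>m n $$ (i, j)" .
  qed (auto simp: P_def Q_def)
  have QP: "Q * P = 1\<^sub>m n"
    by (rule mat_mult_left_right_inverse[OF P Q PQ])
  have PB: "(P * ?B) $$ (i, j) = ?B $$ (f i, j)" if ij: "i < n" "j < n" for i j
  proof -
    have "(P * ?B) $$ (i, j) = (\<Sum>k\<in>{0..<n}. (if k = f i then 1 else 0) * ?B $$ (k, j))"
      using ij B by (simp add: P_def scalar_prod_def)
    also have "\<dots> = (\<Sum>k\<in>{0..<n}. if k = f i then ?B $$ (k, j) else 0)"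
      by (intro sum.cong) auto
    also have "\<dots> = ?B $$ (f i, j)"
      using ij f(1) by (simp add: sum.delta)
    finally show ?thesis .
  qed
  have "?A = P * ?B * Q"
  proof (rule eq_matI)
    fix i j assume "i < dim_row (P * ?B * Q)" "j < dim_col (P * ?B * Q)"
    then have ij: "i < n" "j < n" by (simp_all add: P_def Q_def)
    have "(P * ?B * Q) $$ (i, j) =
        (\<Sum>k\<in>{0..<n}. (P * ?B) $$ (i, k) * (if k = f j then 1 else 0))"
      using ij P B by (simp add: Q_def scalar_prod_def)
    also have "\<dots> = (\<Sum>k\<in>{0..<n}. if k = f j then ?B $$ (f i, k) else 0)"
      using ij by (intro sum.cong) (auto simp: PB)
    also have "\<dots> = ?B $$ (f i, f j)"
      using ij f(1) by (simp add: sum.delta)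
    also have "\<dots> = ?A $$ (i, j)"
      using ij f inj'[of i j] n' by (simp add: laplacian_mat_index n_def[symmetric])
    finally show "?A $$ (i, j) = (P * ?B * Q) $$ (i, j)" by simp
  qed (use A B P Q in auto)
  then show ?thesis
    using A B P Q PQ QP by (intro similar_matI[of _ _ P Q n]) auto
qed

lemma L_spectrum_eq:
  assumes "distinct vs" "set vs = pverts G"
  shows "L_spectrum G = proots (char_poly (laplacian_mat G vs))"
proof -
  let ?ws = "SOME vs. distinct vs \<and> set vs = pverts G"
  have "distinct ?ws \<and> set ?ws = pverts G"
    by (rule someI[of _ vs]) (use assms in simp)
  then have "similar_mat (laplacian_mat G ?ws) (laplacian_mat G vs)"
    using assms by (intro similar_laplacian_mat) simp_all
  from char_poly_similar[OF this] show ?thesis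
    unfolding L_spectrum_def by (rule arg_cong)
qed

section \<open>Theta graphs\<close>

text \<open>The edges of the path with vertex sequence \<open>xs\<close>, as a symmetric relation.\<close>

definition path_edges :: "'a list \<Rightarrow> 'a rel" where
  "path_edges xs = set (zip xs (tl xs)) \<union> (set (zip xs (tl xs)))\<inverse>"

text \<open>
  The two branch vertices are \<open>0\<close> and \<open>1\<close>; the three intervals are the consecutive
  internal vertices of the three paths joining them.  An empty interval gives the edge
  between \<open>0\<close> and \<open>1\<close>.
\<close>

definition theta_graph :: "nat \<Rightarrow> nat \<Rightarrow> nat \<Rightarrow> nat pair_pre_digraph" where
  "theta_graph r s t =
     \<lparr> pverts = {..<r + s + t + 2},
       parcs = path_edges (0 # [2..<2 + r] @ [1])
             \<union> path_edges (0 # [2 + r..<2 + r + s] @ [1])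
             \<union> path_edges (0 # [2 + r + s..<2 + r + s + t] @ [1]) \<rparr>"

lemma path_edges_subset: "path_edges xs \<subseteq> set xs \<times> set xs"
proof -
  have "set (tl xs) \<subseteq> set xs" by (cases xs) auto
  then show ?thesis
    by (auto simp: path_edges_def dest: set_zip_leftD set_zip_rightD)
qed

lemma path_edges_irrefl:
  assumes "distinct xs"
  shows "(x, x) \<notin> path_edges xs"
  using assms
  by (auto simp: path_edges_def set_zip nth_tl nth_eq_iff_index_eq)

lemma sym_path_edges: "sym (path_edges xs)"
  by (auto simp: path_edges_def sym_def)

lemma pair_graph_theta_graph: "pair_graph (theta_graph r s t)"
proof -
  let ?p = "0 # [2..<2 + r] @ [1]" and ?q = "0 # [2 + r..<2 + r + s] @ [1]"
    and ?w = "0 # [2 + r + s..<2 + r + s + t] @ [1]"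
  let ?G = "theta_graph r s t"
  have path: "path_edges xs \<subseteq> V \<times> V" if "set xs \<subseteq> V" for xs and V :: "nat set"
    using path_edges_subset[of xs] Sigma_mono[OF that that] by (rule subset_trans)
  have sub: "parcs ?G \<subseteq> pverts ?G \<times> pverts ?G"
    unfolding theta_graph_def pair_pre_digraph.simps
    by (intro Un_least path) auto
  have fin: "finite (pverts ?G)"
    by (simp add: theta_graph_def)
  have irrefl: "(x, x) \<notin> parcs ?G" for x
    by (simp add: theta_graph_def path_edges_irrefl del: upt_Suc)
  have "sym (parcs ?G)"
    by (simp add: theta_graph_def sym_Un sym_path_edges del: upt_Suc)
  moreover have "finite (parcs ?G)"
    using finite_subset[OF sub finite_cartesian_product[OF fin fin]] .
  ultimately show ?thesis
    using sub irrefl fin by unfold_locales (auto simp: symmetric_def)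
qed

end

theory Submission
  imports Defs "Jordan_Normal_Form.Schur_Decomposition"
begin

text \<open>
  The traces of \<open>L\<close> and \<open>L\<^sup>2\<close> give \<open>\<Sum>(d - 2)(d - 3) = 0\<close> over the degrees of a
  cospectral mate, so it has two vertices of degree 3 and all others have degree 2.
  A disconnected graph has \<open>0\<close> as a multiple Laplacian eigenvalue, whereas
  \<open>det (L + \<epsilon>) \<ge> 2\<epsilon>\<close> for a theta graph; hence the mate is connected, and it is a theta
  graph or a dumbbell (two disjoint cycles joined by a path).

  Eliminating the vertices of degree 2 along a path reduces \<open>det (L - \<mu>)\<close> to a 2 by 2
  determinant.  With \<open>\<mu> = 2 - z - 1/z\<close> it becomes, up to a factor depending only on the
  number of vertices, a polynomial in \<open>z\<close>.  Besides \<open>-(1 + 2z)\<^sup>2\<close>, its low order terms are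
  those of
  \<open>z\<^bsup>2a+2\<^esup> + z\<^bsup>2b+2\<^esup> + z\<^bsup>2c+2\<^esup> + 2(1 + z)\<^sup>2(z\<^bsup>a+b\<^esup> + z\<^bsup>b+c\<^esup> + z\<^bsup>a+c\<^esup>)\<close>
  for a theta graph with path lengths \<open>a \<ge> b \<ge> c\<close>, and those of
  \<open>z\<^bsup>2l+2\<^esup> + (2 + 6z + 4z\<^sup>2)(z\<^bsup>p\<^esup> + z\<^bsup>q\<^esup>)\<close>
  for a dumbbell with cycle lengths \<open>p \<le> q\<close> and path length \<open>l\<close>.  The lowest exponents
  recover the lengths of a theta graph and exclude a dumbbell.
\<close>

section \<open>Determinants by elimination of vertices of degree two\<close>

text \<open>Once the degrees are known, the comparison works with values of det (L - \<mu>) at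
  negative \<mu>, that is q = 2 - \<mu> > 2. There every pivot of the elimination is positive, so no
  division by zero can occur, and z may run through all of (0, 1), so that equal values become an
  identity of polynomials. Passing to z turns a path of length m into the power z^m: lengths become
  exponents and can be read off.

  A dumbbell can have the same number of vertices and the same degrees as a theta graph, so the
  traces do not separate the two; the coefficients do. Connectedness is also invisible to the traces
  and needs its own argument: two components would make det (L + \<epsilon>) of order \<epsilon>^2,
  against the linear lower bound.

  Both ends of a path may be the same vertex, and several paths may share both ends, so elimination
  leads out of simple graphs. The intermediate matrices are therefore described by lists of paths
  and not by edge relations.\<close>

definition idx_mat :: "('v \<Rightarrow> 'v \<Rightarrow> 'a) \<Rightarrow> 'v list \<Rightarrow> 'a mat" where
  "idx_mat M vs = mat (length vs) (length vs) (\<lambda>(i, j). M (vs ! i) (vs ! j))"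

lemma idx_mat_carrier [simp]: "idx_mat M vs \<in> carrier_mat (length vs) (length vs)"
  by (simp add: idx_mat_def)

lemma idx_mat_cong:
  assumes "\<And>x y. x \<in> set vs \<Longrightarrow> y \<in> set vs \<Longrightarrow> M x y = N x y"
  shows "idx_mat M vs = idx_mat N vs"
  using assms by (auto simp: idx_mat_def)

text \<open>A block factorisation with unit lower triangular left factor; the remaining block is the
  Schur complement of the pivot \<open>M w w\<close>. Since entries are indexed by vertices,
  elimination drops the head of the list without renumbering the rest.\<close>

lemma det_idx_mat_Cons:
  fixes M :: "'v \<Rightarrow> 'v \<Rightarrow> 'a::field"
  assumes "M w w \<noteq> 0"
  shows "det (idx_mat M (w # ws)) =
    M w w * det (idx_mat (\<lambda>x y. M x y - M x w * M w y / M w w) ws)"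
proof -
  define n where "n = length ws"
  define N where "N = idx_mat (\<lambda>x y. M x y - M x w * M w y / M w w) ws"
  define C where "C = mat n 1 (\<lambda>(i, j). M (ws ! i) w / M w w)"
  define A where "A = mat 1 1 (\<lambda>(i, j). M w w)"
  define B where "B = mat 1 n (\<lambda>(i, j). M w (ws ! j))"
  have N: "N \<in> carrier_mat n n" and C: "C \<in> carrier_mat n 1"
    and A: "A \<in> carrier_mat 1 1" and B: "B \<in> carrier_mat 1 n"
    by (simp_all add: N_def C_def A_def B_def n_def)
  let ?P = "four_block_mat (1\<^sub>m 1) (0\<^sub>m 1 n) C (1\<^sub>m n)"
  let ?Q = "four_block_mat A B (0\<^sub>m n 1) N"
  have "?P * ?Q = four_block_mat (1\<^sub>m 1 * A + 0\<^sub>m 1 n * 0\<^sub>m n 1) (1\<^sub>m 1 * B + 0\<^sub>m 1 n * N)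
      (C * A + 1\<^sub>m n * 0\<^sub>m n 1) (C * B + 1\<^sub>m n * N)"
    using A B C N by (intro mult_four_block_mat) auto
  also have "\<dots> = four_block_mat A B (C * A) (C * B + N)"
    using A B C N by simp
  also have "\<dots> = idx_mat M (w # ws)"
  proof (rule eq_matI)
    fix i j assume "i < dim_row (idx_mat M (w # ws))" "j < dim_col (idx_mat M (w # ws))"
    then have ij: "i < Suc n" "j < Suc n" by (auto simp: idx_mat_def n_def)
    have "four_block_mat A B (C * A) (C * B + N) $$ (i, j) =
      (if i < 1 then if j < 1 then A $$ (i, j) else B $$ (i, j - 1)
       else if j < 1 then (C * A) $$ (i - 1, j) else (C * B + N) $$ (i - 1, j - 1))"
      using ij A B C N by (subst index_mat_four_block(1)) (auto simp: Suc_diff_le)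
    also have "\<dots> = idx_mat M (w # ws) $$ (i, j)"
      using ij assms
      by (cases i; cases j)
        (auto simp: A_def B_def C_def N_def idx_mat_def scalar_prod_def n_def)
    finally show "four_block_mat A B (C * A) (C * B + N) $$ (i, j) =
      idx_mat M (w # ws) $$ (i, j)" .
  qed (use A B C N in \<open>auto simp: idx_mat_def n_def\<close>)
  finally have eq: "idx_mat M (w # ws) = ?P * ?Q" by simp
  have "det (?P * ?Q) = det ?P * det ?Q"
    by (rule det_mult[of _ "1 + n"]) (use A B C N in auto)
  also have "det ?P = det (1\<^sub>m 1 :: 'a mat) * det (1\<^sub>m n :: 'a mat)"
    by (rule det_four_block_mat_upper_right_zero) (use C in auto)
  also have "det ?Q = det A * det N"
    by (rule det_four_block_mat_lower_left_zero) (use A B N in auto)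
  also have "det A = M w w"
    by (simp add: A_def det_def)
  finally show ?thesis
    by (simp add: eq N_def)
qed

lemma det_idx_mat_2:
  fixes M :: "'v \<Rightarrow> 'v \<Rightarrow> 'a::comm_ring_1"
  shows "det (idx_mat M [u, v]) = M u u * M v v - M u v * M v u"
proof -
  have "det (idx_mat M [u, v]) = (\<Sum>j<2. idx_mat M [u, v] $$ (0, j) * cofactor (idx_mat M [u,
      v]) 0 j)"
    using laplace_expansion_row[of "idx_mat M [u, v]" 2 0] idx_mat_carrier[of M "[u, v]"]
    by (simp add: numeral_2_eq_2)
  then show ?thesis
    by (simp add: numeral_2_eq_2 cofactor_def mat_delete_def idx_mat_def det_single)
qed

text \<open>The Chebyshev polynomial of the second kind U_(k-1) at q/2.
  \<open>cheb q (Suc k)\<close> is the determinant of the tridiagonal matrix of a path with k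
  vertices, with q on the diagonal and -1 beside it.\<close>

fun cheb :: "'a::comm_ring_1 \<Rightarrow> nat \<Rightarrow> 'a" where
  "cheb q 0 = 0"
| "cheb q (Suc 0) = 1"
| "cheb q (Suc (Suc k)) = q * cheb q (Suc k) - cheb q k"

declare cheb.simps(3) [simp del]

text \<open>In terms of path determinants: expansion along the edge that separates the first i
  vertices from the last j.\<close>

lemma cheb_add:
  "cheb q (Suc (i + j)) = cheb q (Suc i) * cheb q (Suc j) - cheb q i * cheb q j"
proof (induction j rule: induct_nat_012)
  case (ge2 n)
  have "cheb q (Suc (i + Suc (Suc n))) = q * cheb q (Suc (i + Suc n)) - cheb q (Suc (i + n))"
    by (simp add: cheb.simps(3))
  also have "\<dots> = cheb q (Suc i) * (q * cheb q (Suc (Suc n)) - cheb q (Suc n))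
      - cheb q i * (q * cheb q (Suc n) - cheb q n)"
    unfolding ge2.IH by (simp only: algebra_simps)
  finally show ?case
    by (simp add: cheb.simps(3))
qed (auto simp: cheb.simps(3))

text \<open>The form x^2 - q x y + y^2 is invariant under the shift (x, y) to (q x - y, x) and has
  the value 1 at the start.\<close>

lemma cheb_square: "cheb q (Suc i) ^ 2 - q * cheb q (Suc i) * cheb q i + cheb q i ^ 2 = 1"
  by (induction i) (auto simp: cheb.simps(3) power2_eq_square algebra_simps)

text \<open>The two identities behind joining paths in series: the first yields the pivot at the
  common vertex, the second the new diagonal correction at an outer end.\<close>

lemma cheb_series:
  fixes q :: "'a::comm_ring_1"
  shows "q * cheb q (Suc i) * cheb q (Suc j) - cheb q i * cheb q (Suc j) - cheb q (Suc i) * cheb q j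
      = cheb q (Suc (Suc (i + j)))" (is ?A)
    and "cheb q (Suc (i + j)) * cheb q (Suc i) - cheb q i * cheb q (Suc (Suc (i + j)))
      = cheb q (Suc j)" (is ?B)
proof -
  have 1: "cheb q (Suc (Suc (i + j))) = cheb q (Suc (Suc i)) * cheb q (Suc j) - cheb q (Suc i)
      * cheb q j"
    using cheb_add[of q "Suc i" j] by simp
  show ?A
    unfolding 1 by (simp add: cheb.simps(3) algebra_simps)
  have "cheb q (Suc (i + j)) * cheb q (Suc i) - cheb q i * cheb q (Suc (Suc (i + j)))
     = (cheb q (Suc i) ^ 2 - q * cheb q (Suc i) * cheb q i + cheb q i ^ 2) * cheb q (Suc j)"
    unfolding 1 cheb_add by (simp add: cheb.simps(3) power2_eq_square algebra_simps)
  then show ?B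
    by (simp add: cheb_square)
qed

text \<open>
  The triple \<open>(x, k, y)\<close> stands for a path from \<open>x\<close> to \<open>y\<close> whose \<open>k\<close> inner vertices have been
  eliminated: its Schur complement subtracts \<open>cheb q k / cheb q (k + 1)\<close> from the diagonal
  entries of both ends and \<open>1 / cheb q (k + 1)\<close> from the entries between them, where
  \<open>q = 2 - \<mu>\<close>.  A closed path (\<open>x = y\<close>) is allowed.
\<close>

definition edge_coeff :: "'a::field \<Rightarrow> 'v \<times> nat \<times> 'v \<Rightarrow> 'v \<Rightarrow> 'v \<Rightarrow> 'a" where
  "edge_coeff q e i j = (case e of (x, k, y) \<Rightarrow>
     ((if i = j then of_bool (i = x) + of_bool (i = y) else 0) * cheb q k
       + of_bool (i = x \<and> j = y) + of_bool (i = y \<and> j = x)) / cheb q (Suc k))"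

definition chain_mat :: "'a::field \<Rightarrow> ('v \<Rightarrow> 'a) \<Rightarrow> ('v \<times> nat \<times> 'v) list \<Rightarrow> 'v \<Rightarrow> 'v \<Rightarrow> 'a" where
  "chain_mat q \<delta> E i j = (if i = j then \<delta> i else 0) - (\<Sum>e\<leftarrow>E. edge_coeff q e i j)"

lemma chain_mat_cong_mset: "mset E = mset F \<Longrightarrow> chain_mat q \<delta> E = chain_mat q \<delta> F"
  unfolding chain_mat_def fun_eq_iff by (metis mset_map sum_mset_sum_list)

lemma edge_coeff:
  "edge_coeff q (x, k, y) i j = ((if i = j then of_bool (i = x) + of_bool (i = y) else 0) * cheb q k
    + of_bool (i = x \<and> j = y) + of_bool (i = y \<and> j = x)) / cheb q (Suc k)"
  by (simp add: edge_coeff_def)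

lemma edge_coeff_eq_0:
  assumes "i \<notin> {fst e, snd (snd e)} \<or> j \<notin> {fst e, snd (snd e)}"
  shows "edge_coeff q e i j = 0"
proof -
  obtain x k y where e: "e = (x, k, y)"
    by (cases e)
  consider "i \<noteq> x" "i \<noteq> y" "i \<noteq> j" | "j \<noteq> x" "j \<noteq> y" "i \<noteq> j" | "j \<noteq> x" "j \<noteq> y" "j = i"
    using assms unfolding e by auto
  then show ?thesis
    unfolding e edge_coeff_def by cases simp_all
qed

text \<open>The vertex w lies only on the two listed paths, so its elimination changes only entries
  at x and y, and \<open>cheb_series\<close> identifies the change as that of one longer path. The
  pivot is \<open>cheb q (Suc (Suc (i + j)))\<close> over the two factors on the left.\<close>

lemma det_chain_mat_merge:
  fixes q :: "'a::field"
  assumes nz: "\<And>k. cheb q (Suc k) \<noteq> 0" and \<delta>: "\<delta> w = q"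
    and w: "w \<notin> set ws" "x \<noteq> w" "y \<noteq> w" "\<And>e. e \<in> set E \<Longrightarrow> fst e \<noteq> w \<and> snd (snd e) \<noteq> w"
  shows "cheb q (Suc i) * cheb q (Suc j) * det (idx_mat (chain_mat q \<delta> ((x, i, w) # (w, j,
      y) # E)) (w # ws))
    = cheb q (Suc (Suc (i + j))) * det (idx_mat (chain_mat q \<delta> ((x, Suc (i + j), y) # E)) ws)"
proof -
  let ?M = "chain_mat q \<delta> ((x, i, w) # (w, j, y) # E)"
  let ?N = "chain_mat q \<delta> ((x, Suc (i + j), y) # E)"
  define sa ta sb tb S R where "sa = cheb q (Suc i)" and "ta = cheb q i" and "sb = cheb q (Suc j)"
    and "tb = cheb q j" and "S = cheb q (Suc (Suc (i + j)))" and "R = cheb q (Suc (i + j))"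
  note defs = sa_def[symmetric] ta_def[symmetric] sb_def[symmetric] tb_def[symmetric]
    S_def[symmetric] R_def[symmetric]
  have nz': "sa \<noteq> 0" "sb \<noteq> 0" "S \<noteq> 0"
    using nz by (simp_all add: sa_def sb_def S_def)
  have id: "q * sa * sb - ta * sb - sa * tb = S" "R * sa - ta * S = sb" "R * sb - tb * S = sa"
    using cheb_series[of q i j] cheb_series(2)[of q j i]
    by (simp_all add: sa_def ta_def sb_def tb_def S_def R_def add.commute)
  have E0: "(\<Sum>e\<leftarrow>E. edge_coeff q e i' j') = 0" if "i' = w \<or> j' = w" for i' j'
  proof (rule sum_list_neutral)
    fix c assume "c \<in> set (map (\<lambda>e. edge_coeff q e i' j') E)"
    then obtain e where "e \<in> set E" "c = edge_coeff q e i' j'"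
      by auto
    with that w(4)[of e] show "c = 0"
      by (auto intro: edge_coeff_eq_0)
  qed
  have "?M w w = q - ta / sa - tb / sb"
    using w(2,3) \<delta> by (simp add: chain_mat_def E0 edge_coeff defs)
  also have "\<dots> = (q * sa * sb - ta * sb - sa * tb) / (sa * sb)"
    using nz' by (simp add: diff_divide_distrib)
  finally have ww: "?M w w = S / (sa * sb)"
    by (simp only: id)
  have Mw: "?M z w = - (of_bool (z = x) / sa + of_bool (z = y) / sb)"
           "?M w z = - (of_bool (z = x) / sa + of_bool (z = y) / sb)" if "z \<noteq> w" for z
    using that w(2,3)
    by (cases "z = x"; cases "z = y"; simp add: chain_mat_def E0 edge_coeff defs
        add_divide_distrib)+
  have red: "?M a b - ?M a w * ?M w b / ?M w w = ?N a b" if "a \<noteq> w" "b \<noteq> w" for a b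
  proof -
    \<comment> \<open>Indicators are kept as field elements, so that one computation covers both x =
      y and distinct x and y.\<close>
    define bx by' cx cy :: 'a where "bx = of_bool (a = x)" and "by' = of_bool (a = y)"
      and "cx = of_bool (b = x)" and "cy = of_bool (b = y)"
    define d :: 'a where "d = of_bool (a = b)"
    have "sb / (sa * S) = (R * sa - ta * S) / (sa * S)" "sa / (sb * S) = (R * sb - tb * S) / (sb
        * S)"
      by (simp_all only: id)
    then have RR: "sb / (sa * S) = R / S - ta / sa" "sa / (sb * S) = R / S - tb / sb"
      using nz' by (simp_all add: diff_divide_distrib)
    have 1: "edge_coeff q (x, i, w) a b = d * bx * ta / sa"
      using that by (simp add: edge_coeff bx_def d_def defs)
    have 2: "edge_coeff q (w, j, y) a b = d * by' * tb / sb"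
      using that by (simp add: edge_coeff by'_def d_def defs)
    have 3: "edge_coeff q (x, Suc (i + j), y) a b = (d * (bx + by') * R + bx * cy + by' * cx) / S"
      by (simp add: edge_coeff of_bool_conj bx_def by'_def cx_def cy_def d_def defs)
    \<comment> \<open>Two indicators of the same end multiply to a diagonal term; this is where the
      diagonal part of \<open>edge_coeff\<close> comes from.\<close>
    have prods: "bx * cx = d * bx" "by' * cy = d * by'"
      by (auto simp: bx_def by'_def cx_def cy_def d_def)
    have "(bx / sa + by' / sb) * (cx / sa + cy / sb) / (S / (sa * sb)) =
        (bx * cx) * (sb / (sa * S)) + (by' * cy) * (sa / (sb * S)) + (bx * cy + by' * cx) / S"
      using nz' by (simp add: add_divide_distrib ring_distribs mult.assoc)
    also have "\<dots> = d * bx * (R / S - ta / sa) + d * by' * (R / S - tb / sb) + (bx * cy + by'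
        * cx) / S"
      unfolding prods RR by (simp only: mult.assoc)
    also have "\<dots> = (d * (bx + by') * R + bx * cy + by' * cx) / S - d * bx * ta / sa - d * by'
        * tb / sb"
      by (simp add: ring_distribs add_divide_distrib)
    finally have key: "(bx / sa + by' / sb) * (cx / sa + cy / sb) / (S / (sa * sb)) = \<dots>" .
    have "?M a w * ?M w b / ?M w w = (bx / sa + by' / sb) * (cx / sa + cy / sb) / (S / (sa * sb))"
      unfolding Mw(1)[OF that(1)] Mw(2)[OF that(2)] ww
      by (simp only: minus_mult_minus bx_def by'_def cx_def cy_def)
    then have "?M a w * ?M w b / ?M w w = edge_coeff q (x, Suc (i + j), y) a b
        - edge_coeff q (x, i, w) a b - edge_coeff q (w, j, y) a b"
      unfolding key 1 2 3 by simp
    then show ?thesis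
      by (simp add: chain_mat_def algebra_simps)
  qed
  have "det (idx_mat ?M (w # ws)) = ?M w w * det (idx_mat ?N ws)"
  proof (subst det_idx_mat_Cons)
    show "?M w w \<noteq> 0"
      using nz' by (simp add: ww)
    show "?M w w * det (idx_mat (\<lambda>x y. ?M x y - ?M x w * ?M w y / ?M w w) ws) = ?M w w * det
        (idx_mat ?N ws)"
      by (intro arg_cong2[of _ _ _ _ "(*)"] refl arg_cong[of _ _ det] idx_mat_cong red)
        (use w(1) in auto)
  qed
  then show ?thesis
    using nz' by (simp add: ww defs)
qed

section \<open>Elimination of whole paths\<close>

definition path_chain :: "'v list \<Rightarrow> ('v \<times> nat \<times> 'v) list" where
  "path_chain xs = map (\<lambda>(x, y). (x, 0, y)) (zip xs (tl xs))"

lemma path_chain_simps [simp]: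
  "path_chain [] = []" "path_chain [x] = []"
  "path_chain (x # y # xs) = (x, 0, y) # path_chain (y # xs)"
  by (auto simp: path_chain_def)

lemma path_chain_Cons: "xs \<noteq> [] \<Longrightarrow> path_chain (x # xs) = (x, 0, hd xs) # path_chain xs"
  by (cases xs) auto

lemma path_chain_endpoints:
  "e \<in> set (path_chain xs) \<Longrightarrow> fst e \<in> set xs \<and> snd (snd e) \<in> set xs"
  by (induction xs rule: induct_list012) auto

text \<open>Induction along the path: the part already eliminated, from u to the next vertex,
  absorbs one more edge at a time. The number i of vertices absorbed so far is therefore general,
  and its factor stays on the left to avoid a quotient.\<close>

lemma det_chain_mat_path:
  fixes q :: "'a::field"
  assumes nz: "\<And>k. cheb q (Suc k) \<noteq> 0"
    and "\<And>x. x \<in> set xs \<Longrightarrow> \<delta> x = q" "distinct (xs @ ws)" "u \<notin> set xs" "v \<notin> set xs"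
    and "\<And>e. e \<in> set E \<Longrightarrow> fst e \<notin> set xs \<and> snd (snd e) \<notin> set xs"
  shows "cheb q (Suc i) * det (idx_mat (chain_mat q \<delta> ((u, i, hd (xs @ [v])) # path_chain (xs @
      [v]) @ E)) (xs @ ws))
    = cheb q (Suc (i + length xs)) * det (idx_mat (chain_mat q \<delta> ((u, i + length xs, v) # E)) ws)"
  using assms(2-)
proof (induction xs arbitrary: i)
  case Nil
  then show ?case by simp
next
  case (Cons w xs)
  let ?y = "hd (xs @ [v])"
  have y: "?y \<noteq> w"
    using Cons.prems by (cases xs) auto
  have "cheb q (Suc i) * cheb q (Suc 0) *
      det (idx_mat (chain_mat q \<delta> ((u, i, w) # (w, 0, ?y) # path_chain (xs @ [v]) @ E))
          (w # xs @ ws))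
    = cheb q (Suc (Suc (i + 0))) *
      det (idx_mat (chain_mat q \<delta> ((u, Suc (i + 0), ?y) # path_chain (xs @ [v]) @ E)) (xs @ ws))"
  proof (rule det_chain_mat_merge[OF nz])
    fix e assume "e \<in> set (path_chain (xs @ [v]) @ E)"
    then show "fst e \<noteq> w \<and> snd (snd e) \<noteq> w"
      using Cons.prems(2-) path_chain_endpoints[of e "xs @ [v]"]
      by (cases "e \<in> set E") auto
  qed (use Cons.prems y in auto)
  also have "\<dots> = cheb q (Suc (Suc i + length xs)) *
      det (idx_mat (chain_mat q \<delta> ((u, Suc i + length xs, v) # E)) ws)"
    using Cons.IH[of "Suc i"] Cons.prems by (simp)
  finally show ?case
    by (simp add: path_chain_Cons)
qed

text \<open>The start \<open>i = 0\<close>, where the factor on the left is 1. The list of paths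
  matters only as a multiset, so the paths can be treated in any order.\<close>

lemma det_chain_mat_path':
  fixes q :: "'a::field"
  assumes "\<And>k. cheb q (Suc k) \<noteq> 0"
    and "\<And>x. x \<in> set xs \<Longrightarrow> \<delta> x = q" "distinct (xs @ ws)" "u \<notin> set xs" "v \<notin> set xs"
    and "\<And>e. e \<in> set E \<Longrightarrow> fst e \<notin> set xs \<and> snd (snd e) \<notin> set xs"
    and "mset F = mset (path_chain (u # xs @ [v]) @ E)"
  shows "det (idx_mat (chain_mat q \<delta> F) (xs @ ws))
    = cheb q (Suc (length xs)) * det (idx_mat (chain_mat q \<delta> ((u, length xs, v) # E)) ws)"
proof -
  have "chain_mat q \<delta> F = chain_mat q \<delta> ((u, 0, hd (xs @ [v])) # path_chain (xs @ [v]) @ E)"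
    by (rule chain_mat_cong_mset) (simp add: assms(7) path_chain_Cons)
  then show ?thesis
    using det_chain_mat_path[where i = 0, OF assms(1-6)] by simp
qed

text \<open>The ends may be any vertices of \<open>ws\<close>, with repetitions, so the statement
  serves theta graphs and dumbbells alike.\<close>

lemma det_chain_mat_three_paths:
  fixes q :: "'a::field"
  assumes nz: "\<And>k. cheb q (Suc k) \<noteq> 0"
    and \<delta>: "\<And>x. x \<in> set r1 \<union> set r2 \<union> set r3 \<Longrightarrow> \<delta> x = q"
    and dist: "distinct (r1 @ r2 @ r3 @ ws)"
    and ends: "{u1, v1, u2, v2, u3, v3} \<subseteq> set ws"
  shows "det (idx_mat (chain_mat q \<delta> (path_chain (u1 # r1 @ [v1]) @ path_chain (u2 # r2 @ [v2])
        @ path_chain (u3 # r3 @ [v3]))) (r1 @ r2 @ r3 @ ws))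
    = cheb q (Suc (length r1)) * cheb q (Suc (length r2)) * cheb q (Suc (length r3)) *
      det (idx_mat (chain_mat q \<delta> [(u1, length r1, v1), (u2, length r2, v2), (u3, length r3,
          v3)]) ws)"
proof -
  let ?p1 = "path_chain (u1 # r1 @ [v1])" and ?p2 = "path_chain (u2 # r2 @ [v2])"
    and ?p3 = "path_chain (u3 # r3 @ [v3])"
  let ?e1 = "(u1, length r1, v1)" and ?e2 = "(u2, length r2, v2)" and ?e3 = "(u3, length r3, v3)"
  have p: "fst e \<in> set r2 \<union> set r3 \<union> set ws \<and> snd (snd e) \<in> set r2 \<union> set r3 \<union> set ws"
    if "e \<in> set (?p2 @ ?p3)" for e
    using that path_chain_endpoints[of e "u2 # r2 @ [v2]"] path_chain_endpoints[of e "u3 # r3 @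
        [v3]"] ends
    by auto
  have p': "fst e \<in> set r3 \<union> set ws \<and> snd (snd e) \<in> set r3 \<union> set ws"
    if "e \<in> set (?e1 # ?p3)" for e
    using that path_chain_endpoints[of e "u3 # r3 @ [v3]"] ends
    by auto
  have disj: "set r1 \<inter> (set r2 \<union> set r3 \<union> set ws) = {}" "set r2 \<inter> (set r3 \<union> set ws) = {}"
    "set r3 \<inter> set ws = {}"
    using dist by auto
  have ends': "u1 \<in> set ws" "v1 \<in> set ws" "u2 \<in> set ws" "v2 \<in> set ws" "u3 \<in> set ws" "v3 \<in> set ws"
    using ends by simp_all
  have "det (idx_mat (chain_mat q \<delta> (?p1 @ ?p2 @ ?p3)) (r1 @ r2 @ r3 @ ws))
      = cheb q (Suc (length r1)) * det (idx_mat (chain_mat q \<delta> (?e1 # ?p2 @ ?p3)) (r2 @ r3 @ ws))"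
  proof (rule det_chain_mat_path'[OF nz])
    show "fst e \<notin> set r1 \<and> snd (snd e) \<notin> set r1" if "e \<in> set (?p2 @ ?p3)" for e
      using p[OF that] disj(1) by blast
    show "\<delta> x = q" if "x \<in> set r1" for x
      using that by (intro \<delta>) simp
    show "u1 \<notin> set r1" "v1 \<notin> set r1"
      using disj(1) ends' by blast+
    show "mset (?p1 @ ?p2 @ ?p3) = mset (?p1 @ ?p2 @ ?p3)"
      by simp
    show "distinct (r1 @ r2 @ r3 @ ws)"
      by (rule dist)
  qed
  also have "det (idx_mat (chain_mat q \<delta> (?e1 # ?p2 @ ?p3)) (r2 @ r3 @ ws))
      = cheb q (Suc (length r2)) * det (idx_mat (chain_mat q \<delta> (?e2 # ?e1 # ?p3)) (r3 @ ws))"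
  proof (rule det_chain_mat_path'[OF nz])
    show "fst e \<notin> set r2 \<and> snd (snd e) \<notin> set r2" if "e \<in> set (?e1 # ?p3)" for e
      using p'[OF that] disj(2) by blast
    show "distinct (r2 @ r3 @ ws)"
      using dist by simp
    show "\<delta> x = q" if "x \<in> set r2" for x
      using that by (intro \<delta>) simp
    show "u2 \<notin> set r2" "v2 \<notin> set r2"
      using disj(2) ends' by blast+
    show "mset (?e1 # ?p2 @ ?p3) = mset (?p2 @ ?e1 # ?p3)"
      by simp
  qed
  also have "det (idx_mat (chain_mat q \<delta> (?e2 # ?e1 # ?p3)) (r3 @ ws))
      = cheb q (Suc (length r3)) * det (idx_mat (chain_mat q \<delta> [?e3, ?e2, ?e1]) ws)"
  proof (rule det_chain_mat_path'[OF nz])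
    show "fst e \<notin> set r3 \<and> snd (snd e) \<notin> set r3" if "e \<in> set [?e2, ?e1]" for e
      using that disj(3) ends' by auto
    show "distinct (r3 @ ws)"
      using dist by simp
    show "\<delta> x = q" if "x \<in> set r3" for x
      using that by (intro \<delta>) simp
    show "u3 \<notin> set r3" "v3 \<notin> set r3"
      using disj(3) ends' by blast+
    show "mset (?e2 # ?e1 # ?p3) = mset (?p3 @ [?e2, ?e1])"
      by simp
  qed
  also have "chain_mat q \<delta> [?e3, ?e2, ?e1] = chain_mat q \<delta> [?e1, ?e2, ?e3]"
    by (rule chain_mat_cong_mset) simp
  finally show ?thesis
    by (simp add: mult.assoc)
qed

section \<open>Decomposition of a graph into paths\<close>

text \<open>Steps count in both directions, so a step \<open>x, x\<close> counts twice at \<open>(x, x)\<close>.\<close>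

fun walk_count :: "'v list \<Rightarrow> 'v \<Rightarrow> 'v \<Rightarrow> nat" where
  "walk_count (a # b # p) x y =
     of_bool (x = a \<and> y = b) + of_bool (x = b \<and> y = a) + walk_count (b # p) x y"
| "walk_count p x y = 0"

lemma walk_count_append:
  "walk_count (xs @ w # ys) x y = walk_count (xs @ [w]) x y + walk_count (w # ys) x y"
  by (induction xs rule: induct_list012) (auto split: list.splits)

lemma walk_count_rev: "walk_count (rev p) x y = walk_count p x y"
proof (induction p rule: induct_list012)
  case (3 a b p)
  have "walk_count (rev (a # b # p)) x y = walk_count (rev (b # p)) x y + walk_count [b, a] x y"
    using walk_count_append[of "rev p" b "[a]"] by simp
  with 3 show ?case
    by simp
qed auto

lemma walk_count_pos: "walk_count p x y > 0 \<Longrightarrow> x \<in> set p \<and> y \<in> set p"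
  by (induction p rule: induct_list012) (auto split: if_splits)

lemma walk_count_map:
  assumes "inj_on f S" "set p \<subseteq> S" "x \<in> S" "y \<in> S"
  shows "walk_count (map f p) (f x) (f y) = walk_count p x y"
  using assms(2)
proof (induction p rule: induct_list012)
  case (3 a b p)
  have "f x = f c \<longleftrightarrow> x = c" "f y = f c \<longleftrightarrow> y = c" if "c \<in> S" for c
    using that assms by (auto dest: inj_onD)
  with 3 show ?case
    by simp
qed auto

text \<open>Each occurrence of x on the walk belongs to two steps, except that the first and the
  last entry of the walk lack one each; the two indicators make up for these.\<close>

lemma walk_count_sum:
  assumes "finite V" "set p \<subseteq> V" "p \<noteq> []"
  shows "(\<Sum>y\<in>V. walk_count p x y) + of_bool (x = hd p) + of_bool (x = last p) = 2 * count_list p x"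
  using assms(2,3)
proof (induction p rule: induct_list012)
  case (3 a b p)
  have "(\<Sum>y\<in>V. of_bool (x = a \<and> y = b)) = (of_bool (x = a) :: nat)"
    using 3 assms(1) by (cases "x = a") (simp_all add: of_bool_def sum.delta)
  moreover have "(\<Sum>y\<in>V. of_bool (x = b \<and> y = a)) = (of_bool (x = b) :: nat)"
    using 3 assms(1) by (cases "x = b") (simp_all add: of_bool_def sum.delta)
  ultimately have "(\<Sum>y\<in>V. walk_count (a # b # p) x y)
      = of_bool (x = a) + of_bool (x = b) + (\<Sum>y\<in>V. walk_count (b # p) x y)"
    by (simp only: walk_count.simps sum.distrib)
  moreover have "(\<Sum>y\<in>V. walk_count (b # p) x y) + of_bool (x = b) + of_bool (x = last (b # p))
      = 2 * count_list (b # p) x"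
    using 3 by simp
  ultimately show ?case
    by simp
qed auto

text \<open>A path is given as (first vertex, inner vertices, last vertex); it may be closed.\<close>

definition track :: "'v \<times> 'v list \<times> 'v \<Rightarrow> 'v list" where
  "track t = fst t # fst (snd t) @ [snd (snd t)]"

definition inner :: "'v \<times> 'v list \<times> 'v \<Rightarrow> 'v list" where
  "inner t = fst (snd t)"

definition ends :: "'v \<times> 'v list \<times> 'v \<Rightarrow> 'v \<Rightarrow> nat" where
  "ends t x = of_bool (x = fst t) + of_bool (x = snd (snd t))"

lemma track_simps [simp]:
  "track (u, r, v) = u # r @ [v]" "inner (u, r, v) = r"
  "ends (u, r, v) x = of_bool (x = u) + of_bool (x = v)"
  by (simp_all add: track_def inner_def ends_def)

lemma set_track: "set (track t) = set (inner t) \<union> {x. ends t x > 0}"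
  by (auto simp: track_def inner_def ends_def split: if_splits)

text \<open>
  The edges are partitioned into paths with ends in \<open>W\<close> whose inner vertices are exactly \<open>V - W\<close>.
  All edges as paths of length one give \<open>W = V\<close>; merging two paths at a vertex of degree 2
  removes it from \<open>W\<close>.
\<close>

definition path_cover :: "'v set \<Rightarrow> 'v rel \<Rightarrow> 'v set \<Rightarrow> ('v \<times> 'v list \<times> 'v) list \<Rightarrow> bool" where
  "path_cover V A W ps \<longleftrightarrow> W \<subseteq> V \<and>
     (\<forall>x y. (\<Sum>t\<leftarrow>ps. walk_count (track t) x y) = of_bool ((x, y) \<in> A)) \<and>
     distinct (concat (map inner ps)) \<and> set (concat (map inner ps)) = V - W \<and>
     (\<forall>t\<in>set ps. \<forall>x. ends t x > 0 \<longrightarrow> x \<in> W)"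

lemma path_coverD:
  assumes "path_cover V A W ps"
  shows "W \<subseteq> V" "\<And>x y. (\<Sum>t\<leftarrow>ps. walk_count (track t) x y) = of_bool ((x, y) \<in> A)"
    "distinct (concat (map inner ps))" "set (concat (map inner ps)) = V - W"
    "\<And>t x. t \<in> set ps \<Longrightarrow> ends t x > 0 \<Longrightarrow> x \<in> W"
  using assms unfolding path_cover_def by auto

lemma path_cover_cong:
  assumes "path_cover V A W ps"
    and "\<And>x y. (\<Sum>t\<leftarrow>qs. walk_count (track t) x y) = (\<Sum>t\<leftarrow>ps. walk_count (track t) x y)"
    and "mset (concat (map inner qs)) = mset (concat (map inner ps))"
    and "\<And>t x. t \<in> set qs \<Longrightarrow> ends t x > 0 \<Longrightarrow> x \<in> W"
  shows "path_cover V A W qs"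
  using assms(1,2,4) mset_eq_imp_distinct_iff[OF assms(3)] mset_eq_setD[OF assms(3)]
  unfolding path_cover_def by auto

lemma sum_list_map_mset:
  fixes f :: "'b \<Rightarrow> 'c::comm_monoid_add"
  assumes "mset xs = mset ys"
  shows "(\<Sum>x\<leftarrow>xs. f x) = (\<Sum>x\<leftarrow>ys. f x)"
proof -
  have "(\<Sum>x\<leftarrow>zs. f x) = (\<Sum>x\<in>#mset zs. f x)" for zs
    by (simp flip: sum_mset_sum_list)
  then show ?thesis
    using assms by simp
qed

lemma path_cover_mset:
  assumes "path_cover V A W ps" "mset qs = mset ps"
  shows "path_cover V A W qs"
proof (rule path_cover_cong[OF assms(1)])
  show "(\<Sum>t\<leftarrow>qs. walk_count (track t) x y) = (\<Sum>t\<leftarrow>ps. walk_count (track t) x y)" for x y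
    by (rule sum_list_map_mset[OF assms(2)])
  show "mset (concat (map inner qs)) = mset (concat (map inner ps))"
    unfolding mset_concat map_map by (rule sum_list_map_mset[OF assms(2)])
  show "\<And>t x. t \<in> set qs \<Longrightarrow> ends t x > 0 \<Longrightarrow> x \<in> W"
    using path_coverD(5)[OF assms(1)] mset_eq_setD[OF assms(2)] by auto
qed

definition flip :: "'v \<times> 'v list \<times> 'v \<Rightarrow> 'v \<times> 'v list \<times> 'v" where
  "flip t = (snd (snd t), rev (inner t), fst t)"

lemma flip_simps [simp]:
  "flip (u, r, v) = (v, rev r, u)" "inner (flip t) = rev (inner t)" "ends (flip t) x = ends t x"
  "walk_count (track (flip t)) x y = walk_count (track t) x y"
proof -
  have "track (flip t) = rev (track t)"
    by (simp add: flip_def track_def inner_def)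
  then show "walk_count (track (flip t)) x y = walk_count (track t) x y"
    by (simp add: walk_count_rev)
qed (auto simp: flip_def ends_def inner_def)

lemma path_cover_flip_map:
  assumes "path_cover V A W ps" "\<And>t. f t = t \<or> f t = flip t"
  shows "path_cover V A W (map f ps)"
proof (rule path_cover_cong[OF assms(1)])
  have "walk_count (track (f t)) x y = walk_count (track t) x y" for t x y
    using assms(2)[of t] by auto
  then show "(\<Sum>t\<leftarrow>map f ps. walk_count (track t) x y) = (\<Sum>t\<leftarrow>ps. walk_count (track t) x y)" for x y
    by (simp add: comp_def)
  have "mset (inner (f t)) = mset (inner t)" for t
    using assms(2)[of t] by auto
  then show "mset (concat (map inner (map f ps))) = mset (concat (map inner ps))"
    by (simp add: mset_concat comp_def)
  have "ends (f t) x = ends t x" for t x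
    using assms(2)[of t] by auto
  then show "\<And>t x. t \<in> set (map f ps) \<Longrightarrow> ends t x > 0 \<Longrightarrow> x \<in> W"
    using path_coverD(5)[OF assms(1)] by auto
qed

lemma path_cover_flip:
  assumes "path_cover V A W (t # ps)"
  shows "path_cover V A W (flip t # ps)"
proof (rule path_cover_cong[OF assms])
  fix t' x assume "t' \<in> set (flip t # ps)" "ends t' x > 0"
  then show "x \<in> W"
    using path_coverD(5)[OF assms, of t x] path_coverD(5)[OF assms, of t' x]
    by (cases "t' = flip t") simp_all
qed simp_all

lemma sum_list_swap:
  fixes f :: "'a \<Rightarrow> 'b \<Rightarrow> 'c::comm_monoid_add"
  shows "(\<Sum>y\<in>V. \<Sum>t\<leftarrow>ps. f t y) = (\<Sum>t\<leftarrow>ps. \<Sum>y\<in>V. f t y)"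
  by (induction ps) (simp_all add: sum.distrib)

text \<open>Summing \<open>walk_count_sum\<close> over the paths counts the ends at x once and the
  inner occurrences of x twice. A vertex of W is never inner; any other vertex is inner exactly once
  and never an end.\<close>

lemma path_cover_degree:
  assumes pc: "path_cover V A W ps" and V: "finite V" "A \<subseteq> V \<times> V"
  shows "x \<in> W \<Longrightarrow> card {y. (x, y) \<in> A} = (\<Sum>t\<leftarrow>ps. ends t x)"
    and "x \<in> V - W \<Longrightarrow> card {y. (x, y) \<in> A} = 2"
proof -
  note pcD = path_coverD[OF pc]
  have sub: "set (track t) \<subseteq> V" if "t \<in> set ps" for t
  proof -
    have "set (inner t) \<subseteq> V"
      using pcD(4) that by auto
    then show ?thesis
      using pcD(1) pcD(5)[OF that] unfolding set_track by auto
  qed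
  have deg: "(\<Sum>y\<in>V. walk_count (track t) x y) = ends t x + 2 * count_list (inner t) x"
    if "t \<in> set ps" for t
  proof -
    have "count_list (track t) x = of_bool (x = fst t) + count_list (inner t) x + of_bool (x
        = snd (snd t))"
      by (auto simp: track_def inner_def)
    moreover have "track t \<noteq> []" "hd (track t) = fst t" "last (track t) = snd (snd t)"
      by (simp_all add: track_def)
    ultimately show ?thesis
      using walk_count_sum[OF V(1) sub[OF that], of x] by (simp add: ends_def)
  qed
  have "{y. (x, y) \<in> A} = {y\<in>V. (x, y) \<in> A}"
    using V(2) by auto
  then have "card {y. (x, y) \<in> A} = (\<Sum>y\<in>V. of_bool ((x, y) \<in> A))"
    using V(1) by (simp add: of_bool_def sum.If_cases Int_def)
  also have "\<dots> = (\<Sum>y\<in>V. \<Sum>t\<leftarrow>ps. walk_count (track t) x y)"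
    by (simp only: pcD(2))
  also have "\<dots> = (\<Sum>t\<leftarrow>ps. \<Sum>y\<in>V. walk_count (track t) x y)"
    by (rule sum_list_swap)
  also have "\<dots> = (\<Sum>t\<leftarrow>ps. ends t x + 2 * count_list (inner t) x)"
    by (rule arg_cong[of _ _ sum_list]) (use deg in auto)
  also have "\<dots> = (\<Sum>t\<leftarrow>ps. ends t x) + 2 * count_list (concat (map inner ps)) x"
    by (induction ps) auto
  also have "count_list (concat (map inner ps)) x = of_bool (x \<in> V - W)"
  proof -
    have "count_list xs x = of_bool (x \<in> set xs)" if "distinct xs" for xs
      using that by (induction xs) auto
    from this[OF pcD(3)] show ?thesis
      by (simp only: pcD(4))
  qed
  finally have *: "card {y. (x, y) \<in> A} = (\<Sum>t\<leftarrow>ps. ends t x) + 2 * of_bool (x \<in> V - W)" .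
  show "x \<in> W \<Longrightarrow> card {y. (x, y) \<in> A} = (\<Sum>t\<leftarrow>ps. ends t x)"
    unfolding * by simp
  show "card {y. (x, y) \<in> A} = 2" if x: "x \<in> V - W"
  proof -
    have "(\<Sum>t\<leftarrow>ps. ends t x) = 0"
    proof (rule sum_list_neutral)
      fix c assume "c \<in> set (map (\<lambda>t. ends t x) ps)"
      then obtain t where "t \<in> set ps" "c = ends t x"
        by auto
      then show "c = 0"
        using pcD(5)[of t x] x by auto
    qed
    then show ?thesis
      unfolding * using x by simp
  qed
qed

text \<open>Under these hypotheses w is an end of exactly two paths, once of each, and so can become
  an inner vertex.\<close>

lemma path_cover_merge:
  assumes pc: "path_cover V A W ((u, r, w) # (w, r', v) # ps)"
    and "u \<noteq> w" "v \<noteq> w" "\<And>t. t \<in> set ps \<Longrightarrow> ends t w = 0"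
  shows "path_cover V A (W - {w}) ((u, r @ w # r', v) # ps)"
proof -
  note pcD = path_coverD[OF pc]
  have w: "w \<in> W" "w \<in> V"
    using pcD(5)[of "(u, r, w)" w] pcD(1) by auto
  show ?thesis
    unfolding path_cover_def
  proof (intro conjI allI ballI impI)
    show "W - {w} \<subseteq> V"
      using pcD(1) by auto
    show "(\<Sum>t\<leftarrow>(u, r @ w # r', v) # ps. walk_count (track t) x y) = of_bool ((x, y) \<in> A)" for x y
      using pcD(2)[of x y] walk_count_append[of "u # r" w "r' @ [v]" x y] by simp
    show "distinct (concat (map inner ((u, r @ w # r', v) # ps)))"
      using pcD(3,4) w by auto
    show "set (concat (map inner ((u, r @ w # r', v) # ps))) = V - (W - {w})"
      using pcD(4) w by auto
    fix t x assume t: "t \<in> set ((u, r @ w # r', v) # ps)" "ends t x > 0"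
    then show "x \<in> W - {w}"
    proof (cases "t \<in> set ps")
      case True
      then have "x \<in> W"
        using pcD(5)[of t x] t(2) by simp
      moreover have "x \<noteq> w"
        using assms(4)[OF True] t(2) by auto
      ultimately show ?thesis
        by simp
    next
      case False
      with t have "x = u \<or> x = v"
        by (auto split: if_splits)
      then show ?thesis
        using pcD(5)[of "(u, r, w)" u] pcD(5)[of "(w, r', v)" v] assms(2,3) by auto
    qed
  qed
qed

text \<open>Connectedness through closed vertex sets. This form fits both uses: a cycle without
  further attachments is a closed set, and a proper closed set splits the Laplacian into
  blocks.\<close>

definition connected_rel :: "'v set \<Rightarrow> 'v rel \<Rightarrow> bool" where
  "connected_rel V A \<longleftrightarrow>
     (\<forall>S\<subseteq>V. S \<noteq> {} \<longrightarrow> (\<forall>x y. (x, y) \<in> A \<longrightarrow> x \<in> S \<longrightarrow> y \<in> S) \<longrightarrow> S = V)"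

section \<open>Absorbing the vertices of degree two into paths\<close>

lemma sum_list_pos_ex: "(\<Sum>t\<leftarrow>ps. f t) > (0 :: nat) \<Longrightarrow> \<exists>t\<in>set ps. f t > 0"
  by (induction ps) auto

text \<open>Two path ends meet at w. If they belong to one closed path, its vertices form a closed
  set avoiding u, which contradicts connectedness; otherwise two different paths meet at w and can
  be merged after turning them suitably.\<close>

lemma path_cover_step:
  assumes pc: "path_cover V A W ps" and V: "finite V" "A \<subseteq> V \<times> V" and conn: "connected_rel V A"
    and w: "w \<in> W" "card {y. (w, y) \<in> A} = 2" and u: "u \<in> W" "u \<noteq> w"
  shows "\<exists>qs. path_cover V A (W - {w}) qs"
proof -
  have sum2: "(\<Sum>t\<leftarrow>ps. ends t w) = 2"
    using path_cover_degree(1)[OF pc V w(1)] w(2) by simp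
  then obtain t where t: "t \<in> set ps" "ends t w > 0"
    using sum_list_pos_ex[of "\<lambda>t. ends t w" ps] by auto
  define ps1 where "ps1 = remove1 t ps"
  have pc1: "path_cover V A W (t # ps1)"
    by (rule path_cover_mset[OF pc]) (use t in \<open>simp add: ps1_def\<close>)
  obtain a r b where tabc: "t = (a, r, b)"
    by (cases t)
  have "\<exists>u r. path_cover V A W ((u, r, w) # ps1)"
    using t(2) pc1 path_cover_flip[OF pc1] unfolding tabc by (auto split: if_splits)
  then obtain u1 r1 where pc2: "path_cover V A W ((u1, r1, w) # ps1)"
    by auto
  note pcD = path_coverD[OF pc2]
  have sum1: "1 + of_bool (w = u1) + (\<Sum>t\<leftarrow>ps1. ends t w) = 2"
    using path_cover_degree(1)[OF pc2 V w(1)] w(2) by simp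
  show ?thesis
  proof (cases "u1 = w")
    case True
    then have "(\<Sum>t\<leftarrow>ps1. ends t w) = 0"
      using sum1 by simp
    then have 0: "ends t w = 0" if "t \<in> set ps1" for t
      using that by (simp add: sum_list_eq_0_iff)
    define S where "S = insert w (set r1)"
    have r1: "set r1 \<subseteq> V - W" "set r1 \<inter> (\<Union>t\<in>set ps1. set (inner t)) = {}"
      using pcD(3,4) by auto
    have SV: "S \<subseteq> V"
      using r1 w(1) pcD(1) by (auto simp: S_def)
    have "y \<in> S" if xy: "(x, y) \<in> A" and x: "x \<in> S" for x y
    proof -
      have "(\<Sum>t\<leftarrow>(u1, r1, w) # ps1. walk_count (track t) x y) > 0"
        unfolding pcD(2) using xy by simp
      from sum_list_pos_ex[OF this]
      obtain t where t: "t \<in> set ((u1, r1, w) # ps1)" "walk_count (track t) x y > 0"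
        by blast
      have xyt: "x \<in> set (track t)" "y \<in> set (track t)"
        using walk_count_pos[OF t(2)] by auto
      have "t = (u1, r1, w)"
      proof (rule ccontr)
        assume "t \<noteq> (u1, r1, w)"
        with t(1) have t1: "t \<in> set ps1" by simp
        from xyt(1) consider "x \<in> set (inner t)" | "ends t x > 0"
          unfolding set_track by auto
        then show False
        proof cases
          case 1
          then have "x \<in> V - W"
            using pcD(4) t1 by auto
          with x w(1) have "x \<in> set r1"
            by (auto simp: S_def)
          with 1 t1 r1(2) show False
            by auto
        next
          case 2
          then have "x \<in> W"
            using pcD(5)[of t x] t1 by auto
          with x r1(1) have "x = w"
            by (auto simp: S_def)
          with 2 0[OF t1] show False
            by simp
        qed
      qed
      with xyt(2) True show "y \<in> S"
        by (auto simp: S_def)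
    qed
    then have "S = V"
      using conn SV unfolding connected_rel_def by (metis S_def insert_not_empty)
    moreover have "u \<notin> S"
      using u r1(1) by (auto simp: S_def)
    ultimately show ?thesis
      using u(1) pcD(1) by auto
  next
    case False
    with sum1 have sum1': "(\<Sum>t\<leftarrow>ps1. ends t w) = 1"
      by simp
    then obtain t2 where t2: "t2 \<in> set ps1" "ends t2 w > 0"
      using sum_list_pos_ex[of "\<lambda>t. ends t w" ps1] by auto
    define ps2 where "ps2 = remove1 t2 ps1"
    have m2: "mset (t2 # ps2) = mset ps1"
      using t2 by (simp add: ps2_def)
    have pc3: "path_cover V A W (t2 # (u1, r1, w) # ps2)"
      by (rule path_cover_mset[OF pc2]) (use m2 in simp)
    obtain a r b where tabc: "t2 = (a, r, b)"
      by (cases t2)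
    have "\<exists>r v. path_cover V A W ((w, r, v) # (u1, r1, w) # ps2)"
      using t2(2) pc3 path_cover_flip[OF pc3] unfolding tabc by (auto split: if_splits)
    then obtain r2 v2 where pc4: "path_cover V A W ((w, r2, v2) # (u1, r1, w) # ps2)"
      by auto
    have pc5: "path_cover V A W ((u1, r1, w) # (w, r2, v2) # ps2)"
      by (rule path_cover_mset[OF pc4]) simp
    have sum3: "of_bool (w = v2) + (\<Sum>t\<leftarrow>ps2. ends t w) = 0"
      using path_cover_degree(1)[OF pc5 V w(1)] w(2) by simp
    then have "v2 \<noteq> w" "\<And>t. t \<in> set ps2 \<Longrightarrow> ends t w = 0"
      by (auto simp: sum_list_eq_0_iff)
    with path_cover_merge[OF pc5 False] show ?thesis
      by blast
  qed
qed

lemma path_cover_reduce: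
  assumes V: "finite V" "A \<subseteq> V \<times> V" and conn: "connected_rel V A"
    and uv: "u \<noteq> v" and deg2: "\<And>w. w \<in> V - {u, v} \<Longrightarrow> card {y. (w, y) \<in> A} = 2"
    and "path_cover V A W ps" "{u, v} \<subseteq> W"
  shows "\<exists>qs. path_cover V A {u, v} qs"
  using assms(6,7)
proof (induction "card (W - {u, v})" arbitrary: W ps)
  case 0
  have "finite W"
    using path_coverD(1)[OF 0(2)] V(1) finite_subset by auto
  with 0 have "W = {u, v}"
    by auto
  with 0(2) show ?case
    by auto
next
  case (Suc n)
  then obtain w where w: "w \<in> W - {u, v}"
    by (metis card.empty equals0I nat.distinct(1))
  have W: "W \<subseteq> V"
    using path_coverD(1)[OF Suc(3)] .
  obtain qs where qs: "path_cover V A (W - {w}) qs"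
    using path_cover_step[OF Suc(3) V conn, of w u] w deg2[of w] W Suc(4) by auto
  have "W - {w} - {u, v} = W - {u, v} - {w}"
    by auto
  then have "n = card (W - {w} - {u, v})"
    using Suc(2) w by simp
  from Suc(1)[OF this qs] show ?case
    using w Suc(4) by auto
qed

lemma path_cover_exists:
  fixes V :: "'a set"
  assumes V: "finite V" "A \<subseteq> V \<times> V" and A: "sym A" "irrefl A"
  shows "\<exists>ps. path_cover V A V ps"
proof -
  \<comment> \<open>\<open>walk_count\<close> already counts both directions, so each edge must be
    listed once; an injection into the naturals selects the orientation.\<close>
  obtain f :: "'a \<Rightarrow> nat" where f: "inj_on f V"
    using finite_imp_inj_to_nat_seg[OF V(1)] by blast
  define B where "B = {e\<in>A. f (fst e) < f (snd e)}"
  have "finite B"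
    using V finite_subset[of A "V \<times> V"] by (auto simp: B_def)
  then obtain es where es: "set es = B" "distinct es"
    using finite_distinct_list by blast
  define ps where "ps = map (\<lambda>(x, y). (x, [] :: 'a list, y)) es"
  have "(\<Sum>t\<leftarrow>ps. walk_count (track t) x y) = of_bool ((x, y) \<in> A)" for x y
  proof -
    have wc: "walk_count (track (a, [], b)) x y = of_bool ((a, b) = (x, y)) + of_bool ((a, b) =
        (y, x))" for a b
    proof -
      have "(x = a \<and> y = b) = ((a, b) = (x, y))" "(x = b \<and> y = a) = ((a, b) = (y, x))"
        by auto
      then show ?thesis
        by (simp only: track_simps append_Nil walk_count.simps add_0_right)
    qed
    have "(\<Sum>t\<leftarrow>ps. walk_count (track t) x y)
        = (\<Sum>e\<leftarrow>es. of_bool (e = (x, y)) + of_bool (e = (y, x)))"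
      unfolding ps_def map_map
    proof (intro arg_cong[of _ _ sum_list] map_cong refl)
      fix e :: "'a \<times> 'a"
      show "((\<lambda>t. walk_count (track t) x y) \<circ> (\<lambda>(x, y). (x, [], y))) e = of_bool (e = (x, y))
          + of_bool (e = (y, x))"
        by (cases e) (simp only: comp_def split wc)
    qed
    also have "\<dots> = (\<Sum>e\<in>B. of_bool (e = (x, y)) + of_bool (e = (y, x)))"
      by (simp only: sum_list_distinct_conv_sum_set[OF es(2)] es(1))
    also have "\<dots> = of_bool ((x, y) \<in> B) + of_bool ((y, x) \<in> B)"
      using \<open>finite B\<close> by (simp add: sum.distrib of_bool_def sum.delta)
    also have "\<dots> = of_bool ((x, y) \<in> A)"
    proof (cases "(x, y) \<in> A")
      case True
      then have "(y, x) \<in> A" "x \<noteq> y" "x \<in> V" "y \<in> V"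
        using A V by (auto dest: symD irreflD)
      then have "f x \<noteq> f y"
        using f by (auto dest: inj_onD)
      with True \<open>(y, x) \<in> A\<close> show ?thesis
        by (auto simp: B_def)
    next
      case False
      then have "(y, x) \<notin> A"
        using A by (auto dest: symD)
      with False show ?thesis
        by (auto simp: B_def)
    qed
    finally show ?thesis .
  qed
  moreover have c: "concat (map inner ps) = []"
    by (auto simp: ps_def)
  moreover have "x \<in> V" if "t \<in> set ps" "ends t x > 0" for t x
    using that V(2) by (auto simp: ps_def es B_def split: if_splits)
  ultimately have "path_cover V A V ps"
    unfolding path_cover_def c by auto
  then show ?thesis ..
qed

text \<open>A cubic multigraph on two vertices is a triple edge, or a loop at each vertex with one
  edge between them. The seven alternatives are these two shapes with all orders of the edges, found
  by checking 27 cases.\<close>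

lemma three_edges_two_vertices:
  assumes "u \<noteq> v" "c1 \<in> {(u, u), (v, v), (u, v)}" "c2 \<in> {(u, u), (v, v), (u, v)}"
    "c3 \<in> {(u, u), (v, v), (u, v)}"
    and "(\<Sum>c\<leftarrow>[c1, c2, c3]. of_bool (u = fst c) + of_bool (u = snd c)) = (3 :: nat)"
    and "(\<Sum>c\<leftarrow>[c1, c2, c3]. of_bool (v = fst c) + of_bool (v = snd c)) = (3 :: nat)"
  shows "c1 = (u, v) \<and> c2 = (u, v) \<and> c3 = (u, v) \<or>
    c1 = (u, u) \<and> c2 = (v, v) \<and> c3 = (u, v) \<or>
    c1 = (u, u) \<and> c2 = (u, v) \<and> c3 = (v, v) \<or>
    c1 = (v, v) \<and> c2 = (u, u) \<and> c3 = (u, v) \<or>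
    c1 = (v, v) \<and> c2 = (u, v) \<and> c3 = (u, u) \<or>
    c1 = (u, v) \<and> c2 = (u, u) \<and> c3 = (v, v) \<or>
    c1 = (u, v) \<and> c2 = (v, v) \<and> c3 = (u, u)"
  using assms(2-4,1,5,6) by (elim insertE emptyE; hypsubst; simp)

lemma theta_or_dumbbell:
  fixes V :: "'a set"
  assumes V: "finite V" "A \<subseteq> V \<times> V" and A: "sym A" "irrefl A" and conn: "connected_rel V A"
    and uv: "u \<noteq> v" "u \<in> V" "v \<in> V"
    and deg3: "card {y. (u, y) \<in> A} = 3" "card {y. (v, y) \<in> A} = 3"
    and deg2: "\<And>w. w \<in> V - {u, v} \<Longrightarrow> card {y. (w, y) \<in> A} = 2"
  shows "\<exists>r1 r2 r3. path_cover V A {u, v} [(u, r1, v), (u, r2, v), (u, r3, v)] \<or>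
    path_cover V A {u, v} [(u, r1, u), (v, r2, v), (u, r3, v)]"
proof -
  obtain ps0 where "path_cover V A V ps0"
    using path_cover_exists[OF V A] by auto
  then obtain ps1 where ps1: "path_cover V A {u, v} ps1"
    using path_cover_reduce[OF V conn uv(1) deg2, of V ps0] uv by auto
  \<comment> \<open>Turning the paths that start at v leaves only the directions (u, u), (v, v) and
    (u, v).\<close>
  define f where "f t = (if fst t = v then flip t else t)" for t :: "'a \<times> 'a list \<times> 'a"
  define ps where "ps = map f ps1"
  have pc: "path_cover V A {u, v} ps"
    unfolding ps_def by (rule path_cover_flip_map[OF ps1]) (auto simp: f_def)
  have dirs: "(fst t, snd (snd t)) \<in> {(u, u), (v, v), (u, v)}" if t: "t \<in> set ps" for t
  proof -
    obtain t' where t': "t' \<in> set ps1" "t = f t'"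
      using t by (auto simp: ps_def)
    obtain a r b where abc: "t' = (a, r, b)"
      by (cases t')
    have "a \<in> {u, v}" "b \<in> {u, v}"
      using path_coverD(5)[OF ps1 t'(1)] by (auto simp: abc)
    then show ?thesis
      using t'(2) by (auto simp: f_def abc)
  qed
  have su: "(\<Sum>t\<leftarrow>ps. ends t u) = 3" and sv: "(\<Sum>t\<leftarrow>ps. ends t v) = 3"
    using path_cover_degree(1)[OF pc V] deg3 by auto
  \<comment> \<open>Each path has two ends and the ends number 3 + 3 in all, hence there are three
    paths.\<close>
  have "ends t u + ends t v = 2" if "t \<in> set ps" for t
    using dirs[OF that] uv(1) by (auto simp: ends_def)
  then have "(\<Sum>t\<leftarrow>ps. ends t u + ends t v) = (\<Sum>t\<leftarrow>ps. 2)"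
    by (intro arg_cong[of _ _ sum_list]) auto
  then have "length ps = 3"
    using su sv by (simp add: sum_list_addf sum_list_triv)
  then obtain t1 t2 t3 where ps: "ps = [t1, t2, t3]"
    by (auto simp: length_Suc_conv numeral_3_eq_3)
  obtain a1 r1 b1 a2 r2 b2 a3 r3 b3 where ts: "t1 = (a1, r1, b1)" "t2 = (a2, r2, b2)" "t3 = (a3,
      r3, b3)"
    by (metis prod.exhaust)
  have d: "(a1, b1) \<in> {(u, u), (v, v), (u, v)}" "(a2, b2) \<in> {(u, u), (v, v), (u, v)}"
      "(a3, b3) \<in> {(u, u), (v, v), (u, v)}"
    using dirs[of t1] dirs[of t2] dirs[of t3] unfolding ps ts by simp_all
  have perm: "path_cover V A {u, v} qs" if "mset qs = mset [t1, t2, t3]" for qs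
    by (rule path_cover_mset[OF pc]) (use that in \<open>simp add: ps\<close>)
  let ?Q = "\<lambda>qs. mset qs = mset [t1, t2, t3]"
  have "(a1, b1) = (u, v) \<and> (a2, b2) = (u, v) \<and> (a3, b3) = (u, v) \<or>
    (a1, b1) = (u, u) \<and> (a2, b2) = (v, v) \<and> (a3, b3) = (u, v) \<or>
    (a1, b1) = (u, u) \<and> (a2, b2) = (u, v) \<and> (a3, b3) = (v, v) \<or>
    (a1, b1) = (v, v) \<and> (a2, b2) = (u, u) \<and> (a3, b3) = (u, v) \<or>
    (a1, b1) = (v, v) \<and> (a2, b2) = (u, v) \<and> (a3, b3) = (u, u) \<or>
    (a1, b1) = (u, v) \<and> (a2, b2) = (u, u) \<and> (a3, b3) = (v, v) \<or>
    (a1, b1) = (u, v) \<and> (a2, b2) = (v, v) \<and> (a3, b3) = (u, u)"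
    by (rule three_edges_two_vertices[OF uv(1) d])
      (use su sv in \<open>simp_all only: ps ts ends_def list.map fst_conv snd_conv\<close>)
  then have "\<exists>r1 r2 r3. ?Q [(u, r1, v), (u, r2, v), (u, r3, v)] \<or> ?Q [(u, r1, u), (v, r2, v), (u,
      r3, v)]"
  proof (elim disjE conjE)
    assume "(a1, b1) = (u, v)" "(a2, b2) = (u, v)" "(a3, b3) = (u, v)"
    then have "?Q [(u, r1, v), (u, r2, v), (u, r3, v)]"
      by (simp add: ts add_mset_commute)
    then show ?thesis by blast
  next
    assume "(a1, b1) = (u, u)" "(a2, b2) = (v, v)" "(a3, b3) = (u, v)"
    then have "?Q [(u, r1, u), (v, r2, v), (u, r3, v)]"
      by (simp add: ts add_mset_commute)
    then show ?thesis by blast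
  next
    assume "(a1, b1) = (u, u)" "(a2, b2) = (u, v)" "(a3, b3) = (v, v)"
    then have "?Q [(u, r1, u), (v, r3, v), (u, r2, v)]"
      by (simp add: ts add_mset_commute)
    then show ?thesis by blast
  next
    assume "(a1, b1) = (v, v)" "(a2, b2) = (u, u)" "(a3, b3) = (u, v)"
    then have "?Q [(u, r2, u), (v, r1, v), (u, r3, v)]"
      by (simp add: ts add_mset_commute)
    then show ?thesis by blast
  next
    assume "(a1, b1) = (v, v)" "(a2, b2) = (u, v)" "(a3, b3) = (u, u)"
    then have "?Q [(u, r3, u), (v, r1, v), (u, r2, v)]"
      by (simp add: ts add_mset_commute)
    then show ?thesis by blast
  next
    assume "(a1, b1) = (u, v)" "(a2, b2) = (u, u)" "(a3, b3) = (v, v)"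
    then have "?Q [(u, r2, u), (v, r3, v), (u, r1, v)]"
      by (simp add: ts add_mset_commute)
    then show ?thesis by blast
  next
    assume "(a1, b1) = (u, v)" "(a2, b2) = (v, v)" "(a3, b3) = (u, u)"
    then have "?Q [(u, r3, u), (v, r2, v), (u, r1, v)]"
      by (simp add: ts add_mset_commute)
    then show ?thesis by blast
  qed
  then show ?thesis
    using perm by blast
qed

section \<open>Closed forms of the two determinants\<close>

text \<open>The formula (z^k - z^(-k)) / (z - 1/z) for the Chebyshev values, freed of
  denominators.\<close>

lemma cheb_closed_form:
  fixes z :: "'a::field"
  assumes "z \<noteq> 0"
  shows "cheb (z + 1 / z) k * (z\<^sup>2 - 1) * z ^ k = z * (z ^ (2 * k) - 1)"
proof (induction k rule: induct_nat_012)
  case (ge2 k)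
  have "cheb (z + 1 / z) (Suc (Suc k)) * (z\<^sup>2 - 1) * z ^ Suc (Suc k)
    = (z\<^sup>2 + 1) * (cheb (z + 1 / z) (Suc k) * (z\<^sup>2 - 1) * z ^ Suc k)
      - z\<^sup>2 * (cheb (z + 1 / z) k * (z\<^sup>2 - 1) * z ^ k)"
    using assms by (simp add: cheb.simps(3) field_simps power2_eq_square)
  also have "\<dots> = z * (z ^ (2 * Suc (Suc k)) - 1)"
    unfolding ge2 by (simp add: algebra_simps power2_eq_square)
  finally show ?case .
qed (auto simp: algebra_simps power2_eq_square)

text \<open>What elimination leaves of det (L - \<mu>) for a theta graph with i, j, k inner
  vertices: the factors of the three paths times the 2 by 2 determinant on the branch vertices,
  whose degree 3 contributes 3 - \<mu> = q + 1.\<close>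

definition theta_det :: "'a::field \<Rightarrow> nat \<Rightarrow> nat \<Rightarrow> nat \<Rightarrow> 'a" where
  "theta_det q i j k = cheb q (Suc i) * cheb q (Suc j) * cheb q (Suc k) *
     ((q + 1 - (cheb q i / cheb q (Suc i) + cheb q j / cheb q (Suc j) + cheb q k / cheb q
         (Suc k)))\<^sup>2
      - (1 / cheb q (Suc i) + 1 / cheb q (Suc j) + 1 / cheb q (Suc k))\<^sup>2)"

text \<open>The analogue for cycles with i and j further vertices and a joining path with k inner
  ones. Both ends of a closed path meet in one diagonal entry, which receives two diagonal and two
  off-diagonal corrections.\<close>

definition dumbbell_det :: "'a::field \<Rightarrow> nat \<Rightarrow> nat \<Rightarrow> nat \<Rightarrow> 'a" where
  "dumbbell_det q i j k = cheb q (Suc i) * cheb q (Suc j) * cheb q (Suc k) *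
     ((q + 1 - (2 * cheb q i + 2) / cheb q (Suc i) - cheb q k / cheb q (Suc k))
      * (q + 1 - (2 * cheb q j + 2) / cheb q (Suc j) - cheb q k / cheb q (Suc k))
      - (1 / cheb q (Suc k))\<^sup>2)"

text \<open>Every quantity in the reduced determinants becomes a rational function of z and the
  single power A, so a path enters only through A. Here w is z - 1/z.\<close>

lemma cheb_ratios:
  fixes z :: "'a::field"
  assumes z: "z \<noteq> 0" "z\<^sup>2 \<noteq> 1" and A: "A = z ^ Suc k" "A\<^sup>2 \<noteq> 1"
  defines "q \<equiv> z + 1 / z" and "w \<equiv> (z\<^sup>2 - 1) / z"
  shows "cheb q (Suc k) = (A\<^sup>2 - 1) / (w * A)"
    and "cheb q k / cheb q (Suc k) = 1 / z - w / (A\<^sup>2 - 1)"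
    and "1 / cheb q (Suc k) = w * A / (A\<^sup>2 - 1)"
proof -
  have A0: "A \<noteq> 0" using z A by simp
  have w: "w \<noteq> 0" using z by (simp add: w_def)
  have "cheb q (Suc k) * (z\<^sup>2 - 1) * A = z * (A\<^sup>2 - 1)"
    using cheb_closed_form[OF z(1), of "Suc k"]
    by (simp only: q_def A(1) power_mult[symmetric] mult.commute[of 2])
  then show 1: "cheb q (Suc k) = (A\<^sup>2 - 1) / (w * A)"
    using z A0 by (simp add: w_def field_simps)
  then show "1 / cheb q (Suc k) = w * A / (A\<^sup>2 - 1)"
    by simp
  have "cheb q k * (z\<^sup>2 - 1) * z ^ k = z * (z ^ (2 * k) - 1)"
    using cheb_closed_form[OF z(1), of k] by (simp only: q_def)
  moreover have "z ^ (2 * k) = A\<^sup>2 / z\<^sup>2" "z ^ k = A / z"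
    using z(1) by (simp_all add: A(1) power_mult power2_eq_square mult.commute[of 2 k])
  ultimately have "cheb q k * (z\<^sup>2 - 1) * (A / z) = z * (A\<^sup>2 / z\<^sup>2 - 1)"
    by simp
  moreover have "z * (A\<^sup>2 / z\<^sup>2 - 1) = (A\<^sup>2 - z\<^sup>2) / z"
    using z(1) by (simp add: power2_eq_square right_diff_distrib diff_divide_distrib)
  moreover have "cheb q k * (z\<^sup>2 - 1) * (A / z) = cheb q k * ((z\<^sup>2 - 1) * A) / z"
    by simp
  ultimately have "cheb q k * ((z\<^sup>2 - 1) * A) / z = (A\<^sup>2 - z\<^sup>2) / z"
    by metis
  then have "cheb q k * ((z\<^sup>2 - 1) * A) = A\<^sup>2 - z\<^sup>2"
    using z(1) by (simp only: divide_cancel_right) simp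
  moreover have "(z\<^sup>2 - 1) * A = z * w * A" "z * w * A \<noteq> 0"
    using z A0 by (simp_all add: w_def)
  ultimately have "cheb q k = (A\<^sup>2 - z\<^sup>2) / (z * w * A)"
    by (metis nonzero_eq_divide_eq)
  then have "cheb q k / cheb q (Suc k) = ((A\<^sup>2 - z\<^sup>2) / (z * w * A)) / ((A\<^sup>2 - 1) / (w * A))"
    by (simp only: 1)
  also have "\<dots> = (A\<^sup>2 - z\<^sup>2) / (z * (A\<^sup>2 - 1))"
    using w A0 by simp
  also have "\<dots> = ((A\<^sup>2 - 1) - z * w) / (z * (A\<^sup>2 - 1))"
    using z by (simp add: w_def)
  also have "\<dots> = 1 / z - w / (A\<^sup>2 - 1)"
    unfolding diff_divide_distrib[of "A\<^sup>2 - 1"] using z(1) A(2) by simp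
  finally show "cheb q k / cheb q (Suc k) = 1 / z - w / (A\<^sup>2 - 1)" .
qed

text \<open>Both entries of the 2 by 2 matrix carry the factor (z - 1)/z. Squared denominators occur
  only in \<open>?S\<^sup>2 - ?T\<^sup>2\<close>, and there 1/a^2 - A^2/a^2 = -1/a because a = A^2 -
  1; so multiplication by a b c clears everything.\<close>

lemma theta_det_closed_form:
  fixes z :: "'a::field"
  assumes z: "z \<noteq> 0" "z\<^sup>2 \<noteq> 1"
    and A: "A = z ^ Suc i" "A\<^sup>2 \<noteq> 1" and B: "B = z ^ Suc j" "B\<^sup>2 \<noteq> 1" and C: "C
        = z ^ Suc k" "C\<^sup>2 \<noteq> 1"
  shows "theta_det (z + 1 / z) i j k * ((z\<^sup>2 - 1) ^ 3 * z ^ (i + j + k + 3)) = z * (z - 1)\<^sup>2 *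
    ((z + 2)\<^sup>2 * ((A\<^sup>2 - 1) * (B\<^sup>2 - 1) * (C\<^sup>2 - 1))
     + (z + 1) * (z + 3) * ((A\<^sup>2 - 1) * (B\<^sup>2 - 1) + (B\<^sup>2 - 1) * (C\<^sup>2 - 1) + (A\<^sup>2 - 1) * (C\<^sup>2 - 1))
     + 2 * (z + 1)\<^sup>2 * ((1 - A * B) * (C\<^sup>2 - 1) + (1 - B * C) * (A\<^sup>2 - 1) + (1 - A * C) * (B\<^sup>2
         - 1)))"
proof -
  define a b c where abc: "a = A\<^sup>2 - 1" "b = B\<^sup>2 - 1" "c = C\<^sup>2 - 1"
  define w where "w = (z\<^sup>2 - 1) / z"
  have nz: "a \<noteq> 0" "b \<noteq> 0" "c \<noteq> 0" "A \<noteq> 0" "B \<noteq> 0" "C \<noteq> 0" "w \<noteq> 0"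
    using z A B C by (auto simp: abc w_def)
  note rA = cheb_ratios[OF z A, folded abc w_def] and rB = cheb_ratios[OF z B, folded abc w_def]
    and rC = cheb_ratios[OF z C, folded abc w_def]
  let ?S = "1 / a + 1 / b + 1 / c" and ?T = "A / a + B / b + C / c"
  have wz: "w = (z - 1) / z * (z + 1)"
    using z by (simp add: w_def field_simps power2_eq_square)
  have 1: "z + 1 / z + 1 - (1 / z - w / a + (1 / z - w / b) + (1 / z - w / c))
      = (z - 1) / z * (z + 2 + (z + 1) * ?S)"
  proof -
    have "z + 1 / z + 1 - (1 / z - w / a + (1 / z - w / b) + (1 / z - w / c))
       = (z + 1 - 2 / z) + w * ?S"
      by (simp add: algebra_simps)
    also have "z + 1 - 2 / z = (z - 1) / z * (z + 2)"
      using z by (simp add: field_simps)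
    also have "(z - 1) / z * (z + 2) + w * ?S = (z - 1) / z * (z + 2 + (z + 1) * ?S)"
      by (simp only: wz ring_distribs mult.assoc)
    finally show ?thesis .
  qed
  have 2: "w * A / a + w * B / b + w * C / c = (z - 1) / z * ((z + 1) * ?T)"
  proof -
    have "w * A / a + w * B / b + w * C / c = w * ?T"
      by (simp add: algebra_simps)
    also have "\<dots> = (z - 1) / z * ((z + 1) * ?T)"
      by (simp only: wz mult.assoc)
    finally show ?thesis .
  qed
  have det: "theta_det (z + 1 / z) i j k = a / (w * A) * (b / (w * B)) * (c / (w * C)) *
      (((z - 1) / z * (z + 2 + (z + 1) * ?S))\<^sup>2 - ((z - 1) / z * ((z + 1) * ?T))\<^sup>2)"
    unfolding theta_det_def rA(2,3) rB(2,3) rC(2,3) 1 2 unfolding rA(1) rB(1) rC(1) ..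
  have e: "(z\<^sup>2 - 1) ^ 3 * z ^ (i + j + k + 3) = (w * A) * (w * B) * (w * C) * z ^ 3"
    using z by (simp add: w_def A(1) B(1) C(1) power3_eq_cube power_add field_simps)
  have "theta_det (z + 1 / z) i j k * ((z\<^sup>2 - 1) ^ 3 * z ^ (i + j + k + 3)) = z ^ 3 * (a * b * c) *
      (((z - 1) / z * (z + 2 + (z + 1) * ?S))\<^sup>2 - ((z - 1) / z * ((z + 1) * ?T))\<^sup>2)"
    unfolding det e using nz by simp
  also have "\<dots> = z * (z - 1)\<^sup>2 * (a * b * c * ((z + 2 + (z + 1) * ?S)\<^sup>2 - ((z + 1) * ?T)\<^sup>2))"
  proof -
    have "z ^ 3 * t * (((z - 1) / z * X)\<^sup>2 - ((z - 1) / z * W)\<^sup>2) = z * (z - 1)\<^sup>2 * (t * (X\<^sup>2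
        - W\<^sup>2))"
      for t X W
      using z(1) by (simp add: power3_eq_cube power2_eq_square field_simps)
    then show ?thesis .
  qed
  also have "a * b * c * ((z + 2 + (z + 1) * ?S)\<^sup>2 - ((z + 1) * ?T)\<^sup>2)
      = (z + 2)\<^sup>2 * (a * b * c) + 2 * (z + 2) * (z + 1) * (a * b * c * ?S)
        + (z + 1)\<^sup>2 * (a * b * c * (?S\<^sup>2 - ?T\<^sup>2))"
  proof -
    have "t * ((z + 2 + (z + 1) * S)\<^sup>2 - ((z + 1) * T)\<^sup>2)
      = (z + 2)\<^sup>2 * t + 2 * (z + 2) * (z + 1) * (t * S) + (z + 1)\<^sup>2 * (t * (S\<^sup>2 - T\<^sup>2))" for t S T
      by (simp add: power2_eq_square algebra_simps)
    then show ?thesis .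
  qed
  also have "a * b * c * ?S = a * b + b * c + a * c"
    using nz by (simp add: field_simps)
  also have "a * b * c * (?S\<^sup>2 - ?T\<^sup>2) = - (a * b + b * c + a * c)
      + 2 * ((1 - A * B) * c + (1 - B * C) * a + (1 - A * C) * b)"
  proof -
    have sq: "1 / a - A\<^sup>2 / a = -1" "1 / b - B\<^sup>2 / b = -1" "1 / c - C\<^sup>2 / c = -1"
      using nz by (simp_all add: abc field_simps)
    have "?S\<^sup>2 - ?T\<^sup>2 = (1 / a - A\<^sup>2 / a) * (1 / a) + (1 / b - B\<^sup>2 / b) * (1 / b) + (1 / c
        - C\<^sup>2 / c) * (1 / c)
       + 2 * ((1 - A * B) / (a * b) + (1 - B * C) / (b * c) + (1 - A * C) / (a * c))"
      by (simp add: power2_eq_square algebra_simps diff_divide_distrib)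
    also have "\<dots> = - (1 / a + 1 / b + 1 / c) + 2 * ((1 - A * B) / (a * b) + (1 - B * C) / (b * c)
        + (1 - A * C) / (a * c))"
      unfolding sq by simp
    finally have d: "?S\<^sup>2 - ?T\<^sup>2 = \<dots>" .
    show ?thesis
      unfolding d using nz by (simp add: field_simps)
  qed
  finally show ?thesis
    unfolding abc by (simp add: power2_eq_square algebra_simps)
qed

text \<open>For a closed path the factor A - 1 cancels and only A + 1 stays in the denominator, by a
  = (A - 1)(A + 1). Clearing denominators therefore leaves (A - 1)(B - 1) outside; the joining path
  is handled by (1 - C^2)/c = -1.\<close>

lemma dumbbell_det_closed_form:
  fixes z :: "'a::field"
  assumes z: "z \<noteq> 0" "z\<^sup>2 \<noteq> 1"
    and A: "A = z ^ Suc i" "A\<^sup>2 \<noteq> 1" and B: "B = z ^ Suc j" "B\<^sup>2 \<noteq> 1" and C: "C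
        = z ^ Suc k" "C\<^sup>2 \<noteq> 1"
  shows "dumbbell_det (z + 1 / z) i j k * ((z\<^sup>2 - 1) ^ 3 * z ^ (i + j + k + 3)) = z * (z - 1)\<^sup>2 *
    ((A - 1) * (B - 1) * ((C\<^sup>2 - 1) * (((z + 2) * A - z) * ((z + 2) * B - z))
      + (z + 1) * (((z + 2) * A - z) * (B + 1) + ((z + 2) * B - z) * (A + 1)
        - (z + 1) * ((A + 1) * (B + 1)))))"
proof -
  define a b c where abc: "a = A\<^sup>2 - 1" "b = B\<^sup>2 - 1" "c = C\<^sup>2 - 1"
  define w where "w = (z\<^sup>2 - 1) / z"
  have fac: "a = (A - 1) * (A + 1)" "b = (B - 1) * (B + 1)"
    by (simp_all add: abc power2_eq_square algebra_simps)
  have nz: "a \<noteq> 0" "b \<noteq> 0" "c \<noteq> 0" "A \<noteq> 0" "B \<noteq> 0" "C \<noteq> 0" "w \<noteq> 0"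
    using z A B C by (auto simp: abc w_def)
  then have nz': "A - 1 \<noteq> 0" "B - 1 \<noteq> 0" "A + 1 \<noteq> 0" "B + 1 \<noteq> 0"
    by (auto simp: fac)
  note rA = cheb_ratios[OF z A, folded abc w_def] and rB = cheb_ratios[OF z B, folded abc w_def]
    and rC = cheb_ratios[OF z C, folded abc w_def]
  have wz: "w = (z - 1) / z * (z + 1)"
    using z by (simp add: w_def field_simps power2_eq_square)
  have loop: "z + 1 / z + 1 - (2 * s + 2) / s' - (1 / z - w / c)
      = (z - 1) / z * (((z + 2) * X - z) / (X + 1) + (z + 1) / c)"
    if "s / s' = 1 / z - w / x" "1 / s' = w * X / x" "x = (X - 1) * (X + 1)" "x \<noteq> 0" for s s' x X
  proof -
    have nzX: "X - 1 \<noteq> 0" "X + 1 \<noteq> 0"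
      using that by auto
    have "(2 * s + 2) / s' = 2 * (s / s' + 1 / s')"
      by (simp add: add_divide_distrib)
    also have "\<dots> = 2 / z - 2 * w * ((1 - X) / x)"
      unfolding that(1,2) by (simp add: diff_divide_distrib algebra_simps)
    also have "(1 - X) / x = - ((X - 1) / x)"
      by (metis minus_diff_eq minus_divide_left)
    also have "(X - 1) / x = 1 / (X + 1)"
      unfolding that(3) using nzX by simp
    finally have "z + 1 / z + 1 - (2 * s + 2) / s' - (1 / z - w / c)
        = (z + 1 - 2 / z) + w * (1 / c - 2 / (X + 1))"
      by (simp add: algebra_simps)
    also have "z + 1 - 2 / z = (z - 1) / z * (z + 2)"
      using z by (simp add: field_simps)
    also have "(z - 1) / z * (z + 2) + w * (1 / c - 2 / (X + 1))
        = (z - 1) / z * ((z + 2) + (z + 1) * (1 / c - 2 / (X + 1)))"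
      unfolding wz by (simp only: ring_distribs mult.assoc)
    also have "(z + 2) + (z + 1) * (1 / c - 2 / (X + 1)) = ((z + 2) * X - z) / (X + 1) + (z
        + 1) / c"
    proof -
      have "(z + 2) * X - z = (z + 2) * (X + 1) - (z + 1) * 2"
        by (simp add: algebra_simps)
      then have "((z + 2) * X - z) / (X + 1) = (z + 2) * (X + 1) / (X + 1) - (z + 1) * 2 / (X + 1)"
        by (simp only: diff_divide_distrib)
      also have "(z + 2) * (X + 1) / (X + 1) = z + 2"
        using nzX(2) by simp
      finally show ?thesis
        by (simp add: right_diff_distrib)
    qed
    finally show ?thesis .
  qed
  let ?P = "((z + 2) * A - z) / (A + 1)" and ?Q = "((z + 2) * B - z) / (B + 1)"
  have wC: "w * C / c = (z - 1) / z * ((z + 1) * C / c)"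
    by (simp add: wz mult.assoc)
  have det: "dumbbell_det (z + 1 / z) i j k = a / (w * A) * (b / (w * B)) * (c / (w * C)) *
      ((z - 1) / z * (?P + (z + 1) / c) * ((z - 1) / z * (?Q + (z + 1) / c)) - ((z - 1) / z * ((z
          + 1) * C / c))\<^sup>2)"
    unfolding dumbbell_det_def rC(2,3) loop[OF rA(2,3) fac(1) nz(1)] loop[OF rB(2,3) fac(2)
        nz(2)] wC
    unfolding rA(1) rB(1) rC(1) ..
  have e: "(z\<^sup>2 - 1) ^ 3 * z ^ (i + j + k + 3) = (w * A) * (w * B) * (w * C) * z ^ 3"
    using z by (simp add: w_def A(1) B(1) C(1) power3_eq_cube power_add field_simps)
  have "dumbbell_det (z + 1 / z) i j k * ((z\<^sup>2 - 1) ^ 3 * z ^ (i + j + k + 3)) = z ^ 3 * (a * b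
      * c) *
      ((z - 1) / z * (?P + (z + 1) / c) * ((z - 1) / z * (?Q + (z + 1) / c)) - ((z - 1) / z * ((z
          + 1) * C / c))\<^sup>2)"
    unfolding det e using nz by simp
  also have "\<dots> = z * (z - 1)\<^sup>2 * (a * b * (c * ((?P + (z + 1) / c) * (?Q + (z + 1) / c) - ((z
      + 1) * C / c)\<^sup>2)))"
  proof -
    have "z ^ 3 * t * ((z - 1) / z * X * ((z - 1) / z * Y) - ((z - 1) / z * W)\<^sup>2) = z * (z - 1)\<^sup>2
        * (t * (X * Y - W\<^sup>2))"
      for t X Y W
      using z(1) by (simp add: power3_eq_cube power2_eq_square field_simps)
    from this[of "a * b * c" "?P + (z + 1) / c" "?Q + (z + 1) / c" "(z + 1) * C / c"] show ?thesis
      by (simp only: mult.assoc)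
  qed
  also have "c * ((?P + (z + 1) / c) * (?Q + (z + 1) / c) - ((z + 1) * C / c)\<^sup>2)
      = c * (?P * ?Q) + (z + 1) * (?P + ?Q) + (z + 1)\<^sup>2 * ((1 - C\<^sup>2) / c)"
  proof -
    have "c * ((P + y / c) * (Q + y / c) - (y * C / c)\<^sup>2) = c * (P * Q) + y * (P + Q) + y\<^sup>2 * ((1
        - C\<^sup>2) / c)" for P Q y
      using nz(3) by (simp add: power2_eq_square field_simps)
    then show ?thesis .
  qed
  also have "(1 - C\<^sup>2) / c = -1"
    using nz(3) by (simp add: abc field_simps)
  also have "a * b * (c * (?P * ?Q) + (z + 1) * (?P + ?Q) + (z + 1)\<^sup>2 * -1)
     = (A - 1) * (B - 1) * (c * (((z + 2) * A - z) * ((z + 2) * B - z))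
      + (z + 1) * (((z + 2) * A - z) * (B + 1) + ((z + 2) * B - z) * (A + 1)
        - (z + 1) * ((A + 1) * (B + 1))))"
  proof -
    have "(A - 1) * (A + 1) * ((B - 1) * (B + 1)) * (c * (x / (A + 1) * (y / (B + 1))) + (z + 1)
        * (x / (A + 1) + y / (B + 1)) + (z + 1)\<^sup>2 * -1)
      = (A - 1) * (B - 1) * (c * (x * y) + (z + 1) * (x * (B + 1) + y * (A + 1) - (z + 1) * ((A
          + 1) * (B + 1))))" for x y
    proof -
      have "(A + 1) * (B + 1) * (c * (x / (A + 1) * (y / (B + 1))) + (z + 1) * (x / (A + 1) + y /
          (B + 1)) + (z + 1)\<^sup>2 * -1)
        = c * (x * y) + (z + 1) * (x * (B + 1) + y * (A + 1) - (z + 1) * ((A + 1) * (B + 1)))"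
      proof -
        have "(A + 1) * (B + 1) * (x / (A + 1) * (y / (B + 1))) = x * y"
          "(A + 1) * (B + 1) * (x / (A + 1)) = x * (B + 1)" "(A + 1) * (B + 1) * (y / (B + 1))
              = y * (A + 1)"
          using nz' by simp_all
        moreover have "(A + 1) * (B + 1) * (c * u + (z + 1) * (v + v') + (z + 1)\<^sup>2 * -1)
          = c * ((A + 1) * (B + 1) * u) + (z + 1) * ((A + 1) * (B + 1) * v + (A + 1) * (B + 1)
              * v' - (z + 1) * ((A + 1) * (B + 1)))" for u v v'
          by (simp add: power2_eq_square algebra_simps)
        ultimately show ?thesis
          by (simp only:)
      qed
      then show ?thesis
        by (metis (no_types, opaque_lifting) mult.assoc mult.left_commute)
    qed
    then show ?thesis
      unfolding fac .
  qed
  finally show ?thesis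
    unfolding abc .
qed

section \<open>Comparison of low order coefficients\<close>

text \<open>
  The arguments are the lengths of the paths and cycles, i.e. one more than the numbers of inner
  vertices.  In both definitions the last parenthesis collects the terms of high order.
\<close>

definition theta_poly :: "nat \<Rightarrow> nat \<Rightarrow> nat \<Rightarrow> real poly" where
  "theta_poly a b c = [:-1, -4, -4:]
     + (monom 1 (2 * a + 2) + monom 1 (2 * b + 2) + monom 1 (2 * c + 2))
     + [:2, 4, 2:] * (monom 1 (a + b) + monom 1 (b + c) + monom 1 (a + c))
     + ([:4, 4, 1:] * monom 1 (2 * a + 2 * b + 2 * c)
     - (monom 1 (2 * a + 2 * b) + monom 1 (2 * b + 2 * c) + monom 1 (2 * a + 2 * c))
     - [:2, 4, 2:] * (monom 1 (2 * a + b + c) + monom 1 (a + 2 * b + c) + monom 1 (a + b + 2 * c)))"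

definition dumbbell_poly :: "nat \<Rightarrow> nat \<Rightarrow> nat \<Rightarrow> real poly" where
  "dumbbell_poly p q l = [:-1, -4, -4:]
     + monom 1 (2 * l + 2) + [:2, 6, 4:] * (monom 1 p + monom 1 q)
     + ([:0, 2, 1:] * (monom 1 (2 * p + 2 * l) + monom 1 (2 * q + 2 * l))
     - [:0, 2, 2:] * (monom 1 (p + 2 * l) + monom 1 (q + 2 * l))
     - [:1, 2:] * (monom 1 (2 * p) + monom 1 (2 * q))
     + [:4, 8, 4:] * (monom 1 (p + q + 2 * l) - monom 1 (p + q))
     + [:2, 2:] * (monom 1 (2 * p + q) + monom 1 (p + 2 * q))
     - [:4, 6, 2:] * (monom 1 (2 * p + q + 2 * l) + monom 1 (p + 2 * q + 2 * l))
     + [:4, 4, 1:] * monom 1 (2 * p + 2 * q + 2 * l) - monom 1 (2 * p + 2 * q))"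

lemma poly_theta_poly:
  fixes z :: real
  assumes "A = z ^ a" "B = z ^ b" "C = z ^ c"
  shows "poly (theta_poly a b c) z =
    (z + 2)\<^sup>2 * ((A\<^sup>2 - 1) * (B\<^sup>2 - 1) * (C\<^sup>2 - 1))
     + (z + 1) * (z + 3) * ((A\<^sup>2 - 1) * (B\<^sup>2 - 1) + (B\<^sup>2 - 1) * (C\<^sup>2 - 1) + (A\<^sup>2 - 1) * (C\<^sup>2 - 1))
     + 2 * (z + 1)\<^sup>2 * ((1 - A * B) * (C\<^sup>2 - 1) + (1 - B * C) * (A\<^sup>2 - 1) + (1 - A * C) * (B\<^sup>2
         - 1))"
proof -
  have p: "poly (theta_poly a b c) z = -1 - 4 * z - 4 * z\<^sup>2
     + (A\<^sup>2 + B\<^sup>2 + C\<^sup>2) * z\<^sup>2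
     + (2 + 4 * z + 2 * z\<^sup>2) * (A * B + B * C + A * C)
     + ((4 + 4 * z + z\<^sup>2) * (A\<^sup>2 * B\<^sup>2 * C\<^sup>2)
     - (A\<^sup>2 * B\<^sup>2 + B\<^sup>2 * C\<^sup>2 + A\<^sup>2 * C\<^sup>2)
     - (2 + 4 * z + 2 * z\<^sup>2) * (A\<^sup>2 * B * C + A * B\<^sup>2 * C + A * B * C\<^sup>2))"
    unfolding theta_poly_def assms
    by (simp add: poly_monom power_add power_mult power2_eq_square algebra_simps power_mult_distrib)
  show ?thesis
    unfolding p by (simp add: power2_eq_square algebra_simps)
qed

lemma poly_dumbbell_poly:
  fixes z :: real
  assumes "A = z ^ p" "B = z ^ q" "C = z ^ l"
  shows "poly (dumbbell_poly p q l) z =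
    (A - 1) * (B - 1) * ((C\<^sup>2 - 1) * (((z + 2) * A - z) * ((z + 2) * B - z))
      + (z + 1) * (((z + 2) * A - z) * (B + 1) + ((z + 2) * B - z) * (A + 1)
        - (z + 1) * ((A + 1) * (B + 1))))"
proof -
  have p: "poly (dumbbell_poly p q l) z = -1 - 4 * z - 4 * z\<^sup>2
     + C\<^sup>2 * z\<^sup>2 + (2 + 6 * z + 4 * z\<^sup>2) * (A + B)
     + ((2 * z + z\<^sup>2) * (A\<^sup>2 * C\<^sup>2 + B\<^sup>2 * C\<^sup>2)
     - (2 * z + 2 * z\<^sup>2) * (A * C\<^sup>2 + B * C\<^sup>2)
     - (1 + 2 * z) * (A\<^sup>2 + B\<^sup>2)
     + (4 + 8 * z + 4 * z\<^sup>2) * (A * B * C\<^sup>2 - A * B)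
     + (2 + 2 * z) * (A\<^sup>2 * B + A * B\<^sup>2)
     - (4 + 6 * z + 2 * z\<^sup>2) * (A\<^sup>2 * B * C\<^sup>2 + A * B\<^sup>2 * C\<^sup>2)
     + (4 + 4 * z + z\<^sup>2) * (A\<^sup>2 * B\<^sup>2 * C\<^sup>2) - A\<^sup>2 * B\<^sup>2)"
    unfolding dumbbell_poly_def assms
    by (simp add: poly_monom power_add power_mult power2_eq_square algebra_simps power_mult_distrib)
  show ?thesis
    unfolding p by (simp add: power2_eq_square algebra_simps)
qed

section \<open>Extraction of the low order coefficients\<close>

lemma coeff_mult_monom_1:
  "coeff (p * monom (1::'a::comm_semiring_1) n) k = (if n \<le> k then coeff p (k - n) else 0)"
  by (subst mult.commute) (simp add: coeff_monom_mult)

text \<open>The low order part without the common summand -(1 + 2z)^2. Its coefficients are natural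
  numbers, which allows arguments by parity and by size.\<close>

definition theta_coeff :: "nat \<Rightarrow> nat \<Rightarrow> nat \<Rightarrow> nat \<Rightarrow> nat" where
  "theta_coeff a b c k =
     of_bool (k = 2 * a + 2) + of_bool (k = 2 * b + 2) + of_bool (k = 2 * c + 2)
     + 2 * (of_bool (k = a + b) + of_bool (k = b + c) + of_bool (k = a + c))
     + 4 * (of_bool (k = a + b + 1) + of_bool (k = b + c + 1) + of_bool (k = a + c + 1))
     + 2 * (of_bool (k = a + b + 2) + of_bool (k = b + c + 2) + of_bool (k = a + c + 2))"

definition dumbbell_coeff :: "nat \<Rightarrow> nat \<Rightarrow> nat \<Rightarrow> nat \<Rightarrow> nat" where
  "dumbbell_coeff p q l k = of_bool (k = 2 * l + 2)
     + 2 * (of_bool (k = p) + of_bool (k = q)) + 6 * (of_bool (k = p + 1) + of_bool (k = q + 1))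
     + 4 * (of_bool (k = p + 2) + of_bool (k = q + 2))"

lemma coeff_quadratic_monom:
  fixes x :: "'a::comm_semiring_1"
  shows "coeff ([:x, y, w:] * monom 1 n) k
    = x * of_bool (k = n) + y * of_bool (k = n + 1) + w * of_bool (k = n + 2)"
proof (cases "n \<le> k")
  case True
  then obtain d where k: "k = n + d"
    using le_Suc_ex by blast
  show ?thesis
    unfolding k coeff_mult_monom_1
    by (cases d; cases "d - 1"; cases "d - 2") (auto simp: coeff_pCons split: nat.splits)
next
  case False
  then show ?thesis
    unfolding coeff_mult_monom_1 by simp
qed

lemma coeff_linear_monom:
  fixes x :: "'a::comm_semiring_1"
  shows "coeff ([:x, y:] * monom 1 n) k = x * of_bool (k = n) + y * of_bool (k = n + 1)"
  using coeff_quadratic_monom[of x y 0 n k] by simp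

lemma coeff_monom_1: "coeff (monom 1 n) k = of_bool (k = n)"
  by simp

lemmas coeff_expand = coeff_add coeff_diff distrib_left[of "pCons _ _"]
    right_diff_distrib[of "pCons _ _"]
  coeff_quadratic_monom coeff_linear_monom coeff_monom_1

text \<open>The terms of high order start at exponent 2b + 2c, which is at least b + c + 2.\<close>

lemma coeff_theta_poly:
  assumes "a \<ge> b" "b \<ge> c" "c \<ge> 1" "k \<le> b + c + 1"
  shows "coeff (theta_poly a b c) k = coeff [:-1, -4, -4:] k + real (theta_coeff a b c k)"
proof -
  have high: "of_bool (k = n) = (0::real) \<and> of_bool (k = n + 1) = (0::real) \<and> of_bool (k = n + 2)
      = (0::real)"
    if "k < n" for n
    using that by simp
  have "k < 2 * a + 2 * b + 2 * c" "k < 2 * a + 2 * b" "k < 2 * b + 2 * c" "k < 2 * a + 2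
      * c" "k < 2 * a + b + c" "k < a + 2 * b + c" "k < a + b + 2 * c"
    using assms by linarith+
  note high = this[THEN high]
  show ?thesis
    unfolding theta_poly_def theta_coeff_def coeff_expand
    by (simp only: high of_nat_add of_nat_mult of_nat_of_bool of_nat_numeral mult_zero_right)
      (simp only: algebra_simps mult_zero_right add_0_right add_0_left diff_self mult_1)
qed

text \<open>The terms of high order start no lower than p + 2: this uses l \<ge> 1 for p + 2l, and p
  \<ge> 2 for 2p and p + q.\<close>

lemma coeff_dumbbell_poly:
  assumes "p \<le> q" "p \<ge> 2" "l \<ge> 1" "k \<le> p + 1"
  shows "coeff (dumbbell_poly p q l) k = coeff [:-1, -4, -4:] k + real (dumbbell_coeff p q l k)"
proof -
  have high: "of_bool (k = n) = (0::real) \<and> of_bool (k = n + 1) = (0::real) \<and> of_bool (k = n + 2)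
      = (0::real)"
    if "k < n" for n
    using that by simp
  have "k < 2 * p + 2 * l" "k < 2 * q + 2 * l" "k < p + 2 * l" "k < q + 2 * l" "k < 2 * p" "k < 2
      * q" "k < p + q + 2 * l" "k < p + q" "k < 2 * p + q" "k < p + 2 * q" "k < 2 * p + q + 2
          * l" "k < p + 2 * q + 2 * l" "k < 2 * p + 2 * q + 2 * l" "k < 2 * p + 2 * q"
    using assms by linarith+
  note high = this[THEN high]
  show ?thesis
    unfolding dumbbell_poly_def dumbbell_coeff_def coeff_expand
    by (simp only: high of_nat_add of_nat_mult of_nat_of_bool of_nat_numeral mult_zero_right)
      (simp only: algebra_simps mult_zero_right add_0_right add_0_left diff_self mult_1)
qed

text \<open>
  The first exponent \<open>min (2c + 2) (b + c)\<close> with its coefficient, which is even iff \<open>b \<le> c + 1\<close>,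
  determines \<open>c\<close>; then the exponent \<open>b + c\<close> determines \<open>b\<close>.
\<close>

lemma theta_coeff_inj:
  assumes ord: "a \<ge> b" "b \<ge> c" "c \<ge> 1" "a' \<ge> b'" "b' \<ge> c'" "c' \<ge> 1"
    and N: "a + b + c = a' + b' + c'"
    and eq: "\<And>k. k \<le> b + c + 1 \<Longrightarrow> k \<le> b' + c' + 1 \<Longrightarrow> theta_coeff a b c k = theta_coeff a' b' c' k"
  shows "a = a' \<and> b = b' \<and> c = c'"
proof -
  have first: "(\<forall>k<e. theta_coeff a b c k = 0) \<and> theta_coeff a b c e > 0 \<and> e \<le> b + c \<and>
      (even (theta_coeff a b c e) \<and> c = e div 2 \<or> odd (theta_coeff a b c e) \<and> c = e div 2 - 1)"
    if "a \<ge> b" "b \<ge> c" "c \<ge> 1" "e = min (2 * c + 2) (b + c)" for a b c e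
  proof (cases "b \<le> c + 1")
    case True
    then have e: "e = b + c" using that by simp
    have "\<forall>k<e. theta_coeff a b c k = 0"
      using \<open>a \<ge> b\<close> \<open>b \<ge> c\<close> \<open>c \<ge> 1\<close> True by (simp add: e theta_coeff_def)
    moreover have at: "theta_coeff a b c e = 2 * (of_bool (e = a + b) + 1 + of_bool (e = a + c))"
      using that(1-3) True by (simp add: e theta_coeff_def)
    moreover have "theta_coeff a b c e > 0" "even (theta_coeff a b c e)"
      unfolding at by simp_all
    \<comment> \<open>Here b is c or c + 1, so e is 2c or 2c + 1.\<close>
    moreover have "c = e div 2"
      using True that(2) unfolding e by presburger
    moreover have "e \<le> b + c"
      by (simp add: e)
    ultimately show ?thesis
      by blast
  next
    case False
    then have e: "e = 2 * c + 2" using that by simp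
    have "\<forall>k<e. theta_coeff a b c k = 0"
      using \<open>a \<ge> b\<close> \<open>b \<ge> c\<close> \<open>c \<ge> 1\<close> False by (simp add: e theta_coeff_def)
    moreover have at: "theta_coeff a b c e = 1 + 2 * (of_bool (e = b + c) + of_bool (e = a + c))"
      using that(1-3) False by (simp add: e theta_coeff_def)
    moreover have "theta_coeff a b c e > 0" "odd (theta_coeff a b c e)"
      unfolding at by simp_all
    moreover have "c = e div 2 - 1" "e \<le> b + c"
      using False by (simp_all add: e)
    ultimately show ?thesis
      by blast
  qed
  define e e' where "e = min (2 * c + 2) (b + c)" and "e' = min (2 * c' + 2) (b' + c')"
  note f = first[OF ord(1-3) e_def] and f' = first[OF ord(4-6) e'_def]
  \<comment> \<open>The smaller of the two exponents lies in the compared range, and there only one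
    of the two coefficients would be nonzero.\<close>
  have "e = e'"
  proof (rule linorder_cases)
    assume "e < e'"
    then show ?thesis
      using f f' eq[of e] by (metis le_add1 less_imp_le order_trans nat_less_le)
  next
    assume "e' < e"
    then show ?thesis
      using f f' eq[of e'] by (metis le_add1 less_imp_le order_trans nat_less_le)
  qed auto
  moreover have "theta_coeff a b c e = theta_coeff a' b' c' e"
    using f f' eq[of e] \<open>e = e'\<close> by (meson le_add1 order_trans)
  ultimately have c: "c = c'"
    using f f' by metis
  have second: "b \<ge> b'"
    if ord: "a \<ge> b" "b \<ge> c" "a' \<ge> b'" "b' \<ge> c" "c \<ge> 1"
      and eq: "\<And>k. k \<le> b + c + 1 \<Longrightarrow> k \<le> b' + c + 1 \<Longrightarrow> theta_coeff a b c k = theta_coeff a' b' c k"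
    for a b a' b'
  proof (rule ccontr)
    assume less: "\<not> b \<ge> b'"
    have "theta_coeff a b c (b + c) \<ge> of_bool (b + c = 2 * c + 2) + 2"
      unfolding theta_coeff_def by simp
    moreover have "theta_coeff a' b' c (b + c) = of_bool (b + c = 2 * c + 2)"
      using less ord unfolding theta_coeff_def by simp
    ultimately show False
      using eq[of "b + c"] less by simp
  qed
  have "b \<ge> b'" "b' \<ge> b"
    using second[of b a b' a'] second[of b' a' b a] ord eq c by auto
  then show ?thesis
    using N c by simp
qed

text \<open>
  Comparing first exponents gives \<open>p = b + c\<close>, so \<open>a = q + l > b + c\<close>, and then the coefficients at
  \<open>p + 1\<close> are at most 5 and at least 6, respectively.
\<close>

lemma theta_coeff_neq_dumbbell_coeff:
  assumes ord: "a \<ge> b" "b \<ge> c" "c \<ge> 1" "p \<le> q" "p \<ge> 2" "l \<ge> 1" and N: "a + b + c = p + q + l"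
    and eq: "\<And>k. k \<le> b + c + 1 \<Longrightarrow> k \<le> p + 1 \<Longrightarrow> theta_coeff a b c k = dumbbell_coeff p q l k"
  shows False
proof -
  have "p = b + c"
  proof (cases "b \<le> c + 1")
    case True
    have lt: "theta_coeff a b c k = 0" if "k < b + c" for k
      using that ord True by (simp add: theta_coeff_def)
    have at: "theta_coeff a b c (b + c) = 2 * (of_bool (c = a) + 1 + of_bool (b = a))"
      using ord True by (auto simp add: theta_coeff_def)
    have ev: "even (theta_coeff a b c (b + c))"
      unfolding at by simp
    have "\<not> p < b + c"
      using lt[of p] eq[of p] by (auto simp: dumbbell_coeff_def)
    \<comment> \<open>Otherwise the dumbbell has an odd coefficient at 2l + 2 and none below it,
      whereas here the first theta coefficient is even.\<close>
    moreover have "\<not> 2 * l + 2 \<le> p"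
    proof
      assume l: "2 * l + 2 \<le> p"
      have "dumbbell_coeff p q l (2 * l + 2) = 1 + 2 * (of_bool (2 * l + 2 = p) + of_bool (2 * l
          + 2 = q))"
        using l ord by (simp add: dumbbell_coeff_def)
      then have odd: "odd (dumbbell_coeff p q l (2 * l + 2))"
        by simp
      consider "2 * l + 2 < b + c" | "2 * l + 2 = b + c" | "b + c < 2 * l + 2"
        by linarith
      then show False
      proof cases
        case 1
        then show False
          using lt eq[of "2 * l + 2"] l odd by simp
      next
        case 2
        then show False
          using ev eq[of "2 * l + 2"] l odd by simp
      next
        case 3
        then have "dumbbell_coeff p q l (b + c) = 0"
          using l ord by (simp add: dumbbell_coeff_def)
        then show False
          using at eq[of "b + c"] 3 l by simp
      qed
    qed
    moreover have "\<not> b + c < p"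
    proof
      assume *: "b + c < p"
      then have "dumbbell_coeff p q l (b + c) = 0"
        using ord \<open>\<not> 2 * l + 2 \<le> p\<close> by (simp add: dumbbell_coeff_def)
      then show False
        using at eq[of "b + c"] * by simp
    qed
    ultimately show ?thesis by simp
  next
    case False
    have lt: "theta_coeff a b c k = 0" if "k < 2 * c + 2" for k
      using that ord False by (simp add: theta_coeff_def)
    have at: "theta_coeff a b c (2 * c + 2) = 1 + 2 * (of_bool (2 * c + 2 = b + c) + of_bool (2
        * c + 2 = a + c))"
      using ord False by (simp add: theta_coeff_def)
    have od: "odd (theta_coeff a b c (2 * c + 2))"
      unfolding at by simp
    have dlt: "dumbbell_coeff p q l k = of_bool (k = 2 * l + 2)" if "k < p" for k
      using that ord by (simp add: dumbbell_coeff_def)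
    have "2 * c + 2 \<le> p"
    proof (rule ccontr)
      assume "\<not> 2 * c + 2 \<le> p"
      then show False
        using lt[of p] eq[of p] False by (auto simp: dumbbell_coeff_def)
    qed
    \<comment> \<open>Up to exponent p, a dumbbell coefficient can be odd only at 2l + 2. The odd
      theta coefficient at 2c + 2 \<le> p therefore forces l = c.\<close>
    have "l = c"
    proof (cases "2 * c + 2 = p")
      case True
      have "dumbbell_coeff p q l p = of_bool (p = 2 * l + 2) + 2 * (1 + of_bool (p = q))"
        using ord by (simp add: dumbbell_coeff_def)
      moreover have "odd (dumbbell_coeff p q l p)"
        using od eq[of p] True False by simp
      ultimately have "p = 2 * l + 2"
        by (cases "p = 2 * l + 2") simp_all
      then show ?thesis
        using True by simp
    next
      case F: False
      then have "2 * c + 2 < p"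
        using \<open>2 * c + 2 \<le> p\<close> by simp
      then show ?thesis
        using dlt[of "2 * c + 2"] at eq[of "2 * c + 2"] False by (cases "2 * c + 2 = 2 * l
            + 2") simp_all
    qed
    \<comment> \<open>The terms at 2c + 2 = 2l + 2 now match, so the next contributions, at b + c
      and at p, must sit at the same exponent.\<close>
    have tlt: "theta_coeff a b c k = of_bool (k = 2 * c + 2)" if "k < b + c" for k
      using that ord False by (simp add: theta_coeff_def)
    have "\<not> p < b + c"
    proof
      assume *: "p < b + c"
      have "dumbbell_coeff p q l p \<ge> of_bool (p = 2 * l + 2) + 2"
        by (simp add: dumbbell_coeff_def)
      then show False
        using tlt[OF *] eq[of p] * \<open>l = c\<close> by simp
    qed
    moreover have "\<not> b + c < p"
    proof
      assume *: "b + c < p"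
      have "theta_coeff a b c (b + c) \<ge> of_bool (b + c = 2 * c + 2) + 2"
        by (simp add: theta_coeff_def)
      then show False
        using dlt[OF *] eq[of "b + c"] * \<open>l = c\<close> by simp
    qed
    ultimately show ?thesis by simp
  qed
  moreover from this have "a > b + c"
    using N ord by linarith
  \<comment> \<open>The term z^(b+c+1) contributes 4 and z^(2c+2) at most 1; every exponent
    involving a is larger.\<close>
  ultimately have "theta_coeff a b c (p + 1) \<le> 5"
    using ord by (simp add: theta_coeff_def)
  moreover have "dumbbell_coeff p q l (p + 1) \<ge> 6"
    by (simp add: dumbbell_coeff_def)
  ultimately show False
    using eq[of "p + 1"] \<open>p = b + c\<close> by simp
qed

section \<open>From equal determinants to equal polynomials\<close>

lemma poly_eqI_unit_interval:
  fixes p r :: "real poly"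
  assumes "\<And>z. 0 < z \<Longrightarrow> z < 1 \<Longrightarrow> poly p z = poly r z"
  shows "p = r"
proof (rule ccontr)
  assume "p \<noteq> r"
  then have "finite {z. poly (p - r) z = 0}"
    by (intro poly_roots_finite) simp
  moreover have "{0<..<1} \<subseteq> {z. poly (p - r) z = 0}"
    using assms by auto
  ultimately have "finite {0<..<1::real}"
    by (rule finite_subset[rotated])
  then show False
    by (simp add: infinite_Ioo)
qed

text \<open>The interval (0, 1) for z corresponds to q > 2, and no denominator of the closed forms
  vanishes on it.\<close>

lemma unit_interval_facts:
  fixes z :: real
  assumes z: "0 < z" "z < 1"
  shows "z + 1 / z > 2" "z \<noteq> 0" "z\<^sup>2 \<noteq> 1" "(z ^ Suc k)\<^sup>2 \<noteq> 1"
proof -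
  have "z + 1 / z - 2 = (1 - z)\<^sup>2 / z"
    using z by (simp add: field_simps power2_eq_square)
  also have "\<dots> > 0"
    using z by simp
  finally show "z + 1 / z > 2" by simp
  have pow: "(z ^ Suc k)\<^sup>2 < 1" for k
    using power_Suc_less_one[of z "k + Suc k"] z by (simp add: power2_eq_square power_add mult_ac)
  show "(z ^ Suc k)\<^sup>2 \<noteq> 1"
    using pow[of k] by simp
  show "z\<^sup>2 \<noteq> 1"
    using pow[of 0] by simp
qed (use z in simp)

lemma theta_det_poly:
  fixes z :: real
  assumes z: "0 < z" "z < 1"
  shows "theta_det (z + 1 / z) i j k * ((z\<^sup>2 - 1) ^ 3 * z ^ (i + j + k + 3))
    = z * (z - 1)\<^sup>2 * poly (theta_poly (Suc i) (Suc j) (Suc k)) z"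
  using theta_det_closed_form[OF unit_interval_facts(2,3)[OF z] refl unit_interval_facts(4)[OF z,
      of i]
      refl unit_interval_facts(4)[OF z, of j] refl unit_interval_facts(4)[OF z, of k]]
    poly_theta_poly[OF refl refl refl, of "Suc i" "Suc j" "Suc k" z] by (simp only:)

lemma dumbbell_det_poly:
  fixes z :: real
  assumes z: "0 < z" "z < 1"
  shows "dumbbell_det (z + 1 / z) i j k * ((z\<^sup>2 - 1) ^ 3 * z ^ (i + j + k + 3))
    = z * (z - 1)\<^sup>2 * poly (dumbbell_poly (Suc i) (Suc j) (Suc k)) z"
  using dumbbell_det_closed_form[OF unit_interval_facts(2,3)[OF z] refl unit_interval_facts(4)[OF
      z, of i]
      refl unit_interval_facts(4)[OF z, of j] refl unit_interval_facts(4)[OF z, of k]]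
    poly_dumbbell_poly[OF refl refl refl, of "Suc i" "Suc j" "Suc k" z] by (simp only:)

lemma theta_det_inj:
  assumes "i \<ge> j" "j \<ge> k" "i' \<ge> j'" "j' \<ge> k'" "i + j + k = i' + j' + k'"
    and eq: "\<And>q::real. q > 2 \<Longrightarrow> theta_det q i j k = theta_det q i' j' k'"
  shows "i = i' \<and> j = j' \<and> k = k'"
proof -
  have "theta_poly (Suc i) (Suc j) (Suc k) = theta_poly (Suc i') (Suc j') (Suc k')"
  proof (rule poly_eqI_unit_interval)
    fix z :: real assume z: "0 < z" "z < 1"
    have "z * (z - 1)\<^sup>2 * poly (theta_poly (Suc i) (Suc j) (Suc k)) z
        = z * (z - 1)\<^sup>2 * poly (theta_poly (Suc i') (Suc j') (Suc k')) z"
      unfolding theta_det_poly[OF z, symmetric] eq[OF unit_interval_facts(1)[OF z]] assms(5) ..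
    then show "poly (theta_poly (Suc i) (Suc j) (Suc k)) z = poly (theta_poly (Suc i') (Suc j')
        (Suc k')) z"
      using z by simp
  qed
  then have poly: "coeff (theta_poly (Suc i) (Suc j) (Suc k)) m = coeff (theta_poly (Suc i')
      (Suc j') (Suc k')) m" for m
    by simp
  have "Suc i = Suc i' \<and> Suc j = Suc j' \<and> Suc k = Suc k'"
  proof (rule theta_coeff_inj)
    fix m assume "m \<le> Suc j + Suc k + 1" "m \<le> Suc j' + Suc k' + 1"
    then show "theta_coeff (Suc i) (Suc j) (Suc k) m = theta_coeff (Suc i') (Suc j') (Suc k') m"
      using coeff_theta_poly[of "Suc j" "Suc i" "Suc k" m] coeff_theta_poly[of "Suc j'" "Suc
          i'" "Suc k'" m]
        assms(1-4) poly[of m] by simp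
  qed (use assms in simp_all)
  then show ?thesis
    by simp
qed

lemma theta_det_neq_dumbbell_det:
  assumes "i \<ge> j" "j \<ge> k" "i' \<le> j'" "i' \<ge> 1" "i + j + k = i' + j' + k'"
    and eq: "\<And>q::real. q > 2 \<Longrightarrow> theta_det q i j k = dumbbell_det q i' j' k'"
  shows False
proof -
  have poly: "theta_poly (Suc i) (Suc j) (Suc k) = dumbbell_poly (Suc i') (Suc j') (Suc k')"
  proof (rule poly_eqI_unit_interval)
    fix z :: real assume z: "0 < z" "z < 1"
    have "z * (z - 1)\<^sup>2 * poly (theta_poly (Suc i) (Suc j) (Suc k)) z
        = z * (z - 1)\<^sup>2 * poly (dumbbell_poly (Suc i') (Suc j') (Suc k')) z"
      unfolding theta_det_poly[OF z, symmetric] dumbbell_det_poly[OF z, symmetric]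
        eq[OF unit_interval_facts(1)[OF z]] assms(5) ..
    then show "poly (theta_poly (Suc i) (Suc j) (Suc k)) z = poly (dumbbell_poly (Suc i')
        (Suc j') (Suc k')) z"
      using z by simp
  qed
  show False
  proof (rule theta_coeff_neq_dumbbell_coeff[of "Suc j" "Suc i" "Suc k" "Suc i'" "Suc j'" "Suc k'"])
    fix m assume "m \<le> Suc j + Suc k + 1" "m \<le> Suc i' + 1"
    then show "theta_coeff (Suc i) (Suc j) (Suc k) m = dumbbell_coeff (Suc i') (Suc j') (Suc k') m"
      using coeff_theta_poly[of "Suc j" "Suc i" "Suc k" m] coeff_dumbbell_poly[of "Suc i'" "Suc
          j'" "Suc k'" m]
        assms(1-4) unfolding poly by simp
  qed (use assms in simp_all)
qed

text \<open>For q \<ge> 2 the increments of the sequence never decrease, and the first one is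
  1.\<close>

lemma cheb_ge_2:
  fixes q :: real
  assumes "q \<ge> 2"
  shows "cheb q (Suc k) \<ge> cheb q k + 1" "cheb q k \<ge> 0" "cheb q (Suc k) > 0"
proof -
  have "cheb q (Suc k) \<ge> cheb q k + 1 \<and> cheb q k \<ge> 0"
  proof (induction k)
    case (Suc k)
    have "q * cheb q (Suc k) \<ge> 2 * cheb q (Suc k)"
      using Suc assms by (intro mult_right_mono) auto
    with Suc show ?case
      unfolding cheb.simps(3) by linarith
  qed simp
  then show "cheb q (Suc k) \<ge> cheb q k + 1" "cheb q k \<ge> 0" "cheb q (Suc k) > 0"
    by auto
qed

text \<open>Factor the 2 by 2 determinant as a difference of squares. Since P + Q \<le> 3, one
  factor is at least \<epsilon> and the other at least 2Q, hence at least twice the reciprocal of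
  the first path factor; the other two path factors are at least 1.\<close>

lemma theta_det_lower_bound:
  fixes \<epsilon> :: real
  assumes \<epsilon>: "\<epsilon> \<ge> 0"
  shows "theta_det (2 + \<epsilon>) i j k \<ge> 2 * \<epsilon>"
proof -
  define s where "s = cheb (2 + \<epsilon>)"
  have s: "s (Suc n) > 0" "s (Suc n) \<ge> 1" "s n + 1 \<le> s (Suc n)" for n
    using cheb_ge_2[of "2 + \<epsilon>" n] \<epsilon> unfolding s_def by auto
  have ratio: "s n / s (Suc n) + 1 / s (Suc n) \<le> 1" for n
    using s[of n] by (simp add: field_simps)
  define P Q where "P = s i / s (Suc i) + s j / s (Suc j) + s k / s (Suc k)"
    and "Q = 1 / s (Suc i) + 1 / s (Suc j) + 1 / s (Suc k)"
  have PQ: "P + Q \<le> 3"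
    using ratio[of i] ratio[of j] ratio[of k] unfolding P_def Q_def by linarith
  have Q: "Q \<ge> 1 / s (Suc i)"
    using s(1)[of j] s(1)[of k] unfolding Q_def by simp
  have "theta_det (2 + \<epsilon>) i j k = s (Suc i) * s (Suc j) * s (Suc k) * ((3 + \<epsilon> - P)\<^sup>2 - Q\<^sup>2)"
    unfolding theta_det_def P_def Q_def s_def by (simp add: add.commute)
  also have "(3 + \<epsilon> - P)\<^sup>2 - Q\<^sup>2 = (3 + \<epsilon> - P - Q) * (3 + \<epsilon> - P + Q)"
    by (simp add: power2_eq_square algebra_simps)
  also have "s (Suc i) * s (Suc j) * s (Suc k) * ((3 + \<epsilon> - P - Q) * (3 + \<epsilon> - P + Q))
      \<ge> s (Suc i) * s (Suc j) * s (Suc k) * (\<epsilon> * (2 / s (Suc i)))"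
  proof (intro mult_left_mono mult_mono)
    show "2 / s (Suc i) \<le> 3 + \<epsilon> - P + Q"
      using PQ Q \<epsilon> by simp
  qed (use PQ \<epsilon> s(1) in \<open>auto intro: less_imp_le mult_pos_pos\<close>)
  also have "s (Suc i) * s (Suc j) * s (Suc k) * (\<epsilon> * (2 / s (Suc i))) = (s (Suc j) * s (Suc k))
      * (2 * \<epsilon>)"
    using s(1)[of i] by simp
  finally have "theta_det (2 + \<epsilon>) i j k \<ge> s (Suc j) * s (Suc k) * (2 * \<epsilon>)" .
  moreover have "s (Suc j) * s (Suc k) * (2 * \<epsilon>) \<ge> 1 * (2 * \<epsilon>)"
  proof (rule mult_right_mono)
    show "1 \<le> s (Suc j) * s (Suc k)"
      using mult_mono[of 1 "s (Suc j)" 1 "s (Suc k)"] s(2)[of j] s(2)[of k] by simp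
  qed (use \<epsilon> in simp)
  ultimately show ?thesis by simp
qed

text \<open>Signs and estimates are real, the Laplacian matrices complex; this and the next two
  lemmas pass from one to the other.\<close>

lemma cheb_of_real: "cheb (of_real q :: 'a::{real_algebra_1,comm_ring_1}) k = of_real (cheb q k)"
  by (induction k rule: induct_nat_012) (simp_all add: cheb.simps(3))

lemma theta_det_of_real: "theta_det (of_real q :: 'a::real_field) i j k = of_real
    (theta_det q i j k)"
  unfolding theta_det_def cheb_of_real by simp

lemma dumbbell_det_of_real: "dumbbell_det (of_real q :: 'a::real_field) i j k = of_real
    (dumbbell_det q i j k)"
  unfolding dumbbell_det_def cheb_of_real by simp

section \<open>Theta graphs and dumbbells\<close>

lemma path_edges_simps:
  "path_edges (a # b # p) = {(a, b), (b, a)} \<union> path_edges (b # p)" "path_edges [a] = {}"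
  by (auto simp: path_edges_def)

lemma walk_count_distinct:
  "distinct p \<Longrightarrow> walk_count p x y = of_bool ((x, y) \<in> path_edges p)"
proof (induction p rule: induct_list012)
  case (3 a b p)
  then have ab: "a \<noteq> b" "a \<notin> set (b # p)"
    by auto
  have no: "(a, z) \<notin> path_edges (b # p)" "(z, a) \<notin> path_edges (b # p)" for z
    using ab(2) path_edges_subset[of "b # p"] by blast+
  have IH: "walk_count (b # p) x y = of_bool ((x, y) \<in> path_edges (b # p))"
    using 3 by simp
  consider "x = a" "y = b" | "x = b" "y = a" | "(x, y) \<noteq> (a, b)" "(x, y) \<noteq> (b, a)"
    by auto
  then show ?case
  proof cases
    case 1
    then show ?thesis
      using ab no IH by (simp add: path_edges_simps)
  next
    case 2
    then show ?thesis
      using ab no IH by (simp add: path_edges_simps)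
  next
    case 3
    then have "\<not> (x = a \<and> y = b)" "\<not> (x = b \<and> y = a)"
      by auto
    then show ?thesis
      unfolding walk_count.simps IH path_edges_simps by (simp only: Un_iff insert_iff empty_iff
          prod.inject) simp
  qed
qed (auto simp: path_edges_def)

text \<open>Two paths of a theta graph could share only an edge between the branch vertices; a path
  with an inner vertex contains no such edge.\<close>

lemma no_edge_between_ends:
  assumes "distinct (u # r @ [v])" "r \<noteq> []" "x \<in> {u, v}" "y \<in> {u, v}"
  shows "(x, y) \<notin> path_edges (u # r @ [v])"
proof -
  obtain c r' where r: "r = c # r'"
    using assms(2) by (cases r) auto
  have *: "(u, z) \<notin> path_edges (r @ [v])" "(z, u) \<notin> path_edges (r @ [v])" for z
    using assms(1) path_edges_subset[of "r @ [v]"] by auto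
  have "(v, v) \<notin> path_edges (r @ [v])"
    by (rule path_edges_irrefl) (use assms(1) in simp)
  with * show ?thesis
    using assms(1,3,4) by (auto simp: r path_edges_simps)
qed

lemma path_cover_theta_graph:
  assumes "s \<ge> 1" "r \<ge> 1"
  shows "path_cover (pverts (theta_graph r s t)) (parcs (theta_graph r s t)) {0, 1}
    [(0, [2..<2 + r], 1), (0, [2 + r..<2 + r + s], 1), (0, [2 + r + s..<2 + r + s + t], 1)]"
proof -
  let ?r1 = "[2..<2 + r]" and ?r2 = "[2 + r..<2 + r + s]" and ?r3 = "[2 + r + s..<2 + r + s + t]"
  let ?p1 = "0 # ?r1 @ [1]" and ?p2 = "0 # ?r2 @ [1]" and ?p3 = "0 # ?r3 @ [1]"
  have dist: "distinct ?p1" "distinct ?p2" "distinct ?p3"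
    by auto
  have no: "(x, y) \<notin> path_edges ?p1" "(x, y) \<notin> path_edges ?p2" if "x \<in> {0, 1}" "y \<in> {0, 1}" for x y
    using no_edge_between_ends[OF dist(1) _ that] no_edge_between_ends[OF dist(2) _ that] assms
        by auto
  have sub: "x \<in> set p \<and> y \<in> set p" if "(x, y) \<in> path_edges p" for x y and p :: "nat list"
    using that path_edges_subset[of p] by auto
  have disj: "(x, y) \<in> path_edges ?p1 \<Longrightarrow> (x, y) \<notin> path_edges ?p2 \<and> (x, y) \<notin> path_edges ?p3"
    "(x, y) \<in> path_edges ?p2 \<Longrightarrow> (x, y) \<notin> path_edges ?p3" for x y
  proof -
    have i: "z \<in> {0, 1}" if "z \<in> set ?p1 \<and> z \<in> set ?p2 \<or> z \<in> set ?p1 \<and> z \<in> set ?p3 \<or> z \<in> set ?p2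
        \<and> z \<in> set ?p3" for z
      using that by auto
    show "(x, y) \<in> path_edges ?p1 \<Longrightarrow> (x, y) \<notin> path_edges ?p2 \<and> (x, y) \<notin> path_edges ?p3"
      using sub i no(1) by metis
    show "(x, y) \<in> path_edges ?p2 \<Longrightarrow> (x, y) \<notin> path_edges ?p3"
      using sub i no(2) by metis
  qed
  have arcs: "parcs (theta_graph r s t) = path_edges ?p1 \<union> path_edges ?p2 \<union> path_edges ?p3"
    by (simp add: theta_graph_def del: upt_Suc)
  have "(\<Sum>t\<leftarrow>[(0, ?r1, 1), (0, ?r2, 1), (0, ?r3, 1)]. walk_count (track t) x y)
      = of_bool ((x, y) \<in> parcs (theta_graph r s t))" for x y
  proof -
    have "(\<Sum>t\<leftarrow>[(0, ?r1, 1), (0, ?r2, 1), (0, ?r3, 1)]. walk_count (track t) x y)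
       = of_bool ((x, y) \<in> path_edges ?p1) + (of_bool ((x, y) \<in> path_edges ?p2) + of_bool ((x,
           y) \<in> path_edges ?p3))"
      unfolding list.map sum_list.Cons sum_list.Nil track_simps(1)
        walk_count_distinct[OF dist(1)] walk_count_distinct[OF dist(2)] walk_count_distinct[OF
            dist(3)]
      by simp
    also have "\<dots> = of_bool ((x, y) \<in> parcs (theta_graph r s t))"
      unfolding arcs using disj[of x y] by (auto simp del: upt_Suc)
    finally show ?thesis .
  qed
  moreover have "distinct (?r1 @ ?r2 @ ?r3)"
    by auto
  moreover have "set (?r1 @ ?r2 @ ?r3) = {..<r + s + t + 2} - {0, 1}"
    by auto
  moreover have "\<forall>x. ends (0, q, 1) x > 0 \<longrightarrow> x \<in> {0, 1}" for q :: "nat list"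
    by auto
  ultimately show ?thesis
    unfolding path_cover_def by (simp add: theta_graph_def del: upt_Suc track_simps(3) set_upt)
qed

section \<open>Isomorphism from equal path lengths\<close>

lemma ex_map_eq:
  assumes "distinct xs" "length ys = length xs"
  shows "\<exists>f. map f xs = ys"
  using assms(2,1)
proof (induction ys xs rule: list_induct2)
  case (Cons y ys x xs)
  then obtain f where f: "map f xs = ys"
    by auto
  have "map (\<lambda>z. if z = x then y else f z) (x # xs) = y # ys"
    using Cons.prems f by auto
  then show ?case
    by (intro exI[of "\<lambda>g. map g (x # xs) = y # ys"])
qed simp

lemma theta_cover_vertices:
  assumes "path_cover V A {u, v} [(a1, r1, b1), (a2, r2, b2), (a3, r3, b3)]" "u \<noteq> v"
  shows "distinct (r1 @ r2 @ r3 @ [u, v])" "set (r1 @ r2 @ r3 @ [u, v]) = V"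
  using path_coverD(1,3,4)[OF assms(1)] assms(2) by auto

text \<open>Matching the vertex lists position by position carries each path onto its counterpart.
  An injective map preserves step counts, and these determine adjacency.\<close>

lemma theta_cover_iso:
  assumes G: "path_cover V A {u, v} [(u, r1, v), (u, r2, v), (u, r3, v)]" "u \<noteq> v"
    and H: "path_cover V' A' {u', v'} [(u', s1, v'), (u', s2, v'), (u', s3, v')]" "u' \<noteq> v'"
    and len: "length r1 = length s1" "length r2 = length s2" "length r3 = length s3"
  shows "\<exists>f. bij_betw f V V' \<and> (\<forall>x\<in>V. \<forall>y\<in>V. (x, y) \<in> A \<longleftrightarrow> (f x, f y) \<in> A')"
proof -
  let ?L = "r1 @ r2 @ r3 @ [u, v]" and ?L' = "s1 @ s2 @ s3 @ [u', v']"
  note GL = theta_cover_vertices[OF G] and HL = theta_cover_vertices[OF H]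
  obtain f where f: "map f ?L = ?L'"
    using ex_map_eq[OF GL(1), of ?L'] len by auto
  have inj: "inj_on f V"
    using HL(1) unfolding f[symmetric] distinct_map GL(2) by blast
  have img: "f ` V = V'"
    unfolding GL(2)[symmetric] HL(2)[symmetric] f[symmetric] by (simp add: image_Un)
  have m: "map f r1 = s1" "map f r2 = s2" "map f r3 = s3" "f u = u'" "f v = v'"
    using f len by simp_all
  have "of_bool ((x, y) \<in> A) = (of_bool ((f x, f y) \<in> A') :: nat)" if "x \<in> V" "y \<in> V" for x y
  proof -
    have sub: "set (u # r @ [v]) \<subseteq> V" if "r \<in> {r1, r2, r3}" for r
      using that GL(2) by auto
    have wc: "walk_count (u' # map f r @ [v']) (f x) (f y) = walk_count (u # r @
        [v]) x y" if "r \<in> {r1, r2, r3}" for r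
      using walk_count_map[OF inj sub[OF that] \<open>x \<in> V\<close> \<open>y \<in> V\<close>] by (simp add: m)
    have "(\<Sum>t\<leftarrow>[(u, r1, v), (u, r2, v), (u, r3, v)]. walk_count (track t) x y)
        = (\<Sum>t\<leftarrow>[(u', s1, v'), (u', s2, v'), (u', s3, v')]. walk_count (track t) (f x) (f y))"
      using wc by (simp add: m(1-3)[symmetric])
    then show ?thesis
      unfolding path_coverD(2)[OF G(1)] path_coverD(2)[OF H(1)] .
  qed
  then have "\<forall>x\<in>V. \<forall>y\<in>V. (x, y) \<in> A \<longleftrightarrow> (f x, f y) \<in> A'"
    by (metis of_bool_eq_iff)
  then show ?thesis
    using inj img unfolding bij_betw_def by blast
qed

lemma digraph_isoI:
  assumes "pair_graph G" "pair_graph H" and f: "bij_betw f (pverts G) (pverts H)"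
    and arcs: "\<And>x y. x \<in> pverts G \<Longrightarrow> y \<in> pverts G \<Longrightarrow> (x, y) \<in> parcs G \<longleftrightarrow> (f x, f y) \<in> parcs H"
  shows "digraph_iso (with_proj G) (with_proj H)"
proof -
  interpret G: pair_graph G by fact
  interpret H: pair_graph H by fact
  \<comment> \<open>In a pair digraph the arc map is forced by the vertex map, and head and tail
    stay the projections.\<close>
  define h where "h = \<lparr>iso_verts = f, iso_arcs = map_prod f f, iso_head = snd, iso_tail = fst\<rparr>"
  have inj: "inj_on f (pverts G)" and img: "f ` pverts G = pverts H"
    using f by (auto simp: bij_betw_def)
  have sub: "parcs G \<subseteq> pverts G \<times> pverts G"
    using G.in_arcsD1 G.in_arcsD2 by auto
  have inj2: "inj_on (map_prod f f) (parcs G)"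
    using inj_on_subset[OF map_prod_inj_on[OF inj inj] sub] .
  have "map_prod f f ` parcs G = parcs H"
  proof (intro equalityI subsetI)
    fix e assume "e \<in> map_prod f f ` parcs G"
    then show "e \<in> parcs H"
      using arcs sub by auto
  next
    fix e assume e: "e \<in> parcs H"
    then have "fst e \<in> f ` pverts G" "snd e \<in> f ` pverts G"
      unfolding img using H.arc_fst_in_verts H.arc_snd_in_verts by auto
    then obtain x y where xy: "x \<in> pverts G" "y \<in> pverts G" "e = (f x, f y)"
      by (metis imageE prod.collapse)
    then have "(x, y) \<in> parcs G"
      using arcs e by auto
    then show "e \<in> map_prod f f ` parcs G"
      using xy(3) by force
  qed
  then have "with_proj H = app_iso h (with_proj G)"
    using img by (simp add: with_proj_def app_iso_def h_def)
  moreover have "pre_digraph.digraph_isomorphism (with_proj G) h"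
    unfolding pre_digraph.digraph_isomorphism_def
    using inj inj2 G.wf_digraph_axioms by (auto simp: h_def)
  ultimately show ?thesis
    unfolding digraph_iso_def by blast
qed

definition lap_entry :: "'v rel \<Rightarrow> complex \<Rightarrow> 'v \<Rightarrow> 'v \<Rightarrow> complex" where
  "lap_entry A \<mu> x y = (if x = y then of_nat (card {z. (x, z) \<in> A}) - \<mu> else 0) - of_bool ((x,
      y) \<in> A)"

section \<open>The Laplacian as a matrix of paths\<close>

lemma out_degree_with_proj: "out_degree (with_proj G) x = card {y. (x, y) \<in> parcs G}"
proof -
  have "out_arcs (with_proj G) x = Pair x ` {y. (x, y) \<in> parcs G}"
    by (auto simp: out_arcs_def)
  then show ?thesis
    by (simp add: out_degree_def card_image inj_on_def)
qed

lemma laplacian_mat_eq_idx_mat: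
  assumes "distinct vs"
  shows "laplacian_mat G vs = idx_mat (lap_entry (parcs G) 0) vs"
proof (rule eq_matI)
  fix i j assume "i < dim_row (idx_mat (lap_entry (parcs G) 0) vs)" "j < dim_col (idx_mat
      (lap_entry (parcs G) 0) vs)"
  then have ij: "i < length vs" "j < length vs"
    by (simp_all add: idx_mat_def)
  then have "vs ! i = vs ! j \<longleftrightarrow> i = j"
    using assms by (simp add: nth_eq_iff_index_eq)
  with ij show "laplacian_mat G vs $$ (i, j) = idx_mat (lap_entry (parcs G) 0) vs $$ (i, j)"
    by (simp add: laplacian_mat_index idx_mat_def lap_entry_def out_degree_with_proj)
qed (use laplacian_mat_carrier[of G vs] in \<open>simp_all add: idx_mat_def\<close>)

text \<open>The sign arises because the characteristic polynomial is det (\<mu> - L), while the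
  elimination treats L - \<mu>.\<close>

lemma poly_char_poly_lap_entry:
  assumes "distinct vs"
  shows "poly (char_poly (idx_mat (lap_entry A 0) vs)) \<mu> = (-1) ^ length vs * det (idx_mat
      (lap_entry A \<mu>) vs)"
proof -
  have "- char_matrix (idx_mat (lap_entry A 0) vs) \<mu> = (-1) \<cdot>\<^sub>m idx_mat (lap_entry A \<mu>) vs"
  proof (rule eq_matI)
    fix i j assume "i < dim_row ((-1) \<cdot>\<^sub>m idx_mat (lap_entry A \<mu>) vs)" "j < dim_col
        ((-1) \<cdot>\<^sub>m idx_mat (lap_entry A \<mu>) vs)"
    then have ij: "i < length vs" "j < length vs"
      by (simp_all add: idx_mat_def)
    then have "vs ! i = vs ! j \<longleftrightarrow> i = j"
      using assms by (simp add: nth_eq_iff_index_eq)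
    with ij show "(- char_matrix (idx_mat (lap_entry A 0) vs) \<mu>) $$ (i, j) = ((-1) \<cdot>\<^sub>m idx_mat
        (lap_entry A \<mu>) vs) $$ (i, j)"
      by (simp add: char_matrix_def idx_mat_def lap_entry_def)
  qed (simp_all add: char_matrix_def idx_mat_def)
  then have "poly (char_poly (idx_mat (lap_entry A 0) vs)) \<mu> = det ((-1) \<cdot>\<^sub>m idx_mat
      (lap_entry A \<mu>) vs)"
    using char_poly_matrix[OF idx_mat_carrier] by metis
  also have "\<dots> = (-1) ^ length vs * det (idx_mat (lap_entry A \<mu>) vs)"
    by (subst det_smult) (simp add: idx_mat_def)
  finally show ?thesis .
qed

text \<open>For a path without eliminated vertices \<open>cheb q 0 = 0\<close> and
  \<open>cheb q 1 = 1\<close>, so that whatever q is, only adjacency remains.\<close>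

lemma sum_path_chain:
  fixes q :: "'a::field"
  shows "(\<Sum>e\<leftarrow>path_chain p. edge_coeff q e x y) = of_nat (walk_count p x y)"
proof (induction p rule: induct_list012)
  case (3 a b p)
  have "edge_coeff q (a, 0, b) x y = of_nat (of_bool (x = a \<and> y = b) + of_bool (x = b \<and> y = a))"
    unfolding edge_coeff by simp
  with 3 show ?case
    by (simp only: path_chain_simps list.map sum_list.Cons walk_count.simps of_nat_add)
qed simp_all

lemma lap_entry_path_cover:
  assumes "path_cover V A W ps"
  shows "lap_entry A \<mu> = chain_mat q (\<lambda>x. of_nat (card {z. (x, z) \<in> A}) - \<mu>) (concat (map
      (\<lambda>t. path_chain (track t)) ps))"
proof (intro ext)
  fix x y
  have "(\<Sum>e\<leftarrow>concat (map (\<lambda>t. path_chain (track t)) ps). edge_coeff q e x y)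
      = of_nat (\<Sum>t\<leftarrow>ps. walk_count (track t) x y)"
    by (induction ps) (simp_all add: sum_path_chain)
  also have "\<dots> = of_bool ((x, y) \<in> A)"
    unfolding path_coverD(2)[OF assms] by simp
  finally show "lap_entry A \<mu> x y = chain_mat q (\<lambda>x. of_nat (card {z. (x, z) \<in> A}) - \<mu>) (concat
      (map (\<lambda>t. path_chain (track t)) ps)) x y"
    unfolding lap_entry_def chain_mat_def by simp
qed

text \<open>Here \<open>\<delta>\<close> is degree minus \<mu>, hence q at all inner vertices and q
  + 1 at u and v. The ends of the paths are left open to cover both shapes.\<close>

lemma det_lap_entry_cover:
  assumes pc: "path_cover V A {u, v} [(a1, r1, b1), (a2, r2, b2), (a3, r3, b3)]"
    and uv: "u \<noteq> v" and V: "finite V" "A \<subseteq> V \<times> V"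
    and nz: "\<And>k. cheb q (Suc k) \<noteq> 0" and q: "q = 2 - \<mu>"
    and deg: "card {z. (u, z) \<in> A} = 3" "card {z. (v, z) \<in> A} = 3"
  shows "\<exists>\<delta>. \<delta> u = q + 1 \<and> \<delta> v = q + 1 \<and> det (idx_mat (lap_entry A \<mu>) (r1 @ r2 @ r3 @ [u, v]))
    = cheb q (Suc (length r1)) * cheb q (Suc (length r2)) * cheb q (Suc (length r3)) *
      det (idx_mat (chain_mat q \<delta> [(a1, length r1, b1), (a2, length r2, b2), (a3, length r3,
          b3)]) [u, v])"
proof (intro exI conjI)
  let ?\<delta> = "\<lambda>x. of_nat (card {z. (x, z) \<in> A}) - \<mu>"
  note vert = theta_cover_vertices[OF pc uv]
  show "?\<delta> u = q + 1" "?\<delta> v = q + 1"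
    using deg by (simp_all add: q)
  have e: "lap_entry A \<mu> = chain_mat q ?\<delta> (path_chain (a1 # r1 @ [b1]) @ path_chain (a2 # r2 @
      [b2]) @ path_chain (a3 # r3 @ [b3]))"
    unfolding lap_entry_path_cover[OF pc, of \<mu> q] by simp
  show "det (idx_mat (lap_entry A \<mu>) (r1 @ r2 @ r3 @ [u, v]))
    = cheb q (Suc (length r1)) * cheb q (Suc (length r2)) * cheb q (Suc (length r3)) *
      det (idx_mat (chain_mat q ?\<delta> [(a1, length r1, b1), (a2, length r2, b2), (a3, length r3,
          b3)]) [u, v])"
    unfolding e
  proof (rule det_chain_mat_three_paths[OF nz])
    show "?\<delta> x = q" if "x \<in> set r1 \<union> set r2 \<union> set r3" for x
    proof -
      have "x \<in> V - {u, v}"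
        using that path_coverD(4)[OF pc] by auto
      then show ?thesis
        using path_cover_degree(2)[OF pc V] by (simp add: q)
    qed
    show "{a1, b1, a2, b2, a3, b3} \<subseteq> set [u, v]"
      using path_coverD(5)[OF pc, of "(a1, r1, b1)"] path_coverD(5)[OF pc, of "(a2, r2, b2)"]
        path_coverD(5)[OF pc, of "(a3, r3, b3)"] by auto
  qed (use vert in simp)
qed

lemma det_lap_entry_theta:
  assumes pc: "path_cover V A {u, v} [(u, r1, v), (u, r2, v), (u, r3, v)]"
    and uv: "u \<noteq> v" and V: "finite V" "A \<subseteq> V \<times> V" and nz: "\<And>k. cheb q (Suc k) \<noteq> 0" and q: "q = 2
        - \<mu>"
  shows "det (idx_mat (lap_entry A \<mu>) (r1 @ r2 @ r3 @ [u, v])) = theta_det q (length r1)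
      (length r2) (length r3)"
proof -
  have deg: "card {z. (u, z) \<in> A} = 3" "card {z. (v, z) \<in> A} = 3"
    using path_cover_degree(1)[OF pc V, of u] path_cover_degree(1)[OF pc V, of v] uv by simp_all
  obtain \<delta> where \<delta>: "\<delta> u = q + 1" "\<delta> v = q + 1" "det (idx_mat (lap_entry A \<mu>) (r1 @ r2 @ r3 @ [u,
      v]))
    = cheb q (Suc (length r1)) * cheb q (Suc (length r2)) * cheb q (Suc (length r3)) *
      det (idx_mat (chain_mat q \<delta> [(u, length r1, v), (u, length r2, v), (u, length r3, v)]) [u,
          v])"
    using det_lap_entry_cover[OF pc uv V nz q deg] by blast
  let ?M = "chain_mat q \<delta> [(u, length r1, v), (u, length r2, v), (u, length r3, v)]"
  have M: "?M u u = q + 1 - (cheb q (length r1) / cheb q (Suc (length r1)) + cheb q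
      (length r2) / cheb q (Suc (length r2)) + cheb q (length r3) / cheb q (Suc (length r3)))"
    "?M v v = ?M u u"
    "?M u v = - (1 / cheb q (Suc (length r1)) + 1 / cheb q (Suc (length r2)) + 1 / cheb q (Suc
        (length r3)))"
    "?M v u = ?M u v"
    using uv uv[symmetric] by (simp_all add: chain_mat_def edge_coeff \<delta>(1,2))
  show ?thesis
    unfolding \<delta>(3) det_idx_mat_2 M(2,4) unfolding M(1,3) theta_det_def
    by (simp only: power2_eq_square minus_mult_minus)
qed

lemma det_lap_entry_dumbbell:
  assumes pc: "path_cover V A {u, v} [(u, r1, u), (v, r2, v), (u, r3, v)]"
    and uv: "u \<noteq> v" and V: "finite V" "A \<subseteq> V \<times> V" and nz: "\<And>k. cheb q (Suc k) \<noteq> 0" and q: "q = 2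
        - \<mu>"
  shows "det (idx_mat (lap_entry A \<mu>) (r1 @ r2 @ r3 @ [u, v])) = dumbbell_det q (length r1)
      (length r2) (length r3)"
proof -
  have deg: "card {z. (u, z) \<in> A} = 3" "card {z. (v, z) \<in> A} = 3"
    using path_cover_degree(1)[OF pc V, of u] path_cover_degree(1)[OF pc V, of v] uv by simp_all
  obtain \<delta> where \<delta>: "\<delta> u = q + 1" "\<delta> v = q + 1" "det (idx_mat (lap_entry A \<mu>) (r1 @ r2 @ r3 @ [u,
      v]))
    = cheb q (Suc (length r1)) * cheb q (Suc (length r2)) * cheb q (Suc (length r3)) *
      det (idx_mat (chain_mat q \<delta> [(u, length r1, u), (v, length r2, v), (u, length r3, v)]) [u,
          v])"
    using det_lap_entry_cover[OF pc uv V nz q deg] by blast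
  let ?M = "chain_mat q \<delta> [(u, length r1, u), (v, length r2, v), (u, length r3, v)]"
  have M: "?M u u = q + 1 - (2 * cheb q (length r1) + 2) / cheb q (Suc (length r1)) - cheb q
      (length r3) / cheb q (Suc (length r3))"
    "?M v v = q + 1 - (2 * cheb q (length r2) + 2) / cheb q (Suc (length r2)) - cheb q
        (length r3) / cheb q (Suc (length r3))"
    "?M u v = - (1 / cheb q (Suc (length r3)))" "?M v u = - (1 / cheb q (Suc (length r3)))"
    using uv uv[symmetric] by (simp_all add: chain_mat_def edge_coeff \<delta>(1,2))
  show ?thesis
    unfolding \<delta>(3) det_idx_mat_2 M dumbbell_det_def
    by (simp only: power2_eq_square minus_mult_minus)
qed

section \<open>Degrees and connectedness from the spectrum\<close>

definition mat_trace :: "'a::comm_monoid_add mat \<Rightarrow> 'a" where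
  "mat_trace A = (\<Sum>i<dim_row A. A $$ (i, i))"

lemma mat_trace_mult_commute:
  fixes A B :: "'a::comm_semiring_0 mat"
  assumes "A \<in> carrier_mat n n" "B \<in> carrier_mat n n"
  shows "mat_trace (A * B) = mat_trace (B * A)"
proof -
  have tr: "mat_trace (X * Y) = (\<Sum>i<n. \<Sum>j<n. X $$ (i, j) * Y $$ (j, i))"
    if "X \<in> carrier_mat n n" "Y \<in> carrier_mat n n" for X Y :: "'a mat"
    using that by (simp add: mat_trace_def scalar_prod_def lessThan_atLeast0)
  show ?thesis
    unfolding tr[OF assms] tr[OF assms(2,1)]
    by (subst sum.swap) (simp add: mult.commute)
qed

text \<open>The trace is invariant under similarity, so both traces can be read off a Schur
  triangular form: its diagonal is \<open>es\<close>, and products of opposite off-diagonal entries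
  vanish.\<close>

lemma mat_trace_char_poly:
  fixes A :: "complex mat"
  assumes A: "A \<in> carrier_mat n n" and es: "char_poly A = (\<Prod>e\<leftarrow>es. [:- e, 1:])"
  shows "mat_trace A = sum_list es" "mat_trace (A * A) = (\<Sum>e\<leftarrow>es. e\<^sup>2)"
proof -
  obtain B P Q where "schur_decomposition A es = (B, P, Q)"
    by (cases "schur_decomposition A es") auto
  from schur_decomposition[OF A es this]
  have sim: "similar_mat_wit A B P Q" and ut: "upper_triangular B" and diag: "diag_mat B = es"
    by auto
  note w = similar_mat_witD2[OF A sim]
  have B: "B \<in> carrier_mat n n" and P: "P \<in> carrier_mat n n" and Q: "Q \<in> carrier_mat n n"
    using w by auto
  have cyc: "mat_trace (P * X * Q) = mat_trace X" if X: "X \<in> carrier_mat n n" for X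
  proof -
    have "mat_trace (P * X * Q) = mat_trace (Q * (P * X))"
      by (rule mat_trace_mult_commute) (use P X Q in auto)
    also have "Q * (P * X) = (Q * P) * X"
      by (rule assoc_mult_mat[symmetric]) (use P X Q in auto)
    also have "\<dots> = X"
      using w(2) X by simp
    finally show ?thesis .
  qed
  have es_eq: "es = map (\<lambda>i. B $$ (i, i)) [0..<n]"
    using diag B by (simp add: diag_mat_def)
  have "mat_trace A = mat_trace B"
    using cyc[OF B] w(3) by simp
  also have "\<dots> = sum_list es"
    using B by (simp add: es_eq mat_trace_def interv_sum_list_conv_sum_set_nat lessThan_atLeast0)
  finally show "mat_trace A = sum_list es" .
  have "A * A = P * (B * B) * Q"
  proof -
    have "A * A = P * B * Q * (P * B * Q)"
      using w(3) by simp
    also have "\<dots> = P * B * (Q * (P * B * Q))"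
      by (rule assoc_mult_mat) (use P B Q in auto)
    also have "Q * (P * B * Q) = Q * (P * (B * Q))"
      using P B Q by (simp add: assoc_mult_mat[of P n n B n Q n])
    also have "\<dots> = Q * P * (B * Q)"
      by (rule assoc_mult_mat[symmetric]) (use P B Q in auto)
    also have "\<dots> = B * Q"
      using w(2) B Q by simp
    also have "P * B * (B * Q) = P * (B * B) * Q"
      using P B Q by (simp add: assoc_mult_mat[of P n n B n "B * Q" n] assoc_mult_mat[of P n n "B
          * B" n Q n]
        assoc_mult_mat[of B n n B n Q n])
    finally show ?thesis .
  qed
  then have "mat_trace (A * A) = mat_trace (B * B)"
    using cyc[of "B * B"] B by simp
  also have "\<dots> = (\<Sum>i<n. (B $$ (i, i))\<^sup>2)"
  proof -
    have "(B * B) $$ (i, i) = (B $$ (i, i))\<^sup>2" if i: "i < n" for i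
    proof -
      have "(B * B) $$ (i, i) = (\<Sum>j<n. B $$ (i, j) * B $$ (j, i))"
        using B i by (simp add: scalar_prod_def lessThan_atLeast0)
      also have "\<dots> = (\<Sum>j<n. if j = i then (B $$ (i, i))\<^sup>2 else 0)"
      proof (rule sum.cong)
        fix j assume j: "j \<in> {..<n}"
        consider "j < i" | "j = i" | "i < j"
          by linarith
        then show "B $$ (i, j) * B $$ (j, i) = (if j = i then (B $$ (i, i))\<^sup>2 else 0)"
          using ut B i j unfolding upper_triangular_def by cases (auto simp: power2_eq_square)
      qed simp
      also have "\<dots> = (B $$ (i, i))\<^sup>2"
        using i by simp
      finally show ?thesis .
    qed
    then show ?thesis
      using B by (simp add: mat_trace_def)
  qed
  also have "\<dots> = (\<Sum>e\<leftarrow>es. e\<^sup>2)"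
    by (simp add: es_eq interv_sum_list_conv_sum_set_nat lessThan_atLeast0 comp_def)
  finally show "mat_trace (A * A) = (\<Sum>e\<leftarrow>es. e\<^sup>2)" .
qed

text \<open>A diagonal entry of L^2 is the square of the degree plus one for each neighbour, from
  the squares of the entries -1.\<close>

lemma mat_trace_laplacian:
  assumes vs: "distinct vs" and A: "irrefl A" "sym A" "A \<subseteq> set vs \<times> set vs"
  defines "L \<equiv> idx_mat (lap_entry A 0) vs"
  shows "mat_trace L = of_nat (\<Sum>x\<in>set vs. card {z. (x, z) \<in> A})"
    and "mat_trace (L * L) = of_nat (\<Sum>x\<in>set vs. (card {z. (x, z) \<in> A})\<^sup>2 + card {z. (x, z) \<in> A})"
proof -
  let ?d = "\<lambda>x. card {z. (x, z) \<in> A}" and ?n = "length vs"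
  have idx: "(\<Sum>i<?n. f (vs ! i)) = (\<Sum>x\<in>set vs. f x)" for f :: "'a \<Rightarrow> complex"
    using sum.reindex_bij_betw[OF bij_betw_nth[OF vs refl refl], of f] .
  have diag: "lap_entry A 0 x x = of_nat (?d x)" for x
    using A(1) by (simp add: lap_entry_def irrefl_def)
  show "mat_trace L = of_nat (\<Sum>x\<in>set vs. ?d x)"
    using idx[of "\<lambda>x. of_nat (?d x)"] by (simp add: mat_trace_def L_def idx_mat_def diag)
  have row: "(\<Sum>y\<in>set vs. lap_entry A 0 x y * lap_entry A 0 y x) = of_nat ((?d x)\<^sup>2
      + ?d x)" if x: "x \<in> set vs" for x
  proof -
    have "(\<Sum>y\<in>set vs. lap_entry A 0 x y * lap_entry A 0 y x)
      = (\<Sum>y\<in>set vs. (if y = x then of_nat ((?d x)\<^sup>2) else 0) + of_bool ((x, y) \<in> A))"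
    proof (rule sum.cong)
      fix y
      have "(y, x) \<in> A \<longleftrightarrow> (x, y) \<in> A"
        using A(2) by (auto dest: symD)
      then show "lap_entry A 0 x y * lap_entry A 0 y x = (if y = x then of_nat ((?d x)\<^sup>2) else 0)
          + of_bool ((x, y) \<in> A)"
        using A(1) by (cases "y = x") (auto simp: lap_entry_def irrefl_def power2_eq_square)
    qed simp
    also have "\<dots> = of_nat ((?d x)\<^sup>2) + (\<Sum>y\<in>set vs. of_bool ((x, y) \<in> A))"
      using x by (simp add: sum.distrib)
    also have "(\<Sum>y\<in>set vs. of_bool ((x, y) \<in> A)) = (of_nat (card (set vs \<inter> {y. (x,
        y) \<in> A})) :: complex)"
      by (simp add: of_bool_def sum.If_cases)
    also have "set vs \<inter> {y. (x, y) \<in> A} = {y. (x, y) \<in> A}"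
      using A(3) by auto
    finally show ?thesis by simp
  qed
  have "mat_trace (L * L) = (\<Sum>i<?n. \<Sum>j<?n. lap_entry A 0 (vs ! i) (vs ! j) * lap_entry A 0
      (vs ! j) (vs ! i))"
    by (simp add: mat_trace_def L_def idx_mat_def scalar_prod_def lessThan_atLeast0)
  also have "\<dots> = (\<Sum>i<?n. \<Sum>y\<in>set vs. lap_entry A 0 (vs ! i) y * lap_entry A 0 y (vs ! i))"
    by (rule sum.cong[OF refl], rule idx)
  also have "\<dots> = (\<Sum>x\<in>set vs. \<Sum>y\<in>set vs. lap_entry A 0 x y * lap_entry A 0 y x)"
    by (rule idx)
  also have "\<dots> = (\<Sum>x\<in>set vs. of_nat ((?d x)\<^sup>2 + ?d x))"
    by (rule sum.cong) (use row in auto)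
  finally show "mat_trace (L * L) = of_nat (\<Sum>x\<in>set vs. (?d x)\<^sup>2 + ?d x)"
    by simp
qed

text \<open>A monic complex polynomial is determined by the multiset of its roots, and its degree is
  the number of vertices.\<close>

lemma L_cospectral_char_poly:
  assumes "L_cospectral G H" "distinct vs" "set vs = pverts G" "distinct ws" "set ws = pverts H"
  shows "char_poly (laplacian_mat G vs) = char_poly (laplacian_mat H ws)" "length vs = length ws"
proof -
  let ?p = "char_poly (laplacian_mat G vs)" and ?r = "char_poly (laplacian_mat H ws)"
  have eq: "proots ?p = proots ?r"
    using assms L_spectrum_eq[of vs G] L_spectrum_eq[of ws H] by (simp add: L_cospectral_def)
  note p = degree_monic_char_poly[OF laplacian_mat_carrier[of G vs]]
    and r = degree_monic_char_poly[OF laplacian_mat_carrier[of H ws]]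
  have "?p = (\<Prod>x\<in>#proots ?p. [:-x, 1:])"
    using complex_poly_decompose_multiset[of ?p] p by simp
  moreover have "?r = (\<Prod>x\<in>#proots ?r. [:-x, 1:])"
    using complex_poly_decompose_multiset[of ?r] r by simp
  ultimately show "?p = ?r"
    using eq by metis
  then show "length vs = length ws"
    using p r by metis
qed

section \<open>Degrees of a cospectral mate\<close>

lemma pair_graph_parcs:
  assumes "pair_graph G"
  shows "irrefl (parcs G)" "sym (parcs G)" "parcs G \<subseteq> pverts G \<times> pverts G" "finite (pverts G)"
proof -
  interpret pair_graph G by fact
  show "irrefl (parcs G)"
    by (rule irreflI) (use pair_no_loops in fastforce)
  show "sym (parcs G)"
    using pair_sym_arcs by (simp add: symmetric_def)
  show "parcs G \<subseteq> pverts G \<times> pverts G"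
    using in_arcsD1 in_arcsD2 by auto
  show "finite (pverts G)"
    by (rule pair_finite_verts)
qed

text \<open>The combination tr L^2 - 6 tr L + 6n, by (d - 2)(d - 3) = (d^2 + d) - 6d + 6.\<close>

lemma sum_degree_expand:
  "(\<Sum>x\<in>V. (int (d x) - 2) * (int (d x) - 3))
    = int (\<Sum>x\<in>V. (d x)\<^sup>2 + d x) - 6 * int (\<Sum>x\<in>V. d x) + 6 * int (card V)"
proof -
  have "(int (d x) - 2) * (int (d x) - 3) = int ((d x)\<^sup>2 + d x) - 6 * int (d x) + 6" for x
    by (simp add: power2_eq_square algebra_simps)
  then have "(\<Sum>x\<in>V. (int (d x) - 2) * (int (d x) - 3)) = (\<Sum>x\<in>V. int ((d x)\<^sup>2 + d x) - 6 * int
      (d x) + 6)"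
    by (simp only:)
  then show ?thesis
    by (simp only: sum.distrib sum_subtractf sum_distrib_left[symmetric] of_nat_sum sum_constant)
        simp
qed

lemma sum_two_plus_of_bool:
  assumes "finite V"
  shows "(\<Sum>x\<in>V. 2 + of_bool (P x)) = 2 * card V + card (V \<inter> {x. P x})"
  using assms by (simp only: sum.distrib sum_constant sum_of_bool_eq) simp

lemma degrees_cospectral_theta:
  assumes G: "pair_graph G" and H: "pair_graph H" and cosp: "L_cospectral G H"
    and uv: "u \<noteq> v" "u \<in> pverts H" "v \<in> pverts H"
    and degH: "card {z. (u, z) \<in> parcs H} = 3" "card {z. (v, z) \<in> parcs H} = 3"
      "\<And>w. w \<in> pverts H - {u, v} \<Longrightarrow> card {z. (w, z) \<in> parcs H} = 2"
  shows "\<exists>u' v'. u' \<noteq> v' \<and> u' \<in> pverts G \<and> v' \<in> pverts G \<and> card {z. (u', z) \<in> parcs G} = 3 \<and>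
    card {z. (v', z) \<in> parcs G} = 3 \<and> (\<forall>w\<in>pverts G - {u', v'}. card {z. (w, z) \<in> parcs G} = 2)"
proof -
  interpret G: pair_graph G by fact
  interpret H: pair_graph H by fact
  obtain vs where vs: "distinct vs" "set vs = pverts G"
    using finite_distinct_list[OF G.pair_finite_verts] by auto
  obtain ws where ws: "distinct ws" "set ws = pverts H"
    using finite_distinct_list[OF H.pair_finite_verts] by auto
  let ?dG = "\<lambda>x. card {z. (x, z) \<in> parcs G}" and ?dH = "\<lambda>x. card {z. (x, z) \<in> parcs H}"
  note cp = L_cospectral_char_poly[OF cosp vs ws, unfolded laplacian_mat_eq_idx_mat[OF vs(1)]
      laplacian_mat_eq_idx_mat[OF ws(1)]]
  let ?LG = "idx_mat (lap_entry (parcs G) 0) vs" and ?LH = "idx_mat (lap_entry (parcs H) 0) ws"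
  obtain es where es: "char_poly ?LG = (\<Prod>e\<leftarrow>es. [:- e, 1:])"
    using char_poly_factorized[OF idx_mat_carrier, of "lap_entry (parcs G) 0" vs] by auto
  note tG = mat_trace_char_poly[OF idx_mat_carrier es] and tH
      = mat_trace_char_poly[OF idx_mat_carrier es[unfolded cp(1)]]
  note lG = mat_trace_laplacian[OF vs(1) pair_graph_parcs(1,2)[OF G] pair_graph_parcs(3)[OF G,
      folded vs(2)]]
    and lH = mat_trace_laplacian[OF ws(1) pair_graph_parcs(1,2)[OF H] pair_graph_parcs(3)[OF H,
        folded ws(2)]]
  have "(of_nat (\<Sum>x\<in>set vs. ?dG x) :: complex) = of_nat (\<Sum>x\<in>set ws. ?dH x)"
    using tG(1) tH(1) lG(1) lH(1) by metis
  then have s1: "(\<Sum>x\<in>pverts G. ?dG x) = (\<Sum>x\<in>pverts H. ?dH x)"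
    unfolding of_nat_eq_iff vs(2) ws(2) .
  have "(of_nat (\<Sum>x\<in>set vs. (?dG x)\<^sup>2 + ?dG x) :: complex) = of_nat (\<Sum>x\<in>set ws. (?dH x)\<^sup>2 + ?dH x)"
    using tG(2) tH(2) lG(2) lH(2) by metis
  then have s2: "(\<Sum>x\<in>pverts G. (?dG x)\<^sup>2 + ?dG x) = (\<Sum>x\<in>pverts H. (?dH x)\<^sup>2 + ?dH x)"
    unfolding of_nat_eq_iff vs(2) ws(2) .
  have n: "card (pverts G) = card (pverts H)"
    using cp(2) distinct_card[OF vs(1)] distinct_card[OF ws(1)] vs(2) ws(2) by simp
  have "(\<Sum>x\<in>pverts G. (int (?dG x) - 2) * (int (?dG x) - 3)) = (\<Sum>x\<in>pverts H. (int (?dH x) - 2) *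
      (int (?dH x) - 3))"
    unfolding sum_degree_expand s1 s2 n ..
  also have "\<dots> = 0"
  proof (rule sum.neutral, rule ballI)
    fix x assume "x \<in> pverts H"
    then consider "x = u" | "x = v" | "x \<in> pverts H - {u, v}"
      by auto
    then show "(int (?dH x) - 2) * (int (?dH x) - 3) = 0"
      by cases (simp_all add: degH)
  qed
  finally have zero: "(\<Sum>x\<in>pverts G. (int (?dG x) - 2) * (int (?dG x) - 3)) = 0" .
  \<comment> \<open>No integer lies strictly between 2 and 3, so every summand is nonnegative and a
    zero sum makes each one vanish.\<close>
  have nonneg: "(int d - 2) * (int d - 3) \<ge> 0" for d
  proof (cases "d \<le> 2")
    case True
    then show ?thesis
      by (intro mult_nonpos_nonpos) auto
  next
    case False
    then show ?thesis
      by (intro mult_nonneg_nonneg) auto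
  qed
  have "(int (?dG x) - 2) * (int (?dG x) - 3) = 0" if "x \<in> pverts G" for x
    using zero that sum_nonneg_eq_0_iff[OF G.pair_finite_verts, of "\<lambda>x. (int (?dG x) - 2) * (int
        (?dG x) - 3)"] nonneg
    by auto
  then have d23: "?dG x = 2 \<or> ?dG x = 3" if "x \<in> pverts G" for x
    using that by fastforce
  \<comment> \<open>The excess of the degree sum over 2n counts the vertices of degree 3.\<close>
  have "(\<Sum>x\<in>pverts G. ?dG x) = (\<Sum>x\<in>pverts G. 2 + of_bool (?dG x = 3))"
  proof (rule sum.cong)
    fix x assume "x \<in> pverts G"
    from d23[OF this] show "?dG x = 2 + of_bool (?dG x = 3)"
      by (elim disjE) simp_all
  qed simp
  also have "\<dots> = 2 * card (pverts G) + card {x\<in>pverts G. ?dG x = 3}"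
    unfolding sum_two_plus_of_bool[OF G.pair_finite_verts] by (simp add: Int_def)
  finally have cG: "(\<Sum>x\<in>pverts G. ?dG x) = 2 * card (pverts G) + card {x\<in>pverts G. ?dG x = 3}" .
  have "(\<Sum>x\<in>pverts H. ?dH x) = (\<Sum>x\<in>pverts H. 2 + of_bool (x \<in> {u, v}))"
  proof (rule sum.cong)
    fix x assume "x \<in> pverts H"
    then consider "x = u" | "x = v" | "x \<in> pverts H - {u, v}"
      by auto
    then show "?dH x = 2 + of_bool (x \<in> {u, v})"
      by cases (simp_all add: degH)
  qed simp
  also have "\<dots> = 2 * card (pverts H) + card (pverts H \<inter> {u, v})"
    unfolding sum_two_plus_of_bool[OF H.pair_finite_verts] Collect_mem_eq ..
  also have "pverts H \<inter> {u, v} = {u, v}"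
    using uv by auto
  finally have "card {x\<in>pverts G. ?dG x = 3} = 2"
    using cG s1 n uv(1) by simp
  then obtain u' v' where *: "{x\<in>pverts G. ?dG x = 3} = {u', v'}" "u' \<noteq> v'"
    by (auto simp: card_2_iff)
  have u': "u' \<in> {x\<in>pverts G. ?dG x = 3}" and v': "v' \<in> {x\<in>pverts G. ?dG x = 3}"
    unfolding *(1) by simp_all
  have "?dG w = 2" if w: "w \<in> pverts G - {u', v'}" for w
  proof -
    have "w \<notin> {x\<in>pverts G. ?dG x = 3}"
      unfolding *(1) using w by simp
    then show ?thesis
      using d23[of w] w by simp
  qed
  then show ?thesis
    using u' v' *(2) by (intro exI[of _ u'] exI[of _ v'] conjI ballI) simp_all
qed

section \<open>Disconnected graphs and the eigenvalue zero\<close>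

lemma det_idx_mat_append:
  fixes M :: "'v \<Rightarrow> 'v \<Rightarrow> 'a::field"
  assumes "\<And>x y. x \<in> set xs \<Longrightarrow> y \<in> set ys \<Longrightarrow> M x y = 0 \<and> M y x = 0"
  shows "det (idx_mat M (xs @ ys)) = det (idx_mat M xs) * det (idx_mat M ys)"
proof -
  let ?m = "length xs" and ?n = "length ys"
  have "idx_mat M (xs @ ys) = four_block_mat (idx_mat M xs) (0\<^sub>m ?m ?n) (0\<^sub>m ?n ?m) (idx_mat M ys)"
    (is "_ = ?B")
  proof (rule eq_matI)
    fix i j assume ij: "i < dim_row ?B" "j < dim_col ?B"
    then have ij': "i < ?m + ?n" "j < ?m + ?n"
      by (simp_all add: idx_mat_def)
    then show "idx_mat M (xs @ ys) $$ (i, j) = ?B $$ (i, j)"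
      using assms[of "xs ! i" "ys ! (j - ?m)"] assms[of "xs ! j" "ys ! (i - ?m)"]
      by (auto simp: idx_mat_def nth_append)
  qed (simp_all add: idx_mat_def)
  then show ?thesis
    using det_four_block_mat_lower_left_zero[of "idx_mat M xs" ?m "0\<^sub>m ?m ?n" ?n "0\<^sub>m ?n
        ?m" "idx_mat M ys"]
    by simp
qed

text \<open>No arc leaves the set, so the rows of this block sum to zero and the all-ones vector
  lies in its kernel.\<close>

lemma char_poly_closed_component:
  assumes vs: "distinct vs" "vs \<noteq> []" and fin: "\<And>x. finite {z. (x, z) \<in> A}"
    and closed: "\<And>x y. (x, y) \<in> A \<Longrightarrow> x \<in> set vs \<Longrightarrow> y \<in> set vs"
  shows "[:0, 1:] dvd char_poly (idx_mat (lap_entry A 0) vs)"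
proof -
  let ?L = "idx_mat (lap_entry A 0) vs" and ?n = "length vs"
  let ?v = "vec ?n (\<lambda>_. 1 :: complex)"
  have "?L *\<^sub>v ?v = 0\<^sub>v ?n"
  proof (rule eq_vecI)
    fix i assume i: "i < dim_vec (0\<^sub>v ?n)"
    define x where "x = vs ! i"
    have x: "x \<in> set vs"
      using i by (simp add: x_def)
    have "(?L *\<^sub>v ?v) $ i = (\<Sum>j<?n. lap_entry A 0 x (vs ! j))"
      using i by (simp add: idx_mat_def scalar_prod_def x_def lessThan_atLeast0)
    also have "\<dots> = (\<Sum>y\<in>set vs. lap_entry A 0 x y)"
      using sum.reindex_bij_betw[OF bij_betw_nth[OF vs(1) refl refl], of "lap_entry A 0 x"] .
    also have "\<dots> = of_nat (card {z. (x, z) \<in> A}) - of_nat (card (set vs \<inter> {y. (x, y) \<in> A}))"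
      using x by (simp add: lap_entry_def sum_subtractf of_bool_def sum.If_cases)
    also have "set vs \<inter> {y. (x, y) \<in> A} = {y. (x, y) \<in> A}"
      using closed x by auto
    finally show "(?L *\<^sub>v ?v) $ i = 0\<^sub>v ?n $ i"
      using i by simp
  qed (simp add: idx_mat_def)
  moreover have "?v \<noteq> 0\<^sub>v ?n"
  proof
    assume "?v = 0\<^sub>v ?n"
    then have "?v $ 0 = 0\<^sub>v ?n $ 0"
      by simp
    then show False
      using vs(2) by simp
  qed
  ultimately have "det ?L = 0"
    using det_0_iff_vec_prod_zero_field[OF idx_mat_carrier[of "lap_entry A 0" vs]] vec_carrier[of
        ?n "\<lambda>_. 1"] by blast
  then have "poly (char_poly ?L) 0 = 0"
    using poly_char_poly_lap_entry[OF vs(1), of A 0] by simp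
  then show ?thesis
    by (simp add: poly_eq_0_iff_dvd)
qed

text \<open>By symmetry the complement of a closed set is closed too. Listing one after the other
  makes the Laplacian block diagonal, and each block contributes a root 0.\<close>

lemma char_poly_disconnected:
  assumes V: "finite V" "A \<subseteq> V \<times> V" and A: "sym A" and disc: "\<not> connected_rel V A"
  shows "\<exists>ws. distinct ws \<and> set ws = V \<and> [:0, 1:]\<^sup>2 dvd char_poly (idx_mat (lap_entry A 0) ws)"
proof -
  obtain S where S: "S \<subseteq> V" "S \<noteq> {}" "S \<noteq> V" "\<And>x y. (x, y) \<in> A \<Longrightarrow> x \<in> S \<Longrightarrow> y \<in> S"
    using disc unfolding connected_rel_def by blast
  obtain xs where xs: "set xs = S" "distinct xs"
    using finite_distinct_list[OF finite_subset[OF S(1) V(1)]] by auto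
  obtain ys where ys: "set ys = V - S" "distinct ys"
    using finite_distinct_list[of "V - S"] V(1) by auto
  have S': "y \<in> V - S" if "(x, y) \<in> A" "x \<in> V - S" for x y
    using that S(4)[of y x] V(2) A by (auto dest: symD)
  have fin: "finite {z. (x, z) \<in> A}" for x
    by (rule finite_subset[OF _ V(1)]) (use V(2) in auto)
  have dist: "distinct (xs @ ys)"
    using xs ys by auto
  let ?c = "\<lambda>us. char_poly (idx_mat (lap_entry A 0) us)"
  have "?c (xs @ ys) = ?c xs * ?c ys"
  proof -
    have "poly (?c (xs @ ys)) \<mu> = poly (?c xs * ?c ys) \<mu>" for \<mu>
    proof -
      have "lap_entry A \<mu> x y = 0 \<and> lap_entry A \<mu> y x = 0" if "x \<in> set xs" "y \<in> set ys" for x y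
        using that xs ys S(4)[of x y] S'[of y x] by (auto simp: lap_entry_def)
      then show ?thesis
        unfolding poly_mult poly_char_poly_lap_entry[OF dist] poly_char_poly_lap_entry[OF xs(2)]
          poly_char_poly_lap_entry[OF ys(2)]
        by (subst det_idx_mat_append) (simp_all add: power_add)
    qed
    then show ?thesis
      by (simp add: poly_eq_poly_eq_iff[symmetric] fun_eq_iff)
  qed
  have "[:0, 1:] dvd ?c xs"
    by (rule char_poly_closed_component[OF xs(2) _ fin]) (use xs S in auto)
  moreover have "[:0, 1:] dvd ?c ys"
    by (rule char_poly_closed_component[OF ys(2) _ fin]) (use ys S S' in auto)
  ultimately have "[:0, 1:]\<^sup>2 dvd ?c (xs @ ys)"
    unfolding \<open>?c (xs @ ys) = ?c xs * ?c ys\<close> power2_eq_square by (rule mult_dvd_mono)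
  moreover have "set (xs @ ys) = V"
    using xs ys S(1) by auto
  ultimately show ?thesis
    using dist by blast
qed

lemma cheb_of_real_nonzero: "q \<ge> 2 \<Longrightarrow> cheb (of_real q :: complex) (Suc k) \<noteq> 0"
  using cheb_ge_2(3)[of q k] unfolding cheb_of_real by simp

text \<open>The two branch vertices do not affect the sign, so its exponent counts only the inner
  vertices.\<close>

lemma poly_char_poly_theta_cover:
  assumes pc: "path_cover V A {u, v} [(u, r1, v), (u, r2, v), (u, r3, v)]"
    and uv: "u \<noteq> v" and V: "finite V" "A \<subseteq> V \<times> V" and q: "q \<ge> 2"
  shows "poly (char_poly (idx_mat (lap_entry A 0) (r1 @ r2 @ r3 @ [u, v]))) (of_real (2 - q))
    = of_real ((-1) ^ (length r1 + length r2 + length r3) * theta_det q (length r1) (length r2)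
        (length r3))"
  using det_lap_entry_theta[OF pc uv V cheb_of_real_nonzero[OF q], of "of_real (2 - q)"]
    theta_cover_vertices[OF pc uv]
  by (simp add: poly_char_poly_lap_entry theta_det_of_real power_add)

lemma poly_char_poly_dumbbell_cover:
  assumes pc: "path_cover V A {u, v} [(u, r1, u), (v, r2, v), (u, r3, v)]"
    and uv: "u \<noteq> v" and V: "finite V" "A \<subseteq> V \<times> V" and q: "q \<ge> 2"
  shows "poly (char_poly (idx_mat (lap_entry A 0) (r1 @ r2 @ r3 @ [u, v]))) (of_real (2 - q))
    = of_real ((-1) ^ (length r1 + length r2 + length r3) * dumbbell_det q (length r1)
        (length r2) (length r3))"
  using det_lap_entry_dumbbell[OF pc uv V cheb_of_real_nonzero[OF q], of "of_real (2 - q)"]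
    theta_cover_vertices[OF pc uv]
  by (simp add: poly_char_poly_lap_entry dumbbell_det_of_real power_add)

text \<open>A double root at 0 would bound the value at -\<epsilon> by a constant times
  \<epsilon>^2, whereas \<open>theta_det_lower_bound\<close> makes it at least 2\<epsilon> in
  modulus.\<close>

lemma square_not_dvd_char_poly_theta:
  assumes pc: "path_cover V A {u, v} [(u, r1, v), (u, r2, v), (u, r3, v)]"
    and uv: "u \<noteq> v" and V: "finite V" "A \<subseteq> V \<times> V"
  shows "\<not> [:0, 1:]\<^sup>2 dvd char_poly (idx_mat (lap_entry A 0) (r1 @ r2 @ r3 @ [u, v]))"
    (is "\<not> _ dvd ?p")
proof
  assume "[:0, 1:]\<^sup>2 dvd ?p"
  then obtain g where g: "?p = [:0, 1:]\<^sup>2 * g"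
    by (elim dvdE)
  obtain B where B: "B > 0" "\<And>z. norm z \<le> 1 \<Longrightarrow> norm (poly g z) \<le> B"
    using poly_bound_exists[of 1 g] by blast
  \<comment> \<open>Small enough to stay in the unit disc, where B bounds the cofactor, and to give
    \<epsilon>^2 B \<le> \<epsilon> < 2\<epsilon>.\<close>
  define \<epsilon> where "\<epsilon> = min 1 (1 / B)"
  have \<epsilon>: "\<epsilon> > 0" "\<epsilon> \<le> 1" "\<epsilon> * B \<le> 1"
    using B(1) by (auto simp: \<epsilon>_def min_def field_simps)
  have "2 * \<epsilon> \<le> theta_det (2 + \<epsilon>) (length r1) (length r2) (length r3)"
    using theta_det_lower_bound[of \<epsilon>] \<epsilon>(1) by simp
  also have "\<dots> \<le> norm (poly ?p (of_real (2 - (2 + \<epsilon>))))"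
  proof -
    have "2 \<le> 2 + \<epsilon>"
      using \<epsilon>(1) by simp
    then show ?thesis
      by (simp only: poly_char_poly_theta_cover[OF pc uv V] norm_of_real abs_mult power_abs)
        (simp add: abs_ge_self)
  qed
  also have "poly ?p (of_real (2 - (2 + \<epsilon>))) = of_real (\<epsilon>\<^sup>2) * poly g (of_real (- \<epsilon>))"
    unfolding g by (simp add: poly_power)
  also have "norm \<dots> = \<epsilon>\<^sup>2 * norm (poly g (of_real (- \<epsilon>)))"
    by (simp add: norm_mult norm_power)
  also have "\<dots> \<le> \<epsilon>\<^sup>2 * B"
    using B(2)[of "of_real (- \<epsilon>)"] \<epsilon> by (intro mult_left_mono) auto
  also have "\<dots> = \<epsilon> * (\<epsilon> * B)"
    by (simp add: power2_eq_square)
  also have "\<dots> \<le> \<epsilon> * 1"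
    using \<epsilon> by (intro mult_left_mono) auto
  finally show False
    using \<epsilon>(1) by simp
qed

lemma dumbbell_det_commute: "dumbbell_det q i j k = dumbbell_det q j i k"
  unfolding dumbbell_det_def by (simp add: mult_ac)

lemma sort_three_lists:
  "\<exists>s1 s2 s3. mset [s1, s2, s3] = mset [r1, r2, r3] \<and> length s1 \<ge> length s2 \<and> length s2 \<ge> length s3"
proof -
  consider "length r1 \<ge> length r2" "length r2 \<ge> length r3" | "length r1 \<ge> length r3" "length r3
      \<ge> length r2"
    | "length r2 \<ge> length r1" "length r1 \<ge> length r3" | "length r2 \<ge> length r3" "length r3
        \<ge> length r1"
    | "length r3 \<ge> length r1" "length r1 \<ge> length r2" | "length r3 \<ge> length r2" "length r2
        \<ge> length r1"
    by linarith
  then show ?thesis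
  proof cases
    case 1 then show ?thesis by (intro exI[of _ r1] exI[of _ r2] exI[of _ r3]) simp
  next
    case 2 then show ?thesis by (intro exI[of _ r1] exI[of _ r3] exI[of _ r2]) simp
  next
    case 3 then show ?thesis by (intro exI[of _ r2] exI[of _ r1] exI[of _ r3]) simp
  next
    case 4 then show ?thesis by (intro exI[of _ r2] exI[of _ r3] exI[of _ r1]) simp
  next
    case 5 then show ?thesis by (intro exI[of _ r3] exI[of _ r1] exI[of _ r2]) simp
  next
    case 6 then show ?thesis by (intro exI[of _ r3] exI[of _ r2] exI[of _ r1]) simp
  qed
qed

theorem theorem1p2:
  fixes r s t :: nat and G :: "'a pair_pre_digraph"
  assumes "r \<ge> s" and "s \<ge> t" and "(s, t) \<noteq> (0, 0)"
    and "pair_graph G"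
    and "L_cospectral G (theta_graph r s t)"
  shows "digraph_iso (with_proj G) (with_proj (theta_graph r s t))"
proof -
  let ?H = "theta_graph r s t" and ?u = "0 :: nat" and ?v = "1 :: nat"
  note G = pair_graph_parcs[OF assms(4)] and H = pair_graph_parcs[OF pair_graph_theta_graph[of r
      s t]]
  \<comment> \<open>At most the third path is a bare edge, so the three edge sets are
    disjoint.\<close>
  have "s \<ge> 1" "r \<ge> 1"
    using assms(1-3) by auto
  from path_cover_theta_graph[OF this, of t]
  obtain s1 s2 s3 where pcH: "path_cover (pverts ?H) (parcs ?H) {?u, ?v} [(?u, s1, ?v), (?u, s2,
      ?v), (?u, s3, ?v)]"
    and lenH: "length s1 = r" "length s2 = s" "length s3 = t"
    using length_upt by (metis add_diff_cancel_left')
  have uv: "?u \<noteq> ?v"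
    by simp
  have uvH: "?u \<in> pverts ?H" "?v \<in> pverts ?H"
    using path_coverD(1)[OF pcH] by auto
  have degH: "card {z. (?u, z) \<in> parcs ?H} = 3" "card {z. (?v, z) \<in> parcs ?H} = 3"
    "\<And>w. w \<in> pverts ?H - {?u, ?v} \<Longrightarrow> card {z. (w, z) \<in> parcs ?H} = 2"
    using path_cover_degree[OF pcH H(4,3)] by simp_all
  obtain u v where uvG: "u \<noteq> v" "u \<in> pverts G" "v \<in> pverts G"
    and degG: "card {z. (u, z) \<in> parcs G} = 3" "card {z. (v, z) \<in> parcs G} = 3"
      "\<And>w. w \<in> pverts G - {u, v} \<Longrightarrow> card {z. (w, z) \<in> parcs G} = 2"
    using degrees_cospectral_theta[OF assms(4) pair_graph_theta_graph assms(5) uv uvH degH] by blast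
  let ?ws = "s1 @ s2 @ s3 @ [?u, ?v]"
  let ?pH = "char_poly (idx_mat (lap_entry (parcs ?H) 0) ?ws)"
  note wsH = theta_cover_vertices[OF pcH uv]
  have charG: "char_poly (idx_mat (lap_entry (parcs G) 0) vs) = ?pH" "length vs = r + s + t + 2"
    if "distinct vs" "set vs = pverts G" for vs
    using L_cospectral_char_poly[OF assms(5) that wsH]
    unfolding laplacian_mat_eq_idx_mat[OF that(1)] laplacian_mat_eq_idx_mat[OF wsH(1)] by
        (simp_all add: lenH)
  have conn: "connected_rel (pverts G) (parcs G)"
  proof (rule ccontr)
    assume "\<not> ?thesis"
    from char_poly_disconnected[OF G(4,3,2) this] obtain vs where vs: "distinct vs" "set vs
        = pverts G"
      "[:0, 1:]\<^sup>2 dvd char_poly (idx_mat (lap_entry (parcs G) 0) vs)"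
      by blast
    then show False
      using square_not_dvd_char_poly_theta[OF pcH uv H(4,3)] charG(1)[OF vs(1,2)] by simp
  qed
  have pH: "poly ?pH (of_real (2 - q)) = of_real ((-1) ^ (r + s + t)
      * theta_det q r s t)" if "q > 2" for q
    using poly_char_poly_theta_cover[OF pcH uv H(4,3), of q] that by (simp add: lenH)
  from theta_or_dumbbell[OF G(4,3,2,1) conn uvG degG]
  obtain r1 r2 r3 where
    "path_cover (pverts G) (parcs G) {u, v} [(u, r1, v), (u, r2, v), (u, r3, v)] \<or>
     path_cover (pverts G) (parcs G) {u, v} [(u, r1, u), (v, r2, v), (u, r3, v)]"
    by blast
  then show ?thesis
  proof
    assume pc0: "path_cover (pverts G) (parcs G) {u, v} [(u, r1, v), (u, r2, v), (u, r3, v)]"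
    \<comment> \<open>The cover lists its paths in no particular order; they are sorted by length to
      match r \<ge> s \<ge> t.\<close>
    obtain q1 q2 q3 where q: "mset [q1, q2, q3] = mset [r1, r2, r3]" "length q1
        \<ge> length q2" "length q2 \<ge> length q3"
      using sort_three_lists[of r1 r2 r3] by blast
    have "mset (map (\<lambda>p. (u, p, v)) [q1, q2, q3]) = mset (map (\<lambda>p. (u, p, v)) [r1, r2, r3])"
      unfolding mset_map q(1) ..
    then have pc: "path_cover (pverts G) (parcs G) {u, v} [(u, q1, v), (u, q2, v), (u, q3, v)]"
      by (intro path_cover_mset[OF pc0]) simp
    note vs = theta_cover_vertices[OF pc uvG(1)]
    have len: "length q1 + length q2 + length q3 = r + s + t"
      using charG(2)[OF vs] by simp
    have "length q1 = r \<and> length q2 = s \<and> length q3 = t"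
    proof (rule theta_det_inj[OF q(2,3) assms(1,2) len])
      fix q :: real assume "q > 2"
      then have "complex_of_real ((-1) ^ (r + s + t) * theta_det q (length q1) (length q2)
          (length q3))
          = of_real ((-1) ^ (r + s + t) * theta_det q r s t)"
        using poly_char_poly_theta_cover[OF pc uvG(1) G(4,3),
            of q] pH[of q] charG(1)[OF vs] len by simp
      then show "theta_det q (length q1) (length q2) (length q3) = theta_det q r s t"
        unfolding of_real_eq_iff by simp
    qed
    then obtain f where "bij_betw f (pverts G) (pverts ?H)"
      "\<forall>x\<in>pverts G. \<forall>y\<in>pverts G. (x, y) \<in> parcs G \<longleftrightarrow> (f x, f y) \<in> parcs ?H"
      using theta_cover_iso[OF pc uvG(1) pcH uv] lenH by auto
    then show ?thesis
      by (intro digraph_isoI[OF assms(4) pair_graph_theta_graph]) auto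
  next
    assume pc: "path_cover (pverts G) (parcs G) {u, v} [(u, r1, u), (v, r2, v), (u, r3, v)]"
    note vs = theta_cover_vertices[OF pc uvG(1)]
    have len: "length r1 + length r2 + length r3 = r + s + t"
      using charG(2)[OF vs] by simp
    \<comment> \<open>A closed path without inner vertices would be a loop; this supplies the bound
      p \<ge> 2 for the cycle lengths.\<close>
    have ne: "r1 \<noteq> []" "r2 \<noteq> []"
      using path_coverD(2)[OF pc, of u u] path_coverD(2)[OF pc, of v v] irreflD[OF G(1),
          of u] irreflD[OF G(1), of v]
      by auto
    have eq: "theta_det q r s t = dumbbell_det q (length r1) (length r2)
        (length r3)" if "q > 2" for q :: real
    proof -
      have "complex_of_real ((-1) ^ (r + s + t) * dumbbell_det q (length r1) (length r2)
          (length r3))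
          = of_real ((-1) ^ (r + s + t) * theta_det q r s t)"
        using poly_char_poly_dumbbell_cover[OF pc uvG(1) G(4,3),
            of q] pH[OF that] charG(1)[OF vs] len that by simp
      then show ?thesis
        unfolding of_real_eq_iff by simp
    qed
    \<comment> \<open>The comparison expects the shorter cycle first; the determinant is symmetric
      in the two cycles.\<close>
    have False
    proof (cases "length r1 \<le> length r2")
      case True
      show False
        by (rule theta_det_neq_dumbbell_det[OF assms(1,2) True _ _ eq])
            (use ne len in \<open>auto simp: Suc_le_eq\<close>)
    next
      case False
      then have le: "length r2 \<le> length r1" by simp
      show False
        by (rule theta_det_neq_dumbbell_det[OF assms(1,2) le _ _ eq[unfolded
            dumbbell_det_commute[of _ "length r1"]]])
          (use ne len in \<open>auto simp: Suc_le_eq\<close>)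
    qed
    then show ?thesis ..
  qed
qed

end
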